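(* Fix $\kappa>0$ and an integer $l\ge1$, and let $L=\{1,\dots,l\}$. For $N>l$, let $\Upsilon$ be a random spanning tree of $K_N\cup\{\Delta\}$ with law $\mathbb P^{(N),\kappa}$, and let $\Upsilon_L$, $L^*$, $Q_L$, $u_L$, $\mathcal B_l$, $c_l$ be as described in the context. Then: (a) $\mathbb P^{(N),\kappa}(L^*=L)\to1$ as $N\to\infty$. (b) For every $\alpha\in\mathcal B_l$, $\lim_{N\to\infty}\mathbb P^{(N),\kappa}(Q_L=\alpha)=c_l^{-1}$, i.e. the law of $Q_L$ converges to the uniform distribution on $\mathcal B_l$. (c) For every $\alpha\in\mathcal B_l$ and every $t=(t_1,\dots,t_{2l-1})\in\mathbb R_+^{2l-1}$, \[ \lim_{N\to\infty}N^{(2l-1)/2}\,\mathbb P^{(N),\kappa}\bigl(Q_L=\alpha,\ u_L=[t\sqrt N]\bigr)=\Bigl(\sum_{i=1}^{2l-1}t_i\Bigr)\exp\Bigl(-\tfrac12\Bigl(\sum_{i=1}^{2l-1}t_i\Bigr)^2\Bigr), \] where $[t\sqrt N]=([t_1\sqrt N],\dots,[t_{2l-1}\sqrt N])$ (componentwise integer parts).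
   Context: $K_N\cup\{\Delta\}$ is the complete graph on vertices $\{1,\dots,N,\Delta\}$; $\mathbb P^{(N),\kappa}$ is the probability on its spanning trees $T$ with $\mathbb P^{(N),\kappa}(T)\propto\kappa^{\deg_T(\Delta)}$. Trees are rooted at $\Delta$; the parent of $x\neq\Delta$ is its neighbour on the path to $\Delta$, children of $x$ are vertices whose parent is $x$. $\Upsilon_L$ is the smallest subtree of $\Upsilon$ containing $L\cup\{\Delta\}$; $L^*\subseteq L$ is its set of vertices other than $\Delta$ having no children. A node is a vertex of $\Upsilon_L$ with at least two children. The $L$-reduction of $\Upsilon_L$ is the tree whose vertices are $\Delta$, the elements of $L$ and the nodes, where each such vertex $v\neq\Delta$ is joined to the first such vertex strictly below it (on the path to $\Delta$). $Q_L$ is the equivalence class of this reduction under relabelling by permutations of $\{l+1,\dots,N\}$ (i.e. its shape, with only the labels in $L$ retained). A class is binary if $L^*=L$, every vertex other than $\Delta$ and the leaves has exactly two children, and $\Delta$ has exactly one child; $\mathcal B_l$ is the set of binary classes, and $c_l=|\mathcal B_l|=\prod_{i=1}^{l-1}(2i-1)$. A binary class has $2l-1$ edges, enumerated in a fixed order determined by the class (via the order of $L$). When $Q_L=\alpha\in\mathcal B_l$, $u_L\in\mathbb N^{2l-1}$ records, for each edge of the reduction, the number of intermediate vertices of $\Upsilon_L$ lying strictly between its endpoints. *)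

theory Defs
  imports "HOL-Probability.Probability" "HOL-Library.Nat_Bijection" "HOL-Combinatorics.Permutations"
begin

text \<open>A finite graph is a pair of a vertex set and a set of edges, an edge being a two-element set
  of vertices. The vertex \<open>\<Delta>\<close> is coded as \<open>0\<close>, so that the vertex set of \<open>K\<^sub>N \<union> {\<Delta>}\<close> is \<open>{0..N}\<close>.\<close>

type_synonym ugraph = "nat set \<times> nat set set"

abbreviation (input) Delta :: nat (\<open>\<Delta>\<close>) where "\<Delta> \<equiv> 0"

definition complete_edges :: "nat set \<Rightarrow> nat set set" where
  "complete_edges V = {{u, v} | u v. u \<in> V \<and> v \<in> V \<and> u \<noteq> v}"

definition is_path :: "nat set set \<Rightarrow> nat \<Rightarrow> nat list \<Rightarrow> nat \<Rightarrow> bool" where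
  "is_path E u xs v \<longleftrightarrow> xs \<noteq> [] \<and> hd xs = u \<and> last xs = v \<and> distinct xs \<and>
     successively (\<lambda>x y. {x, y} \<in> E) xs"

definition is_cycle :: "nat set set \<Rightarrow> nat list \<Rightarrow> bool" where
  "is_cycle E xs \<longleftrightarrow> length xs \<ge> 3 \<and> distinct xs \<and>
     successively (\<lambda>x y. {x, y} \<in> E) xs \<and> {last xs, hd xs} \<in> E"

definition is_tree :: "ugraph \<Rightarrow> bool" where
  "is_tree G \<longleftrightarrow> finite (fst G) \<and> fst G \<noteq> {} \<and> snd G \<subseteq> complete_edges (fst G) \<and>
     (\<forall>u\<in>fst G. \<forall>v\<in>fst G. \<exists>xs. is_path (snd G) u xs v) \<and> (\<nexists>xs. is_cycle (snd G) xs)"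

definition spanning_trees :: "nat \<Rightarrow> nat set set set" where
  "spanning_trees N = {T. is_tree ({0..N}, T)}"

definition degree_in :: "nat set set \<Rightarrow> nat \<Rightarrow> nat" where
  "degree_in E v = card {e \<in> E. v \<in> e}"

definition tree_law :: "nat \<Rightarrow> real \<Rightarrow> nat set set pmf" where
  "tree_law N \<kappa> = embed_pmf (\<lambda>T. if T \<in> spanning_trees N
      then \<kappa> ^ degree_in T \<Delta> / (\<Sum>S\<in>spanning_trees N. \<kappa> ^ degree_in S \<Delta>) else 0)"

definition path_to_root :: "nat set set \<Rightarrow> nat \<Rightarrow> nat list" where
  "path_to_root E x = (THE xs. is_path E x xs \<Delta>)"

definition parent :: "nat set set \<Rightarrow> nat \<Rightarrow> nat" where
  "parent E x = path_to_root E x ! 1"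

definition children :: "ugraph \<Rightarrow> nat \<Rightarrow> nat set" where
  "children G x = {y \<in> fst G - {\<Delta>}. parent (snd G) y = x}"

definition childless :: "ugraph \<Rightarrow> nat set" where
  "childless G = {v \<in> fst G - {\<Delta>}. children G v = {}}"

definition nodes :: "ugraph \<Rightarrow> nat set" where
  "nodes G = {v \<in> fst G. card (children G v) \<ge> 2}"

text \<open>The smallest subtree of \<open>T\<close> containing \<open>L \<union> {\<Delta>}\<close>, as the intersection of all such subtrees.\<close>

definition subtrees_containing :: "nat set \<Rightarrow> nat set set \<Rightarrow> ugraph set" where
  "subtrees_containing L T = {G. is_tree G \<and> snd G \<subseteq> T \<and> insert \<Delta> L \<subseteq> fst G}"

definition spanned_subtree :: "nat set \<Rightarrow> nat set set \<Rightarrow> ugraph" where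
  "spanned_subtree L T =
     (\<Inter> (fst ` subtrees_containing L T), \<Inter> (snd ` subtrees_containing L T))"

definition retained :: "nat set \<Rightarrow> ugraph \<Rightarrow> nat set" where
  "retained L G = insert \<Delta> (L \<union> nodes G)"

definition first_below :: "nat set \<Rightarrow> ugraph \<Rightarrow> nat \<Rightarrow> nat" where
  "first_below L G v = hd (dropWhile (\<lambda>w. w \<notin> retained L G) (tl (path_to_root (snd G) v)))"

definition num_between :: "nat set \<Rightarrow> ugraph \<Rightarrow> nat \<Rightarrow> nat" where
  "num_between L G v = length (takeWhile (\<lambda>w. w \<notin> retained L G) (tl (path_to_root (snd G) v)))"

definition reduction :: "nat set \<Rightarrow> ugraph \<Rightarrow> ugraph" where
  "reduction L G = (retained L G, (\<lambda>v. {v, first_below L G v}) ` (retained L G - {\<Delta>}))"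

definition relabel :: "(nat \<Rightarrow> nat) \<Rightarrow> ugraph \<Rightarrow> ugraph" where
  "relabel \<pi> G = (\<pi> ` fst G, (`) \<pi> ` snd G)"

text \<open>Relabelling uses permutations of all labels above \<open>l\<close>, so that classes for different \<open>N\<close> can be
  compared. Two trees with labels in \<open>{0..N}\<close> have the same class iff they differ by a
  permutation of \<open>{l+1..N}\<close>.\<close>

definition tree_class :: "nat \<Rightarrow> ugraph \<Rightarrow> ugraph set" where
  "tree_class l G = {relabel \<pi> G | \<pi>. \<pi> permutes {l<..}}"

definition is_binary :: "nat \<Rightarrow> ugraph \<Rightarrow> bool" where
  "is_binary l G \<longleftrightarrow> is_tree G \<and> \<Delta> \<in> fst G \<and> childless G = {1..l} \<and>
     (\<forall>v \<in> fst G - {\<Delta>} - childless G. card (children G v) = 2) \<and> card (children G \<Delta>) = 1"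

definition binary_classes :: "nat \<Rightarrow> ugraph set set" where
  "binary_classes l = {tree_class l G | G. is_binary l G}"

definition num_binary :: "nat \<Rightarrow> nat" where
  "num_binary l = card (binary_classes l)"

definition L_star :: "nat \<Rightarrow> nat set set \<Rightarrow> nat set" where
  "L_star l T = childless (spanned_subtree {1..l} T)"

definition Q_class :: "nat \<Rightarrow> nat set set \<Rightarrow> ugraph set" where
  "Q_class l T = tree_class l (reduction {1..l} (spanned_subtree {1..l} T))"

text \<open>An edge is identified with its endpoint \<open>v\<close> farther from \<open>\<Delta>\<close>. In a binary tree \<open>v\<close> is determined by
  the set of leaves whose path to \<open>\<Delta>\<close> passes through \<open>v\<close>. The edges are listed in the order of
  the binary codes of these leaf sets, i.e. two sets are compared by the largest label in which they
  differ; this order does not depend on the representative of the class.\<close>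

definition leaves_above :: "nat \<Rightarrow> ugraph \<Rightarrow> nat \<Rightarrow> nat set" where
  "leaves_above l R v = {x \<in> {1..l}. v \<in> set (path_to_root (snd R) x)}"

definition edge_list :: "nat \<Rightarrow> ugraph \<Rightarrow> nat list" where
  "edge_list l R = sorted_key_list_of_set (\<lambda>v. set_encode (leaves_above l R v)) (fst R - {\<Delta>})"

definition u_vec :: "nat \<Rightarrow> nat set set \<Rightarrow> nat list" where
  "u_vec l T = (let G = spanned_subtree {1..l} T in
     map (num_between {1..l} G) (edge_list l (reduction {1..l} G)))"

lemma finite_spanning_trees: "finite (spanning_trees N)"
proof -
  have "spanning_trees N \<subseteq> Pow (Pow {0..N})"
    by (auto simp: spanning_trees_def is_tree_def complete_edges_def)
  thus ?thesis by (rule finite_subset) auto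
qed

lemma star_spanning_tree: "(\<lambda>v. {0, v}) ` {1..N} \<in> spanning_trees N"
proof -
  let ?T = "(\<lambda>v. {0::nat, v}) ` {1..N}"
  have mem: "{x, y} \<in> ?T \<longleftrightarrow> (x = 0 \<and> y \<in> {1..N}) \<or> (y = 0 \<and> x \<in> {1..N})" for x y
    by (auto simp: doubleton_eq_iff image_iff)
  have "\<exists>xs. is_path ?T u xs v" if "u \<in> {0..N}" "v \<in> {0..N}" for u v
  proof (cases "u = v")
    case True
    thus ?thesis by (intro exI[of _ "[u]"]) (simp add: is_path_def)
  next
    case False
    show ?thesis
    proof (cases "u = 0 \<or> v = 0")
      case True
      thus ?thesis using False that
        by (intro exI[of _ "[u, v]"]) (auto simp: is_path_def mem)
    next
      case no: False
      thus ?thesis using False that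
        by (intro exI[of _ "[u, 0, v]"]) (auto simp: is_path_def mem)
    qed
  qed
  moreover have "\<not> is_cycle ?T xs" for xs
  proof
    assume c: "is_cycle ?T xs"
    then obtain a b c' ys where xs: "xs = a # b # c' # ys"
      by (cases xs; cases "tl xs"; cases "tl (tl xs)") (auto simp: is_cycle_def)
    have "{a, b} \<in> ?T" "{b, c'} \<in> ?T" "{last xs, a} \<in> ?T" "distinct (a # b # c' # ys)"
      using c unfolding xs is_cycle_def by simp_all
    moreover have "last xs \<in> set (c' # ys)"
      unfolding xs by (metis last.simps last_in_set list.distinct(1))
    ultimately show False unfolding mem by (metis distinct.simps(2) list.set_intros(1,2))
  qed
  moreover have "?T \<subseteq> complete_edges {0..N}"
    by (force simp: complete_edges_def)
  ultimately show ?thesis by (auto simp: spanning_trees_def is_tree_def)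
qed

lemma pmf_tree_law:
  assumes "\<kappa> > 0"
  shows "pmf (tree_law N \<kappa>) T = (if T \<in> spanning_trees N
      then \<kappa> ^ degree_in T \<Delta> / (\<Sum>S\<in>spanning_trees N. \<kappa> ^ degree_in S \<Delta>) else 0)"
proof -
  let ?Z = "\<Sum>S\<in>spanning_trees N. \<kappa> ^ degree_in S \<Delta>"
  let ?f = "\<lambda>T. if T \<in> spanning_trees N then \<kappa> ^ degree_in T \<Delta> / ?Z else 0"
  have Z: "?Z > 0"
    using assms star_spanning_tree[of N] by (intro sum_pos) (auto simp: finite_spanning_trees)
  have nn: "?f T \<ge> 0" for T using assms Z by simp
  have "(\<integral>\<^sup>+T. ennreal (?f T) \<partial>count_space UNIV) = (\<Sum>T\<in>spanning_trees N. ennreal (?f T))"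
    by (rule nn_integral_count_space'[OF finite_spanning_trees]) auto
  also have "\<dots> = ennreal (\<Sum>T\<in>spanning_trees N. ?f T)"
    by (rule sum_ennreal) (use nn in blast)
  also have "(\<Sum>T\<in>spanning_trees N. ?f T) = 1"
    using Z by (simp flip: sum_divide_distrib)
  finally show ?thesis unfolding tree_law_def
    by (subst pmf_embed_pmf) (use nn in auto)
qed

end

theory Submission
  imports Defs "HOL-Combinatorics.Multiset_Permutations" "HOL-Real_Asymp.Real_Asymp"
begin

text \<open>A spanning tree is a parent function \<open>f\<close> on \<open>{1..N}\<close> all of whose orbits reach \<open>0\<close>. Prescribing
  \<open>f\<close> on a set \<open>D\<close> that is closed under parents, and contracting \<open>D\<close> to the root, leaves a sum over rooted
  functions whose value can be computed for an arbitrary function of the multiset of values, by assigning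
  one parent at a time. With weights \<open>\<kappa>\<close> this shows that a given subtree with \<open>s\<close> vertices besides \<open>0\<close>, one
  of them adjacent to \<open>0\<close>, is contained in the random tree with probability \<open>(\<kappa> + s) / (\<kappa> + N)^s\<close>. A
  binary class together with \<open>u\<close> is realised by \<open>(N - l)(N - l - 1) \<cdots> (N - s + 1)\<close> subtrees, where
  \<open>s = 2 l - 1 + \<Sum>u\<close>, because binary trees with labelled leaves have no automorphisms. Hence
  the probability in (c) is explicit.

  The numbers \<open>a\<^sub>m = (N - l)(N - l - 1) \<cdots> (N - s + 1) / (\<kappa> + N)^s\<close>, with \<open>s = 2 l - 1 + m\<close>, satisfy \<open>(\<kappa> + s) a\<^sub>m = (\<kappa> + N) (a\<^sub>m - a\<^sub>m\<^sub>+\<^sub>1)\<close>. Summation by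
  parts thus gives a two-step recursion for their binomial moments, and the probability of every class converges to
  \<open>1 / (1 \<cdot> 3 \<cdots> (2 l - 3))\<close>. The same counting, with prescribed indegrees and \<open>N = 2 l - 1\<close>, shows that
  there are \<open>1 \<cdot> 3 \<cdots> (2 l - 3)\<close> classes. They therefore exhaust the total mass, which gives (a).\<close>

section \<open>Trees as parent functions\<close>

text \<open>The limit in (c) alone does not yield (b): summing it over all \<open>u\<close> would
  call for a bound uniform in \<open>u\<close> and then for a Gaussian integral. The exact
  probability avoids both. Summed over \<open>u\<close>, it turns by parts into the moment of index
  2 l - 2 in the numbering of \<open>ysum\<close>, which is even. To leading order the recursion
  joins moments of equal parity, and on the even side it starts from the coefficient at m = 0
  itself, so that only the factors 1, 3, ..., 2 l - 3 appear. The odd moments, where a square root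
  of \<pi> would come in, carry a factor of order N^(-1/2); for them a bound is enough. The sum over
  rooted functions is evaluated for a general function of the multiset of values because two cases
  occur: a power of \<kappa> that counts the value 0, and the indicator of a prescribed multiset. A
  class is known only up to labels above \<open>l\<close>, and the spanned subtree is an
  intersection. Hence the work between counting and asymptotics: computing these objects by
  iterating a parent function, and matching each tree of a class with a labelling of the subdivided
  representative.\<close>

inductive reach :: "nat set \<Rightarrow> (nat \<Rightarrow> nat) \<Rightarrow> nat \<Rightarrow> bool" for V p where
  root: "reach V p 0"
| step: "v \<in> V \<Longrightarrow> reach V p (p v) \<Longrightarrow> reach V p v"

text \<open>One condition covers both acyclicity and connectedness. Closure of \<open>V\<close>
  under \<open>p\<close> follows from it, since \<open>reach\<close> lets an orbit pass only through
  \<open>V\<close>.\<close>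

definition rooted :: "nat set \<Rightarrow> (nat \<Rightarrow> nat) \<Rightarrow> bool" where
  "rooted V p \<longleftrightarrow> finite V \<and> 0 \<notin> V \<and> (\<forall>v\<in>V. reach V p v)"

definition pedges :: "nat set \<Rightarrow> (nat \<Rightarrow> nat) \<Rightarrow> nat set set" where
  "pedges V p = (\<lambda>v. {v, p v}) ` V"

definition pgraph :: "nat set \<Rightarrow> (nat \<Rightarrow> nat) \<Rightarrow> ugraph" where
  "pgraph V p = (insert 0 V, pedges V p)"

abbreviation ptr :: "nat set \<Rightarrow> (nat \<Rightarrow> nat) \<Rightarrow> nat \<Rightarrow> nat list" where
  "ptr V p \<equiv> path_to_root (pedges V p)"

lemma fst_pgraph [simp]: "fst (pgraph V p) = insert 0 V"
  and snd_pgraph [simp]: "snd (pgraph V p) = pedges V p"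
  by (simp_all add: pgraph_def)

lemma reach_insert: "reach V p v \<Longrightarrow> v \<in> insert 0 V"
  by (cases rule: reach.cases) auto

lemma rooted_finite: "rooted V p \<Longrightarrow> finite V"
  and rooted_zero: "rooted V p \<Longrightarrow> 0 \<notin> V"
  by (auto simp: rooted_def)

lemma rooted_reach: "rooted V p \<Longrightarrow> v \<in> insert 0 V \<Longrightarrow> reach V p v"
  by (auto simp: rooted_def intro: reach.root)

lemma rooted_closed:
  assumes "rooted V p" "v \<in> V"
  shows "p v \<in> insert 0 V"
proof -
  have "reach V p v" using assms by (simp add: rooted_reach)
  thus ?thesis
    by (cases rule: reach.cases) (use assms in \<open>auto simp: rooted_def dest: reach_insert\<close>)
qed

lemma rooted_induct [consumes 2, case_names root step]:
  assumes "rooted V p" "v \<in> insert 0 V"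
    and "P 0" "\<And>v. v \<in> V \<Longrightarrow> p v \<in> insert 0 V \<Longrightarrow> P (p v) \<Longrightarrow> P v"
  shows "P v"
proof -
  have "reach V p v" using assms by (simp add: rooted_reach)
  thus ?thesis by induction (use assms rooted_closed in blast)+
qed

lemma rooted_cong:
  assumes "\<And>v. v \<in> V \<Longrightarrow> p v = q v"
  shows "rooted V p \<longleftrightarrow> rooted V q"
proof -
  have "reach V q v" if "reach V p v" "\<And>v. v \<in> V \<Longrightarrow> p v = q v" for p q v
    using that by induction (auto intro: reach.intros)
  thus ?thesis unfolding rooted_def using assms by metis
qed

lemma pedges_cong: "(\<And>v. v \<in> V \<Longrightarrow> p v = q v) \<Longrightarrow> pedges V p = pedges V q"
  by (auto simp: pedges_def)

lemma rooted_subset: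
  assumes "rooted V p" "S \<subseteq> V" "\<And>v. v \<in> S \<Longrightarrow> p v \<in> insert 0 S"
  shows "rooted S p"
proof -
  have "v \<in> insert 0 S \<longrightarrow> reach S p v" if "v \<in> insert 0 V" for v
    using assms(1) that
  proof (induction rule: rooted_induct)
    case (step v)
    thus ?case using assms(3)[of v] by (cases "v = 0") (auto intro: reach.intros)
  qed (auto intro: reach.root)
  thus ?thesis using assms finite_subset by (auto simp: rooted_def)
qed

section \<open>Paths to the root as orbits of the parent function\<close>

inductive rpath :: "nat set \<Rightarrow> (nat \<Rightarrow> nat) \<Rightarrow> nat \<Rightarrow> nat list \<Rightarrow> bool" for V p where
  root: "rpath V p 0 [0]"
| step: "v \<in> V \<Longrightarrow> rpath V p (p v) xs \<Longrightarrow> rpath V p v (v # xs)"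

lemma rpath_unique:
  assumes "0 \<notin> V"
  shows "rpath V p v xs \<Longrightarrow> rpath V p v ys \<Longrightarrow> xs = ys"
proof (induction arbitrary: ys rule: rpath.induct)
  case root
  thus ?case by (cases rule: rpath.cases) (use assms in auto)
next
  case (step v xs)
  note IH = step.IH
  from step.prems show ?case
  proof (cases rule: rpath.cases)
    case root
    thus ?thesis using step.hyps(1) assms by simp
  next
    case (step zs)
    thus ?thesis using IH by blast
  qed
qed

lemma rpath_exists:
  assumes "rooted V p" "v \<in> insert 0 V"
  shows "\<exists>xs. rpath V p v xs"
  using assms
proof (induction rule: rooted_induct)
  case root
  show ?case using rpath.root by blast
next
  case (step v)
  thus ?case using rpath.step by blast
qed

lemma rpath_mem: "rpath V p v xs \<Longrightarrow> w \<in> set xs \<Longrightarrow> \<exists>ys. rpath V p w ys \<and> length ys \<le> length xs"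
proof (induction rule: rpath.induct)
  case root
  thus ?case using rpath.root[of V p] by (intro exI[of _ "[0]"]) simp
next
  case (step v xs)
  show ?case
  proof (cases "w = v")
    case True
    thus ?thesis using rpath.step[OF step.hyps] by auto
  next
    case False
    then obtain ys where "rpath V p w ys" "length ys \<le> length xs" using step by auto
    thus ?thesis by auto
  qed
qed

text \<open>A repeated vertex \<open>v\<close> would have a second orbit to \<open>0\<close>, no
  longer than the tail, against \<open>rpath_unique\<close>.\<close>

lemma rpath_distinct:
  assumes "0 \<notin> V"
  shows "rpath V p v xs \<Longrightarrow> distinct xs"
proof (induction rule: rpath.induct)
  case (step v xs)
  have "v \<notin> set xs"
  proof
    assume "v \<in> set xs"
    then obtain ys where "rpath V p v ys" "length ys \<le> length xs"
      using rpath_mem step by blast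
    moreover have "rpath V p v (v # xs)" using step.hyps by (rule rpath.step)
    ultimately have "ys = v # xs" using rpath_unique assms by blast
    thus False using \<open>length ys \<le> length xs\<close> by simp
  qed
  thus ?case using step by simp
qed auto

lemma rpath_hd: "rpath V p v xs \<Longrightarrow> xs \<noteq> [] \<and> hd xs = v"
  by (cases rule: rpath.cases) auto

lemma rpath_is_path:
  assumes "0 \<notin> V"
  shows "rpath V p v xs \<Longrightarrow> is_path (pedges V p) v xs 0"
proof (induction rule: rpath.induct)
  case (step v xs)
  have "distinct (v # xs)" using rpath_distinct[OF assms] rpath.step[OF step.hyps] by blast
  thus ?case using step rpath_hd[OF step.hyps(2)]
    by (cases xs) (auto simp: is_path_def pedges_def)
qed (auto simp: is_path_def)

lemma pedges_mem: "{x, y} \<in> pedges V p \<longleftrightarrow> (x \<in> V \<and> p x = y) \<or> (y \<in> V \<and> p y = x)"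
  by (auto simp: pedges_def doubleton_eq_iff)

text \<open>The first edge of a simple path to \<open>0\<close> cannot lead from \<open>x\<close> to
  a child \<open>y\<close> of \<open>x\<close>: by induction the rest is the orbit of
  \<open>y\<close>, which returns to \<open>x\<close>.\<close>

lemma is_path_rpath:
  assumes "0 \<notin> V"
  shows "is_path (pedges V p) v xs 0 \<Longrightarrow> rpath V p v xs"
proof (induction xs arbitrary: v)
  case (Cons x xs)
  show ?case
  proof (cases xs)
    case Nil
    thus ?thesis using Cons.prems rpath.root by (auto simp: is_path_def)
  next
    case (Cons y ys)
    have "is_path (pedges V p) y xs 0" "x = v" and e: "{x, y} \<in> pedges V p"
      and d: "x \<notin> set xs"
      using Cons.prems by (auto simp: is_path_def Cons)
    hence r: "rpath V p y xs" using Cons.IH by blast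
    have "x \<in> V \<and> p x = y"
    proof (rule ccontr)
      assume "\<not> ?thesis"
      hence y: "y \<in> V" "p y = x" using e by (auto simp: pedges_mem)
      from r show False
      proof (cases rule: rpath.cases)
        case (step zs)
        hence "x \<in> set zs" using rpath_hd[of V p "p y" zs] y by (metis hd_in_set)
        thus False using step d by auto
      qed (use y assms in auto)
    qed
    thus ?thesis using r \<open>x = v\<close> rpath.step[of v V p xs] by auto
  qed
qed (simp add: is_path_def)

text \<open>This resolves the description in \<open>path_to_root\<close>: simple paths to
  \<open>0\<close> and orbits are the same lists.\<close>

lemma path_to_root_rpath:
  assumes "rooted V p" "rpath V p v xs"
  shows "ptr V p v = xs"
  unfolding path_to_root_def
proof (rule the_equality)
  have z: "0 \<notin> V" by (rule rooted_zero[OF assms(1)])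
  show "is_path (pedges V p) v xs 0" by (rule rpath_is_path[OF z assms(2)])
  show "ys = xs" if "is_path (pedges V p) v ys 0" for ys
    by (rule rpath_unique[OF z is_path_rpath[OF z that] assms(2)])
qed

lemma path_to_root_zero:
  assumes "rooted V p"
  shows "ptr V p 0 = [0]"
  by (rule path_to_root_rpath[OF assms rpath.root])

lemma path_to_root_step:
  assumes "rooted V p" "v \<in> V"
  shows "ptr V p v = v # ptr V p (p v)"
proof -
  obtain xs where xs: "rpath V p (p v) xs"
    using rpath_exists[OF assms(1) rooted_closed[OF assms]] by blast
  show ?thesis
    using path_to_root_rpath[OF assms(1) xs] path_to_root_rpath[OF assms(1) rpath.step[OF assms(2) xs]]
    by simp
qed

lemma path_to_root_Cons:
  assumes "rooted V p" "v \<in> insert 0 V"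
  shows "\<exists>xs. ptr V p v = v # xs"
  using path_to_root_zero[OF assms(1)] path_to_root_step[OF assms(1), of v] assms(2) by auto

lemma is_path_path_to_root:
  assumes "rooted V p" "v \<in> insert 0 V"
  shows "is_path (pedges V p) v (ptr V p v) 0"
proof -
  obtain xs where xs: "rpath V p v xs" using rpath_exists[OF assms] by blast
  show ?thesis
    using path_to_root_rpath[OF assms(1) xs] rpath_is_path[OF rooted_zero[OF assms(1)] xs] by simp
qed

lemma is_path_unique:
  assumes "rooted V p" "is_path (pedges V p) v xs 0"
  shows "xs = ptr V p v"
  using path_to_root_rpath[OF assms(1) is_path_rpath[OF rooted_zero[OF assms(1)] assms(2)]] by simp

lemma set_path_to_root:
  assumes "rooted V p" "v \<in> insert 0 V"
  shows "set (ptr V p v) \<subseteq> insert 0 V"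
  using assms
  by (induction rule: rooted_induct)
    (auto simp: path_to_root_zero[OF assms(1)] path_to_root_step[OF assms(1)])

lemma parent_pedges:
  assumes "rooted V p" "v \<in> V"
  shows "parent (pedges V p) v = p v"
proof -
  have "p v \<in> insert 0 V" by (rule rooted_closed[OF assms])
  then obtain xs where "ptr V p (p v) = p v # xs"
    using path_to_root_Cons assms by blast
  thus ?thesis by (simp add: parent_def path_to_root_step[OF assms])
qed

lemma children_pgraph:
  assumes "rooted V p"
  shows "children (pgraph V p) x = {y \<in> V. p y = x}"
  using assms parent_pedges[OF assms] rooted_zero[OF assms] by (auto simp: children_def)

section \<open>Depth, and induction from the leaves\<close>

definition depth :: "nat set \<Rightarrow> (nat \<Rightarrow> nat) \<Rightarrow> nat \<Rightarrow> nat" where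
  "depth V p v = length (ptr V p v)"

lemma depth_step:
  assumes "rooted V p" "v \<in> V"
  shows "depth V p v = Suc (depth V p (p v))"
  by (simp add: depth_def path_to_root_step[OF assms])

text \<open>Counterpart of \<open>rooted_induct\<close> for properties that a vertex inherits from
  its children. The distance to the maximal depth decreases from a vertex to its children.\<close>

lemma rooted_up_induct [consumes 2, case_names up]:
  assumes "rooted V p" "v \<in> V"
    and "\<And>v. v \<in> V \<Longrightarrow> (\<And>w. w \<in> V \<Longrightarrow> p w = v \<Longrightarrow> P w) \<Longrightarrow> P v"
  shows "P v"
  using assms(2)
proof (induction "Max (depth V p ` V) - depth V p v" arbitrary: v rule: less_induct)
  case less
  show ?case
  proof (rule assms(3)[OF less.prems])
    fix w assume w: "w \<in> V" "p w = v"
    have "depth V p w \<le> Max (depth V p ` V)"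
      using w rooted_finite[OF assms(1)] by auto
    thus "P w" using w less depth_step[OF assms(1) w(1)] by (intro less.hyps) auto
  qed
qed

text \<open>At a vertex of maximal depth on a cycle, both cycle neighbours must be its parent and
  hence coincide.\<close>

lemma pgraph_no_cycle:
  assumes "rooted V p"
  shows "\<not> is_cycle (pedges V p) xs"
proof
  assume c: "is_cycle (pedges V p) xs"
  define n where "n = length xs"
  have n: "n \<ge> 3" and d: "distinct xs" using c by (auto simp: is_cycle_def n_def)
  have e: "{xs ! i, xs ! (Suc i mod n)} \<in> pedges V p" if "i < n" for i
  proof (cases "Suc i < n")
    case True
    thus ?thesis using c by (auto simp: is_cycle_def successively_conv_nth n_def)
  next
    case False
    hence "Suc i = n" using that by simp
    hence "length xs - 1 = i" "Suc i mod n = 0" by (simp_all add: n_def)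
    moreover have "xs \<noteq> []" using n by (auto simp: n_def)
    ultimately have "xs ! i = last xs" "xs ! (Suc i mod n) = hd xs"
      using last_conv_nth[of xs] hd_conv_nth[of xs] by metis+
    thus ?thesis using c by (auto simp: is_cycle_def)
  qed
  let ?D = "\<lambda>i. depth V p (xs ! i)"
  have fin: "finite {..<n}" "{..<n} \<noteq> {}" using n by (auto simp: lessThan_empty_iff)
  obtain i where i: "i < n" "\<And>j. j < n \<Longrightarrow> ?D j \<le> ?D i"
  proof -
    have "Max (?D ` {..<n}) \<in> ?D ` {..<n}" using fin by (intro Max_in) auto
    then obtain i where "i < n" "?D i = Max (?D ` {..<n})" by auto
    thus ?thesis using that fin by (metis Max_ge finite_imageI image_eqI lessThan_iff)
  qed
  \<comment> \<open>\<open>k\<close> is the cyclic predecessor of \<open>i\<close>;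
    \<open>n \<ge> 3\<close> keeps it apart from the cyclic successor.\<close>
  define k where "k = (if i = 0 then n - 1 else i - 1)"
  have k: "k < n" "Suc k mod n = i" using i n by (auto simp: k_def)
  have j: "Suc i mod n < n" using n by simp
  have ne: "Suc i mod n \<noteq> k" using i n by (auto simp: k_def mod_Suc)
  have up: "p (xs ! i) = xs ! j" if "j < n" "{xs ! i, xs ! j} \<in> pedges V p" for j
  proof (rule ccontr)
    assume "\<not> ?thesis"
    hence "xs ! j \<in> V" "p (xs ! j) = xs ! i" using that(2) by (auto simp: pedges_mem)
    hence "?D j = Suc (?D i)" using depth_step[OF assms] by metis
    thus False using i(2)[OF that(1)] by simp
  qed
  have "xs ! (Suc i mod n) = xs ! k"
    using up[OF j e[OF i(1)]] up[OF k(1)] e[OF k(1)] k(2) by (metis insert_commute)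
  thus False using d ne j k by (simp add: nth_eq_iff_index_eq n_def)
qed

section \<open>Trees containing the root are the graphs of rooted parent functions\<close>

lemma walk_to_path:
  assumes "xs \<noteq> []" "successively (\<lambda>x y. {x, y} \<in> E) xs"
  shows "\<exists>ys. is_path E (hd xs) ys (last xs)"
  using assms
proof (induction "length xs" arbitrary: xs rule: less_induct)
  case less
  show ?case
  proof (cases "distinct xs")
    case True
    thus ?thesis using less by (auto simp: is_path_def)
  next
    case False
    then obtain as bs cs y where xs: "xs = as @ [y] @ bs @ [y] @ cs"
      using not_distinct_decomp by blast
    let ?zs = "as @ [y] @ cs"
    have "successively (\<lambda>x y. {x, y} \<in> E) ?zs"
      using less.prems(2) unfolding xs by (auto simp: successively_append_iff successively_Cons)
    moreover have "hd ?zs = hd xs" "last ?zs = last xs"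
      unfolding xs by (auto simp: hd_append)
    ultimately show ?thesis using less.hyps[of ?zs] by (simp add: xs)
  qed
qed

text \<open>Two vertices are joined by going from one to \<open>0\<close> and then up to the other;
  \<open>walk_to_path\<close> removes the repetitions.\<close>

lemma is_tree_pgraph:
  assumes "rooted V p"
  shows "is_tree (pgraph V p)"
proof -
  have ne: "p v \<noteq> v" if "v \<in> V" for v
    using depth_step[OF assms that] by (metis n_not_Suc_n)
  have "pedges V p \<subseteq> complete_edges (insert 0 V)"
  proof
    fix e assume "e \<in> pedges V p"
    then obtain v where "v \<in> V" "e = {v, p v}" by (auto simp: pedges_def)
    thus "e \<in> complete_edges (insert 0 V)"
      using rooted_closed[OF assms, of v] ne[of v] unfolding complete_edges_def by fastforce
  qed
  moreover have "\<exists>xs. is_path (pedges V p) u xs v" if "u \<in> insert 0 V" "v \<in> insert 0 V" for u v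
  proof -
    let ?R = "\<lambda>x y. {x, y} \<in> pedges V p"
    let ?us = "ptr V p u" and ?vs = "ptr V p v"
    have u: "is_path (pedges V p) u ?us 0" and v: "is_path (pedges V p) v ?vs 0"
      using is_path_path_to_root[OF assms] that by auto
    \<comment> \<open>\<open>tl\<close> drops the second copy of \<open>0\<close>.\<close>
    let ?ws = "?us @ tl (rev ?vs)"
    have rv: "rev ?vs = 0 # tl (rev ?vs)" using v
      by (metis hd_rev is_path_def list.collapse rev_is_Nil_conv)
    have sv: "successively ?R (rev ?vs)" using v by (simp add: is_path_def successively_rev insert_commute)
    have "successively ?R ?ws"
    proof (cases "tl (rev ?vs) = []")
      case True
      thus ?thesis using u by (simp add: is_path_def)
    next
      case False
      have "successively ?R (0 # tl (rev ?vs))" using sv rv by metis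
      hence "successively ?R (tl (rev ?vs)) \<and> ?R 0 (hd (tl (rev ?vs)))"
        using False by (simp add: successively_Cons)
      thus ?thesis using u False by (simp add: is_path_def successively_append_iff)
    qed
    moreover have "hd ?ws = u" using u by (simp add: is_path_def)
    moreover have "last ?ws = v"
    proof -
      have "last (rev ?vs) = v" using v by (simp add: is_path_def last_rev)
      thus ?thesis using rv u unfolding is_path_def by (metis last_ConsL last_ConsR last_appendR append_Nil2)
    qed
    moreover have "?ws \<noteq> []" using u by (simp add: is_path_def)
    ultimately show ?thesis using walk_to_path[of ?ws] by metis
  qed
  ultimately show ?thesis
    using assms pgraph_no_cycle[OF assms] by (auto simp: is_tree_def rooted_finite)
qed

lemma is_path_ConsD:
  assumes "is_path E u (u # w # xs) v"
  shows "is_path E w (w # xs) v" "{u, w} \<in> E"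
  using assms by (auto simp: is_path_def)

text \<open>The parent of \<open>v\<close> is the next vertex on a shortest path from
  \<open>v\<close> to \<open>0\<close>, so the distance \<open>d\<close> strictly decreases along
  \<open>p\<close> and every orbit ends at \<open>0\<close>.\<close>

lemma tree_spanned_by_shortest_paths:
  assumes "is_tree G" "0 \<in> fst G"
  shows "\<exists>p. rooted (fst G - {0}) p \<and> pedges (fst G - {0}) p \<subseteq> snd G"
proof -
  define V E where "V = fst G - {0}" and "E = snd G"
  define d where "d v = (LEAST n. \<exists>xs. is_path E v xs 0 \<and> length xs = n)" for v
  have conn: "\<exists>xs. is_path E v xs 0" if "v \<in> fst G" for v
    using assms that by (auto simp: is_tree_def E_def)
  have le: "d v \<le> length xs" if "is_path E v xs 0" for v xs
    unfolding d_def by (rule Least_le) (use that in blast)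
  have ex: "\<exists>w. w \<in> fst G \<and> {v, w} \<in> E \<and> d w < d v" if v: "v \<in> V" for v
  proof -
    have "\<exists>xs. is_path E v xs 0 \<and> length xs = d v"
      unfolding d_def by (rule LeastI_ex) (use conn v in \<open>auto simp: V_def\<close>)
    then obtain xs where xs: "is_path E v xs 0" "length xs = d v" by blast
    then obtain w ys where eq: "xs = v # w # ys"
      using v by (cases xs; cases "tl xs") (auto simp: is_path_def V_def)
    have "is_path E w (w # ys) 0" "{v, w} \<in> E" using is_path_ConsD xs(1) unfolding eq by blast+
    moreover from \<open>{v, w} \<in> E\<close> have "w \<in> fst G"
      using assms(1) by (force simp: is_tree_def complete_edges_def E_def doubleton_eq_iff)
    ultimately show ?thesis using le[of w "w # ys"] xs(2) eq by auto
  qed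
  then obtain p where p: "\<And>v. v \<in> V \<Longrightarrow> p v \<in> fst G \<and> {v, p v} \<in> E \<and> d (p v) < d v"
    by metis
  have "reach V p v" if "v \<in> fst G" for v
    using that
  proof (induction "d v" arbitrary: v rule: less_induct)
    case less
    show ?case
    proof (cases "v = 0")
      case False
      hence v: "v \<in> V" using less.prems by (simp add: V_def)
      show ?thesis by (rule reach.step[OF v less.hyps]) (use p[OF v] in auto)
    qed (simp add: reach.root)
  qed
  hence "rooted V p" using assms(1) by (auto simp: rooted_def V_def is_tree_def)
  moreover have "pedges V p \<subseteq> E" using p by (auto simp: pedges_def)
  ultimately show ?thesis unfolding V_def E_def by blast
qed

text \<open>An edge outside the spanning parent graph would close a cycle with the orbits of its two
  ends, cut where they meet.\<close>

lemma tree_eq_pgraph: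
  assumes "is_tree G" "0 \<in> fst G"
  shows "\<exists>p. rooted (fst G - {0}) p \<and> G = pgraph (fst G - {0}) p"
proof -
  define V where "V = fst G - {0}"
  obtain p where r: "rooted V p" and sub: "pedges V p \<subseteq> snd G"
    using tree_spanned_by_shortest_paths[OF assms] by (auto simp: V_def)
  have "snd G \<subseteq> pedges V p"
  proof (rule ccontr)
    assume "\<not> ?thesis"
    then obtain e where e: "e \<in> snd G" "e \<notin> pedges V p" by blast
    have "e \<in> complete_edges (fst G)" using e assms by (auto simp: is_tree_def)
    then obtain a b where ab: "e = {a, b}" "a \<in> fst G" "b \<in> fst G" "a \<noteq> b"
      by (auto simp: complete_edges_def)
    let ?R = "\<lambda>x y. {x, y} \<in> snd G"
    define xs ys where "xs = ptr V p a" and "ys = ptr V p b"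
    have mem: "a \<in> insert 0 V" "b \<in> insert 0 V" using ab by (auto simp: V_def)
    have px: "is_path (pedges V p) a xs 0" and py: "is_path (pedges V p) b ys 0"
      using is_path_path_to_root[OF r] mem by (auto simp: xs_def ys_def)
    have "0 \<in> set xs" "0 \<in> set ys" using px py unfolding is_path_def by (metis last_in_set)+
    hence "\<exists>x\<in>set xs. x \<in> set ys" by blast
    \<comment> \<open>\<open>m\<close> is the first vertex of the orbit of \<open>a\<close> that
      lies on the orbit of \<open>b\<close>; hence \<open>xs1\<close> avoids \<open>ys1\<close>, and
      \<open>?c\<close> has no repetition.\<close>
    then obtain xs1 m xs2 where xs: "xs = xs1 @ m # xs2" "m \<in> set ys" "\<forall>x\<in>set xs1. x \<notin> set ys"
      using split_list_first_propE[of xs "\<lambda>x. x \<in> set ys"] by metis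
    obtain ys1 ys2 where ys: "ys = ys1 @ m # ys2" using xs(2) by (meson split_list)
    let ?c = "xs1 @ [m] @ rev ys1"
    have sx: "successively (\<lambda>x y. {x, y} \<in> pedges V p) (xs1 @ m # xs2)" and dx: "distinct (xs1 @ m # xs2)"
      and hx: "hd (xs1 @ m # xs2) = a" using px by (auto simp: is_path_def xs)
    have sy: "successively (\<lambda>x y. {x, y} \<in> pedges V p) (ys1 @ m # ys2)" and dy: "distinct (ys1 @ m # ys2)"
      and hy: "hd (ys1 @ m # ys2) = b" using py by (auto simp: is_path_def ys)
    have s1: "successively (\<lambda>x y. {x, y} \<in> pedges V p) (xs1 @ [m])"
      using sx by (auto simp: successively_append_iff)
    have "successively (\<lambda>x y. {x, y} \<in> pedges V p) (ys1 @ [m])"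
      using sy by (auto simp: successively_append_iff)
    hence s2: "successively (\<lambda>x y. {x, y} \<in> pedges V p) (m # rev ys1)"
      by (subst (asm) successively_rev[symmetric]) (simp add: insert_commute)
    have s: "successively (\<lambda>x y. {x, y} \<in> pedges V p) ?c"
      using s1 s2 by (auto simp: successively_append_iff)
    have sR: "successively ?R ?c" by (rule successively_mono[OF s]) (use sub in auto)
    have hc: "hd ?c = a" using hx by (cases xs1) auto
    have lc: "last ?c = b" using hy by (cases ys1) auto
    have dc: "distinct ?c" using dx dy xs(3) ys by auto
    \<comment> \<open>With two vertices only, \<open>{a, b}\<close> would be an edge of
      \<open>pedges V p\<close>, against the choice of \<open>e\<close>.\<close>
    have len: "length ?c \<ge> 3"
    proof (rule ccontr)
      assume "\<not> ?thesis"
      hence le: "length ?c \<le> 2" by simp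
      obtain c1 cs where c1: "?c = c1 # cs" by (cases ?c) auto
      with le consider "?c = [c1]" | c2 where "?c = [c1, c2]"
        by (cases cs; cases "tl cs") auto
      thus False
      proof cases
        case 1
        thus False using hc lc ab by (metis last_ConsL list.sel(1))
      next
        case 2
        have "c1 = a" using hc unfolding 2 by simp
        moreover have "c2 = b" using lc unfolding 2 by simp
        moreover have "{c1, c2} \<in> pedges V p" using s unfolding 2 by simp
        ultimately show False using e ab by simp
      qed
    qed
    have "{last ?c, hd ?c} \<in> snd G" using e(1) ab(1) unfolding hc lc by (simp add: insert_commute)
    hence "is_cycle (snd G) ?c" unfolding is_cycle_def using len dc sR by blast
    thus False using assms by (auto simp: is_tree_def)
  qed
  hence "snd G = pedges V p" using sub by blast
  hence "G = pgraph V p" using assms(2) by (intro prod_eqI) (auto simp: V_def)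
  thus ?thesis using r unfolding V_def by (intro exI[of _ p] conjI)
qed

section \<open>The subtree spanned by a set of labels\<close>

definition anc :: "nat set \<Rightarrow> (nat \<Rightarrow> nat) \<Rightarrow> nat set \<Rightarrow> nat set" where
  "anc V p L = (\<Union>x\<in>L. set (ptr V p x)) - {0}"

lemma path_to_root_closed:
  assumes "rooted V p" "x \<in> insert 0 V" "v \<in> set (ptr V p x)" "v \<noteq> 0"
  shows "p v \<in> set (ptr V p x)"
  using assms(1,2,3)
proof (induction rule: rooted_induct)
  case root
  thus ?case using assms(4) path_to_root_zero[OF assms(1)] by simp
next
  case (step x)
  obtain xs where "ptr V p (p x) = p x # xs"
    using path_to_root_Cons assms(1) step by blast
  thus ?case using step path_to_root_step[OF assms(1) step(1)] by auto
qed

lemma rooted_anc: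
  assumes "rooted V p" "L \<subseteq> V"
  shows "rooted (anc V p L) p" "L \<subseteq> anc V p L" "anc V p L \<subseteq> V"
    "\<And>v. v \<in> anc V p L \<Longrightarrow> p v \<in> insert 0 (anc V p L)"
proof -
  have ancE: "\<exists>x\<in>L. x \<in> insert 0 V \<and> v \<in> set (ptr V p x) \<and> v \<noteq> 0"
    if "v \<in> anc V p L" for v
    using that assms(2) by (auto simp: anc_def)
  show sub: "anc V p L \<subseteq> V"
  proof
    fix v assume "v \<in> anc V p L"
    then obtain x where "x \<in> insert 0 V" "v \<in> set (ptr V p x)" "v \<noteq> 0"
      using ancE by blast
    thus "v \<in> V" using set_path_to_root[OF assms(1), of x] by blast
  qed
  show cl: "p v \<in> insert 0 (anc V p L)" if v: "v \<in> anc V p L" for v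
  proof -
    obtain x where x: "x \<in> L" "x \<in> insert 0 V" "v \<in> set (ptr V p x)" "v \<noteq> 0"
      using ancE[OF v] by blast
    have "p v \<in> set (ptr V p x)"
      using path_to_root_closed[OF assms(1) x(2-4)] .
    thus ?thesis using x(1) by (auto simp: anc_def)
  qed
  show "rooted (anc V p L) p" using assms(1) sub cl by (rule rooted_subset)
  show "L \<subseteq> anc V p L"
  proof
    fix x assume x: "x \<in> L"
    hence V: "x \<in> V" using assms by auto
    hence "x \<in> set (ptr V p x)" by (simp add: path_to_root_step[OF assms(1)])
    moreover have "x \<noteq> 0" using V rooted_zero[OF assms(1)] by metis
    ultimately show "x \<in> anc V p L" using x unfolding anc_def by blast
  qed
qed

lemma anc_least:
  assumes "rooted V p" "L \<subseteq> S" "S \<subseteq> V" "\<And>v. v \<in> S \<Longrightarrow> p v \<in> insert 0 S"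
  shows "anc V p L \<subseteq> S"
proof -
  have "x \<in> insert 0 S \<longrightarrow> set (ptr V p x) \<subseteq> insert 0 S" if "x \<in> insert 0 V" for x
    using assms(1) that
  proof (induction rule: rooted_induct)
    case root
    show ?case using path_to_root_zero[OF assms(1)] by simp
  next
    case (step v)
    show ?case
    proof
      assume "v \<in> insert 0 S"
      hence "p v \<in> insert 0 S" using assms(4) step(1) rooted_zero[OF assms(1)] by auto
      thus "set (ptr V p v) \<subseteq> insert 0 S"
        using step \<open>v \<in> insert 0 S\<close> path_to_root_step[OF assms(1) step(1)] by auto
    qed
  qed
  hence "set (ptr V p x) \<subseteq> insert 0 S" if "x \<in> L" for x
    using assms(2,3) that by blast
  thus ?thesis unfolding anc_def by blast
qed

text \<open>Any competing subtree is itself a parent graph \<open>pgraph W q\<close>. Paths to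
  \<open>0\<close> are unique in the large tree, so \<open>q\<close> agrees with \<open>p\<close> on
  \<open>W\<close> and \<open>W\<close> is closed under \<open>p\<close>. The ancestor subtree is
  thus the least competitor and equals the intersection.\<close>

lemma spanned_subtree_pedges:
  assumes "rooted V p" "L \<subseteq> V"
  shows "spanned_subtree L (pedges V p) = pgraph (anc V p L) p"
proof -
  note A = rooted_anc[OF assms]
  have in1: "pgraph (anc V p L) p \<in> subtrees_containing L (pedges V p)"
    using is_tree_pgraph[OF A(1)] A(2,3) by (auto simp: subtrees_containing_def pedges_def)
  have least: "insert 0 (anc V p L) \<subseteq> fst G \<and> pedges (anc V p L) p \<subseteq> snd G"
    if "G \<in> subtrees_containing L (pedges V p)" for G
  proof -
    have t: "is_tree G" "snd G \<subseteq> pedges V p" "insert 0 L \<subseteq> fst G"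
      using that by (auto simp: subtrees_containing_def)
    obtain q where q: "rooted (fst G - {0}) q" "G = pgraph (fst G - {0}) q"
      using tree_eq_pgraph t by blast
    define W where "W = fst G - {0}"
    have W: "rooted W q" "snd G = pedges W q" "fst G = insert 0 W"
      using q t(3) unfolding W_def by (auto, (metis snd_pgraph)+)
    have WV: "W \<subseteq> V"
    proof
      fix w assume w: "w \<in> W"
      hence "{w, q w} \<in> pedges V p" using t(2) W by (auto simp: pedges_def)
      then obtain v where v: "v \<in> V" "{w, q w} = {v, p v}" by (auto simp: pedges_def)
      hence "w \<in> insert 0 V" using rooted_closed[OF assms(1) v(1)] by (auto simp: doubleton_eq_iff)
      thus "w \<in> V" using w by (auto simp: W_def)
    qed
    have qp: "q w = p w" if w: "w \<in> W" for w
    proof -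
      have "is_path (pedges W q) w (path_to_root (pedges W q) w) 0"
        using is_path_path_to_root W w by simp
      hence "is_path (pedges V p) w (path_to_root (pedges W q) w) 0"
        using t(2) W unfolding is_path_def by (auto elim!: successively_mono)
      hence "path_to_root (pedges W q) w = ptr V p w"
        using is_path_unique assms by blast
      thus ?thesis using parent_pedges[OF W(1) w] parent_pedges[OF assms(1)] WV w
        by (metis parent_def subsetD)
    qed
    have "anc V p L \<subseteq> W"
    proof (rule anc_least[OF assms(1)])
      show "L \<subseteq> W" using t(3) W(3) assms(2) rooted_zero[OF assms(1)] by auto
      show "p v \<in> insert 0 W" if "v \<in> W" for v
        using rooted_closed[OF W(1) that] qp[OF that] by simp
    qed (rule WV)
    moreover have "pedges S p \<subseteq> pedges W q" if "S \<subseteq> W" for S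
    proof
      fix e assume "e \<in> pedges S p"
      then obtain v where "v \<in> S" "e = {v, p v}" by (auto simp: pedges_def)
      thus "e \<in> pedges W q" using that qp[of v] unfolding pedges_def by (intro image_eqI[of _ _ v]) auto
    qed
    ultimately show ?thesis using W by auto
  qed
  have "\<Inter> (fst ` subtrees_containing L (pedges V p)) = insert 0 (anc V p L)"
  proof (rule antisym)
    show "\<Inter> (fst ` subtrees_containing L (pedges V p)) \<subseteq> insert 0 (anc V p L)"
      using INT_lower[OF in1, of fst] by simp
    show "insert 0 (anc V p L) \<subseteq> \<Inter> (fst ` subtrees_containing L (pedges V p))"
      by (rule INT_greatest) (use least in blast)
  qed
  moreover have "\<Inter> (snd ` subtrees_containing L (pedges V p)) = pedges (anc V p L) p"
  proof (rule antisym)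
    show "\<Inter> (snd ` subtrees_containing L (pedges V p)) \<subseteq> pedges (anc V p L) p"
      using INT_lower[OF in1, of snd] by simp
    show "pedges (anc V p L) p \<subseteq> \<Inter> (snd ` subtrees_containing L (pedges V p))"
      by (rule INT_greatest) (use least in blast)
  qed
  ultimately show ?thesis by (simp add: spanned_subtree_def pgraph_def)
qed

section \<open>Spanning trees as extensional parent functions\<close>

lemma degree_in_pedges:
  assumes "rooted V p"
  shows "degree_in (pedges V p) 0 = card {v \<in> V. p v = 0}"
proof -
  have "{e \<in> pedges V p. 0 \<in> e} = (\<lambda>v. {v, 0}) ` {v \<in> V. p v = 0}"
    using rooted_zero[OF assms] by (auto simp: pedges_def)
  moreover have "inj_on (\<lambda>v. {v, 0::nat}) {v \<in> V. p v = 0}"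
    by (auto simp: inj_on_def doubleton_eq_iff)
  ultimately show ?thesis by (simp add: degree_in_def card_image)
qed

text \<open>Extensionality fixes the values outside \<open>{1..N}\<close>, so that
  \<open>pedges {1..N}\<close> becomes a bijection onto the spanning trees.\<close>

definition parent_funs :: "nat \<Rightarrow> (nat \<Rightarrow> nat) set" where
  "parent_funs N = {f \<in> {1..N} \<rightarrow>\<^sub>E {0..N}. rooted {1..N} f}"

lemma bij_betw_spanning_trees: "bij_betw (pedges {1..N}) (parent_funs N) (spanning_trees N)"
proof (rule bij_betwI')
  have ins: "insert 0 {1..N} = {0..N}" by auto
  fix f g assume f: "f \<in> parent_funs N"
  show "pedges {1..N} f \<in> spanning_trees N"
    using is_tree_pgraph[of "{1..N}" f] f ins
    by (simp add: spanning_trees_def parent_funs_def pgraph_def)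
  assume g: "g \<in> parent_funs N"
  show "pedges {1..N} f = pedges {1..N} g \<longleftrightarrow> f = g"
  proof
    assume eq: "pedges {1..N} f = pedges {1..N} g"
    show "f = g"
    proof (rule PiE_ext)
      show "f \<in> {1..N} \<rightarrow>\<^sub>E {0..N}" "g \<in> {1..N} \<rightarrow>\<^sub>E {0..N}"
        using f g by (auto simp: parent_funs_def)
      show "f x = g x" if "x \<in> {1..N}" for x
        using parent_pedges[of "{1..N}" f x] parent_pedges[of "{1..N}" g x] f g eq that
        by (simp add: parent_funs_def)
    qed
  qed simp
next
  fix T assume T: "T \<in> spanning_trees N"
  hence t: "is_tree ({0..N}, T)" by (simp add: spanning_trees_def)
  have V: "{0..N} - {0} = {1..N}" by auto
  obtain p where p: "rooted {1..N} p" "({0..N}, T) = pgraph {1..N} p"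
    using tree_eq_pgraph[OF t] V by auto
  define f where "f = restrict p {1..N}"
  have r: "rooted {1..N} f" using p(1) rooted_cong[of "{1..N}" p f] by (simp add: f_def)
  have "f \<in> {1..N} \<rightarrow>\<^sub>E {0..N}"
    using rooted_closed[OF p(1)] by (fastforce simp: f_def)
  moreover have "T = pedges {1..N} f"
    using p(2) pedges_cong[of "{1..N}" p f] by (simp add: pgraph_def f_def)
  ultimately show "\<exists>f\<in>parent_funs N. T = pedges {1..N} f" using r by (auto simp: parent_funs_def)
qed

section \<open>Counting rooted functions\<close>

lemma rooted_neq: "rooted V p \<Longrightarrow> v \<in> V \<Longrightarrow> p v \<noteq> v"
  using depth_step by (metis n_not_Suc_n)

text \<open>Deleting \<open>v\<close> and sending its children to its parent only removes the visits
  to \<open>v\<close> from the orbits. In the count of rooted functions this is the step that merges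
  the component of \<open>v\<close> into that of its parent.\<close>

lemma rooted_contract:
  assumes "v \<in> V" "v \<noteq> 0" "q v \<noteq> v" "q v \<in> insert 0 V"
  shows "rooted V q \<longleftrightarrow> rooted (V - {v}) (\<lambda>x. if q x = v then q v else q x)"
proof -
  define q' where "q' = (\<lambda>x. if q x = v then q v else q x)"
  \<comment> \<open>The orbit of \<open>q\<close> is followed from \<open>x\<close>, with
    \<open>v\<close> itself replaced by its image \<open>q v\<close>.\<close>
  have 1: "reach (V - {v}) q' (if x = v then q v else x)" if "reach V q x" for x
    using that
  proof induction
    case root
    show ?case using assms(2) reach.root by simp
  next
    case (step x)
    show ?case
    proof (cases "x = v")
      case True
      thus ?thesis using step.IH assms(3) by simp
    next
      case False
      have "reach (V - {v}) q' (q' x)" using step.IH by (simp add: q'_def)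
      thus ?thesis using False step.hyps reach.step[of x "V - {v}" q'] by simp
    qed
  qed
  have 2: "reach V q x" if "reach (V - {v}) q' x" for x
    using that
  proof induction
    case root
    show ?case by (rule reach.root)
  next
    case (step x)
    have "reach V q (q x)"
    proof (cases "q x = v")
      case True
      hence "reach V q (q v)" using step.IH by (simp add: q'_def)
      thus ?thesis using True reach.step[OF assms(1)] by simp
    next
      case False
      thus ?thesis using step.IH by (simp add: q'_def)
    qed
    thus ?case using step.hyps reach.step[of x V q] by simp
  qed
  show ?thesis unfolding q'_def[symmetric]
  proof
    assume r: "rooted V q"
    have "reach (V - {v}) q' x" if "x \<in> V - {v}" for x
      using 1[of x] rooted_reach[OF r, of x] that by simp
    thus "rooted (V - {v}) q'" using r by (simp add: rooted_def)
  next
    assume r: "rooted (V - {v}) q'"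
    have "reach V q x" if "x \<in> V - {v}" for x
      using 2[of x] rooted_reach[OF r, of x] that by simp
    moreover have "reach V q (q v)"
      using 2[of "q v"] rooted_reach[OF r, of "q v"] assms(3,4) by simp
    hence "reach V q v" using assms(1) by (rule reach.step[rotated])
    ultimately show "rooted V q" using r assms(2) unfolding rooted_def by auto
  qed
qed

text \<open>The contribution of \<open>n\<close> unconstrained values from \<open>W\<close> on top
  of \<open>M\<close>. Only the multiset of values is passed on, since \<open>F\<close> sees nothing
  else.\<close>

primrec msum :: "nat set \<Rightarrow> nat \<Rightarrow> (nat multiset \<Rightarrow> real) \<Rightarrow> nat multiset \<Rightarrow> real" where
  "msum W 0 F M = F M"
| "msum W (Suc n) F M = (\<Sum>w\<in>W. msum W n F (add_mset w M))"

lemma sum_PiE_insert: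
  fixes h :: "(nat \<Rightarrow> nat) \<Rightarrow> real"
  assumes "v \<notin> U"
  shows "(\<Sum>f\<in>insert v U \<rightarrow>\<^sub>E W. h f) = (\<Sum>w\<in>W. \<Sum>g\<in>U \<rightarrow>\<^sub>E W. h (g(v := w)))"
proof -
  have "(\<Sum>f\<in>insert v U \<rightarrow>\<^sub>E W. h f) = (\<Sum>(w, g)\<in>W \<times> (U \<rightarrow>\<^sub>E W). h (g(v := w)))"
    unfolding PiE_insert_eq
    by (subst sum.reindex[OF inj_combinator[OF assms]]) (auto intro!: sum.cong)
  thus ?thesis by (simp add: sum.cartesian_product)
qed

lemma rooted_singleton:
  assumes "v \<noteq> 0" "q v \<in> {0, v}"
  shows "rooted {v} q \<longleftrightarrow> q v = 0"
proof
  assume "rooted {v} q"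
  thus "q v = 0" using rooted_neq[of "{v}" q v] assms by auto
next
  assume "q v = 0"
  hence "reach {v} q v" using reach.step[of v "{v}" q] reach.root[of "{v}" q] by simp
  thus "rooted {v} q" using assms by (simp add: rooted_def)
qed

text \<open>Here \<open>U\<close> is the set of vertices whose parent is still open, and \<open>\<rho>\<close> sends a vertex to the root of
  its current component. Choosing \<open>f v = w\<close> merges the component of \<open>v\<close> into that of \<open>w\<close>; the induction closes
  because the first two values on the right can be exchanged.\<close>

lemma sum_rooted_functions:
  fixes F :: "nat multiset \<Rightarrow> real"
  assumes "finite U" "U \<noteq> {}" "finite W" "0 \<notin> U" "\<And>w. w \<in> W \<Longrightarrow> \<rho> w \<in> insert 0 U"
  shows "(\<Sum>f\<in>U \<rightarrow>\<^sub>E W. if rooted U (\<rho> \<circ> f) then F (M + image_mset f (mset_set U)) else 0)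
    = (\<Sum>c\<in>{c \<in> W. \<rho> c = 0}. msum W (card U - 1) F (add_mset c M))"
  using assms(1,2,4,5)
proof (induction U arbitrary: \<rho> M rule: finite_ne_induct)
  case (singleton v)
  have "(\<Sum>f\<in>{v} \<rightarrow>\<^sub>E W. if rooted {v} (\<rho> \<circ> f) then F (M + image_mset f (mset_set {v})) else 0)
    = (\<Sum>w\<in>W. \<Sum>g\<in>{} \<rightarrow>\<^sub>E W. if rooted {v} (\<rho> \<circ> g(v := w)) then F (M + image_mset (g(v := w)) (mset_set {v})) else 0)"
    by (rule sum_PiE_insert) simp
  also have "\<dots> = (\<Sum>w\<in>W. if \<rho> w = 0 then F (add_mset w M) else 0)"
  proof (rule sum.cong[OF refl])
    fix w assume "w \<in> W"
    hence "\<rho> w \<in> {0, v}" using singleton by simp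
    hence "rooted {v} (\<rho> \<circ> (\<lambda>x. undefined)(v := w)) \<longleftrightarrow> \<rho> w = 0"
      using rooted_singleton[of v "\<rho> \<circ> (\<lambda>x. undefined)(v := w)"] singleton by simp
    thus "(\<Sum>g\<in>{} \<rightarrow>\<^sub>E W. if rooted {v} (\<rho> \<circ> g(v := w)) then F (M + image_mset (g(v := w)) (mset_set {v})) else 0)
      = (if \<rho> w = 0 then F (add_mset w M) else 0)"
      by simp
  qed
  also have "\<dots> = (\<Sum>c\<in>{c \<in> W. \<rho> c = 0}. F (add_mset c M))"
    by (simp add: sum.inter_filter[OF assms(3)])
  finally show ?case by (simp add: comp_def)
next
  case (insert v U)
  define G where "G c w = msum W (card U - 1) F (add_mset c (add_mset w M))" for c w
  have Gsym: "G c w = G w c" for c w by (simp add: G_def add_mset_commute)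
  \<comment> \<open>Possible parents of \<open>v\<close>, by component: \<open>C\<close> is that of
    the root, \<open>A\<close> that of \<open>v\<close> itself, which would close a cycle, and
    \<open>B\<close> the rest.\<close>
  define C A B where "C = {c \<in> W. \<rho> c = 0}" and "A = {c \<in> W. \<rho> c = v}"
    and "B = {c \<in> W. \<rho> c \<noteq> 0 \<and> \<rho> c \<noteq> v}"
  have v: "v \<noteq> 0" "v \<notin> U" using insert by auto
  have fin: "finite C" "finite A" "finite B" using assms(3) by (auto simp: C_def A_def B_def)
  have dis: "C \<inter> A = {}" "(C \<union> A) \<inter> B = {}" "C \<inter> B = {}" "A \<inter> B = {}" using v
    by (auto simp: C_def A_def B_def)
  have W: "W = C \<union> A \<union> B" by (auto simp: C_def A_def B_def)
  have inner: "(\<Sum>g\<in>U \<rightarrow>\<^sub>E W. if rooted (insert v U) (\<rho> \<circ> g(v := w))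
      then F (M + image_mset (g(v := w)) (mset_set (insert v U))) else 0)
    = (if w \<in> A then 0 else if w \<in> C then (\<Sum>c\<in>C \<union> A. G c w) else (\<Sum>c\<in>C. G c w))" (is "?L = _")
    if w: "w \<in> W" for w
  proof (cases "\<rho> w = v")
    case True
    have "\<not> rooted (insert v U) (\<rho> \<circ> g(v := w))" for g
      using rooted_neq[of "insert v U" "\<rho> \<circ> g(v := w)" v] True by auto
    thus ?thesis using w True by (simp add: A_def)
  next
    case False
    \<comment> \<open>Once \<open>v\<close> has joined the component of \<open>w\<close>, whatever
      was rooted at \<open>v\<close> is rooted at \<open>\<rho> w\<close>.\<close>
    define \<rho>' where "\<rho>' = (\<lambda>y. if \<rho> y = v then \<rho> w else \<rho> y)"
    have rw: "\<rho> w \<in> insert 0 U" using insert.prems(2)[OF w] False by auto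
    have cl: "\<rho>' y \<in> insert 0 U" if "y \<in> W" for y
      using insert.prems(2)[OF that] rw by (auto simp: \<rho>'_def)
    have iff: "rooted (insert v U) (\<rho> \<circ> g(v := w)) \<longleftrightarrow> rooted U (\<rho>' \<circ> g)" for g
    proof -
      have "rooted (insert v U) (\<rho> \<circ> g(v := w)) \<longleftrightarrow>
        rooted (insert v U - {v}) (\<lambda>x. if (\<rho> \<circ> g(v := w)) x = v then (\<rho> \<circ> g(v := w)) v else (\<rho> \<circ> g(v := w)) x)"
        by (rule rooted_contract) (use v False rw in auto)
      also have "insert v U - {v} = U" using v by simp
      also have "rooted U (\<lambda>x. if (\<rho> \<circ> g(v := w)) x = v then (\<rho> \<circ> g(v := w)) v else (\<rho> \<circ> g(v := w)) x)
        \<longleftrightarrow> rooted U (\<rho>' \<circ> g)"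
        by (rule rooted_cong) (use v in \<open>auto simp: \<rho>'_def\<close>)
      finally show ?thesis .
    qed
    have im: "M + image_mset (g(v := w)) (mset_set (insert v U)) = add_mset w M + image_mset g (mset_set U)" for g
    proof -
      have "image_mset (g(v := w)) (mset_set U) = image_mset g (mset_set U)"
        by (rule image_mset_cong) (use v insert.hyps(1) in auto)
      thus ?thesis using v insert.hyps(1) by simp
    qed
    have "?L = (\<Sum>g\<in>U \<rightarrow>\<^sub>E W. if rooted U (\<rho>' \<circ> g) then F (add_mset w M + image_mset g (mset_set U)) else 0)"
      by (simp only: iff im)
    also have "\<dots> = (\<Sum>c\<in>{c \<in> W. \<rho>' c = 0}. msum W (card U - 1) F (add_mset c (add_mset w M)))"
      by (rule insert.IH) (use insert.prems cl in auto)
    also have "{c \<in> W. \<rho>' c = 0} = (if w \<in> C then C \<union> A else C)"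
      using w v False by (auto simp: \<rho>'_def C_def A_def)
    finally have eq: "?L = (\<Sum>c\<in>(if w \<in> C then C \<union> A else C). G c w)" unfolding G_def .
    have "w \<notin> A" using False by (simp add: A_def)
    thus ?thesis unfolding eq by (cases "w \<in> C") simp_all
  qed
  have c: "card (insert v U) - 1 = Suc (card U - 1)"
    using insert.hyps v(2) by (simp add: card_gt_0_iff)
  have "(\<Sum>f\<in>insert v U \<rightarrow>\<^sub>E W. if rooted (insert v U) (\<rho> \<circ> f) then F (M + image_mset f (mset_set (insert v U))) else 0)
    = (\<Sum>w\<in>W. if w \<in> A then 0 else if w \<in> C then (\<Sum>c\<in>C \<union> A. G c w) else (\<Sum>c\<in>C. G c w))"
    unfolding sum_PiE_insert[OF v(2)] by (rule sum.cong[OF refl inner])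
  also have "\<dots> = (\<Sum>w\<in>C. \<Sum>c\<in>C \<union> A. G c w) + (\<Sum>w\<in>B. \<Sum>c\<in>C. G c w)"
  proof -
    have "(\<Sum>w\<in>C. if w \<in> A then 0 else if w \<in> C then (\<Sum>c\<in>C \<union> A. G c w) else (\<Sum>c\<in>C. G c w)) = (\<Sum>w\<in>C. \<Sum>c\<in>C \<union> A. G c w)"
      by (rule sum.cong) (use dis in auto)
    moreover have "(\<Sum>w\<in>B. if w \<in> A then 0 else if w \<in> C then (\<Sum>c\<in>C \<union> A. G c w) else (\<Sum>c\<in>C. G c w)) = (\<Sum>w\<in>B. \<Sum>c\<in>C. G c w)"
      by (rule sum.cong) (use dis in auto)
    moreover have "(\<Sum>w\<in>A. if w \<in> A then 0 else if w \<in> C then (\<Sum>c\<in>C \<union> A. G c w) else (\<Sum>c\<in>C. G c w)) = 0"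
      by (rule sum.neutral) auto
    ultimately show ?thesis unfolding W using fin dis by (simp add: sum.union_disjoint)
  qed
  \<comment> \<open>Here \<open>Gsym\<close> exchanges the roles of the two values for the choices
    in \<open>B\<close>. Together with those in \<open>C \<union> A\<close> they fill all of
    \<open>W\<close>, which amounts to one further unconstrained value.\<close>
  also have "(\<Sum>w\<in>B. \<Sum>c\<in>C. G c w) = (\<Sum>c\<in>C. \<Sum>w\<in>B. G w c)"
    by (subst sum.swap) (simp add: Gsym)
  also have "(\<Sum>w\<in>C. \<Sum>c\<in>C \<union> A. G c w) + (\<Sum>c\<in>C. \<Sum>w\<in>B. G w c) = (\<Sum>c\<in>C. \<Sum>w\<in>W. G w c)"
    unfolding W sum.distrib[symmetric] using fin dis by (simp add: sum.union_disjoint)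
  finally show ?case unfolding c msum.simps G_def C_def .
qed

text \<open>Every unconstrained value contributes \<kappa> if it is \<open>0\<close> and
  \<open>1\<close> otherwise, in total the same factor at each step.\<close>

lemma msum_weight:
  assumes "finite W" "0 \<in> W"
  shows "msum W n (\<lambda>M. \<kappa> ^ count M 0) M = \<kappa> ^ count M 0 * (\<kappa> + (real (card W) - 1)) ^ n"
proof (induction n arbitrary: M)
  case (Suc n)
  let ?X = "\<kappa> + (real (card W) - 1)"
  have "card W > 0" using assms by (auto simp: card_gt_0_iff)
  hence cW: "real (card (W - {0})) = real (card W) - 1"
    using assms by (subst card_Diff_singleton) (auto simp: of_nat_diff)
  have "msum W (Suc n) (\<lambda>M. \<kappa> ^ count M 0) M
      = (\<Sum>w\<in>W. \<kappa> ^ count (add_mset w M) 0) * ?X ^ n"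
    by (simp add: Suc.IH sum_distrib_right)
  also have "(\<Sum>w\<in>W. \<kappa> ^ count (add_mset w M) 0) = \<kappa> ^ Suc (count M 0) + (\<Sum>w\<in>W - {0}. \<kappa> ^ count M 0)"
    using assms by (subst sum.remove[of W 0]) auto
  also have "\<dots> = \<kappa> ^ count M 0 * ?X" by (simp add: cW algebra_simps)
  finally show ?case by simp
qed simp

lemma msum_lists:
  assumes "finite W"
  shows "msum W n F M = (\<Sum>ws\<in>{ws. set ws \<subseteq> W \<and> length ws = n}. F (M + mset ws))"
proof (induction n arbitrary: M)
  case 0
  have "{ws. set ws \<subseteq> W \<and> length ws = 0} = {[]}" by auto
  thus ?case by simp
next
  case (Suc n)
  let ?S = "{ws. set ws \<subseteq> W \<and> length ws = n}"
  have "(\<Sum>ws\<in>{ws. set ws \<subseteq> W \<and> length ws = Suc n}. F (M + mset ws))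
    = (\<Sum>(xs, w)\<in>?S \<times> W. F (M + mset (w # xs)))"
    unfolding lists_length_Suc_eq
    by (subst sum.reindex) (auto intro!: sum.cong simp: inj_on_def)
  also have "\<dots> = (\<Sum>w\<in>W. \<Sum>xs\<in>?S. F (add_mset w M + mset xs))"
    by (subst sum.cartesian_product[symmetric], subst sum.swap) simp
  also have "\<dots> = msum W (Suc n) F M" by (simp add: Suc.IH)
  finally show ?case by simp
qed

text \<open>Contracting \<open>D\<close> to the root loses nothing: \<open>f\<close> agrees with
  \<open>g\<close> on \<open>D\<close>, so an orbit that enters \<open>D\<close> is certain to reach
  \<open>0\<close>.\<close>

lemma rooted_extend_iff:
  assumes "rooted D g" "D \<subseteq> V" "finite V" "0 \<notin> V" "\<And>x. x \<in> D \<Longrightarrow> f x = g x"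
    "\<And>x. x \<in> V \<Longrightarrow> f x \<in> insert 0 V"
  shows "rooted V f \<longleftrightarrow> rooted (V - D) ((\<lambda>x. if x \<in> D then 0 else x) \<circ> f)"
proof -
  define \<rho> where "\<rho> = (\<lambda>x. if x \<in> D then 0 else x)"
  define q where "q = \<rho> \<circ> f"
  have qf: "q x = (if f x \<in> D then 0 else f x)" for x by (simp add: q_def \<rho>_def)
  have 1: "reach (V - D) q (\<rho> x)" if "reach V f x" for x
    using that
  proof induction
    case root
    show ?case using assms(2,4) by (auto simp: \<rho>_def reach.root)
  next
    case (step x)
    show ?case
    proof (cases "x \<in> D")
      case True
      thus ?thesis by (simp add: \<rho>_def reach.root)
    next
      case False
      have "q x = \<rho> (f x)" by (simp add: q_def)
      hence "reach (V - D) q (q x)" using step.IH by metis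
      thus ?thesis using reach.step[of x "V - D" q] False step.hyps by (simp add: \<rho>_def)
    qed
  qed
  have 3: "reach V f x" if "reach D g x" for x
    using that
  proof induction
    case (step x)
    have "reach V f (f x)" using step assms(5) by simp
    thus ?case using reach.step[of x V f] step.hyps assms(2) by blast
  qed (rule reach.root)
  have 2: "reach V f x" if "reach (V - D) q x" for x
    using that
  proof induction
    case (step x)
    have "reach V f (f x)"
    proof (cases "f x \<in> D")
      case True
      thus ?thesis using 3 rooted_reach[OF assms(1)] by simp
    next
      case False
      thus ?thesis using step.IH by (simp add: qf)
    qed
    thus ?case using reach.step[of x V f] step.hyps by simp
  qed (rule reach.root)
  show ?thesis unfolding \<rho>_def[symmetric] q_def[symmetric]
  proof
    assume r: "rooted V f"
    have "reach (V - D) q x" if "x \<in> V - D" for x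
      using 1[of x] rooted_reach[OF r, of x] that by (simp add: \<rho>_def)
    thus "rooted (V - D) q" using assms(3,4) by (simp add: rooted_def)
  next
    assume r: "rooted (V - D) q"
    have "reach V f x" if "x \<in> V" for x
    proof (cases "x \<in> D")
      case True
      thus ?thesis using 3 rooted_reach[OF assms(1)] by simp
    next
      case False
      thus ?thesis using 2 rooted_reach[OF r, of x] that by simp
    qed
    thus "rooted V f" using assms(3,4) by (simp add: rooted_def)
  qed
qed

lemma count_image_mset_set:
  assumes "finite U"
  shows "count (image_mset h (mset_set U)) y = card {v \<in> U. h v = y}"
proof -
  have "h -` {y} \<inter> U = {v \<in> U. h v = y}" by auto
  thus ?thesis using assms by (simp add: count_image_mset)
qed

text \<open>After contracting \<open>D\<close>, the first value in
  \<open>sum_rooted_functions\<close> ranges over \<open>insert 0 D\<close> and gives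
  \<open>\<kappa> + card D\<close>; the other \<open>N - card D - 1\<close> values are unconstrained
  and give \<open>\<kappa> + N\<close> each. The power on the left clears this exponent, so that
  \<open>D = {1..N}\<close> is no exception.\<close>

lemma cylinder_weight:
  fixes \<kappa> :: real
  assumes "rooted D g" "D \<subseteq> {1..N}"
  shows "(\<Sum>f | f \<in> parent_funs N \<and> (\<forall>x\<in>D. f x = g x). \<kappa> ^ card {v \<in> {1..N}. f v = 0}) * (\<kappa> + N) ^ (card D + 1)
    = \<kappa> ^ card {v \<in> D. g v = 0} * (\<kappa> + card D) * (\<kappa> + N) ^ N"
proof -
  define U \<rho> where "U = {1..N} - D" and "\<rho> = (\<lambda>x. if x \<in> D then 0 else x)"
  define k where "k = \<kappa> ^ card {v \<in> D. g v = 0}"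
  define F where "F M = \<kappa> ^ count M 0" for M :: "nat multiset"
  let ?A = "{f. f \<in> parent_funs N \<and> (\<forall>x\<in>D. f x = g x)}"
  let ?B = "{h \<in> U \<rightarrow>\<^sub>E {0..N}. rooted U (\<rho> \<circ> h)}"
  let ?i = "\<lambda>h x. if x \<in> D then g x else h x"
  have finD: "finite D" using assms rooted_finite by blast
  have gcl: "g x \<in> {0..N}" if "x \<in> D" for x
    using rooted_closed[OF assms(1) that] assms(2) by auto
  have insN: "insert 0 {1..N} = {0..N}" by auto
  have iff: "rooted {1..N} f \<longleftrightarrow> rooted U (\<rho> \<circ> f)"
    if "\<And>x. x \<in> D \<Longrightarrow> f x = g x" "\<And>x. x \<in> {1..N} \<Longrightarrow> f x \<in> {0..N}" for f
    unfolding U_def \<rho>_def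
    by (rule rooted_extend_iff[OF assms]) (use that insN in auto)
  have resiff: "rooted U (\<rho> \<circ> f) \<longleftrightarrow> rooted U (\<rho> \<circ> f')" if "\<And>x. x \<in> U \<Longrightarrow> f x = f' x" for f f'
    by (rule rooted_cong) (use that in auto)
  have "(\<Sum>f\<in>?A. \<kappa> ^ card {v \<in> {1..N}. f v = 0})
      = (\<Sum>h\<in>?B. k * F ({#} + image_mset h (mset_set U)))"
  proof (rule sum.reindex_bij_witness[of _ ?i "\<lambda>f. restrict f U"])
    fix f assume f: "f \<in> ?A"
    hence fP: "f \<in> {1..N} \<rightarrow>\<^sub>E {0..N}" and fr: "rooted {1..N} f" and fg: "\<And>x. x \<in> D \<Longrightarrow> f x = g x"
      by (auto simp: parent_funs_def)
    show "?i (restrict f U) = f"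
      using fP fg by (auto simp: fun_eq_iff U_def PiE_def extensional_def)
    show "restrict f U \<in> ?B"
    proof -
      have "rooted U (\<rho> \<circ> restrict f U)" using iff[OF fg] fr PiE_mem[OF fP] resiff[of f "restrict f U"] by auto
      moreover have "restrict f U \<in> U \<rightarrow>\<^sub>E {0..N}"
        unfolding restrict_PiE_iff using fP by (auto simp: U_def)
      ultimately show ?thesis by simp
    qed
    have "{v \<in> {1..N}. f v = 0} = {v \<in> D. g v = 0} \<union> {v \<in> U. restrict f U v = 0}"
      using fg assms(2) by (auto simp: U_def)
    moreover have "{v \<in> D. g v = 0} \<inter> {v \<in> U. restrict f U v = 0} = {}" by (auto simp: U_def)
    ultimately have "card {v \<in> {1..N}. f v = 0} = card {v \<in> D. g v = 0} + card {v \<in> U. restrict f U v = 0}"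
      using finD by (simp add: card_Un_disjoint U_def)
    moreover have "count (image_mset (restrict f U) (mset_set U)) 0 = card {v \<in> U. restrict f U v = 0}"
      by (rule count_image_mset_set) (simp add: U_def)
    ultimately show "k * F ({#} + image_mset (restrict f U) (mset_set U)) = \<kappa> ^ card {v \<in> {1..N}. f v = 0}"
      by (simp only: k_def F_def power_add add_0)
  next
    fix h assume h: "h \<in> ?B"
    hence hP: "h \<in> U \<rightarrow>\<^sub>E {0..N}" and hr: "rooted U (\<rho> \<circ> h)" by auto
    show "restrict (?i h) U = h"
      using hP by (auto simp: fun_eq_iff U_def PiE_def extensional_def)
    have "?i h \<in> {1..N} \<rightarrow>\<^sub>E {0..N}"
    proof (rule PiE_I)
      fix x assume "x \<in> {1..N}"
      thus "?i h x \<in> {0..N}" using gcl[of x] PiE_mem[OF hP, of x] by (auto simp: U_def)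
    next
      fix x assume "x \<notin> {1..N}"
      thus "?i h x = undefined" using hP assms(2) by (auto simp: U_def PiE_def extensional_def)
    qed
    moreover from this have "rooted {1..N} (?i h)"
      using iff[of "?i h"] resiff[of h "?i h"] hr by (auto simp: U_def PiE_def Pi_def)
    ultimately show "?i h \<in> ?A" by (simp add: parent_funs_def)
  qed
  also have "\<dots> = k * (\<Sum>h\<in>U \<rightarrow>\<^sub>E {0..N}. if rooted U (\<rho> \<circ> h) then F ({#} + image_mset h (mset_set U)) else 0)"
  proof -
    have "finite (U \<rightarrow>\<^sub>E {0..N})" by (intro finite_PiE) (auto simp: U_def)
    thus ?thesis by (simp only: sum_distrib_left[symmetric] sum.inter_filter)
  qed
  finally have sum1: "(\<Sum>f\<in>?A. \<kappa> ^ card {v \<in> {1..N}. f v = 0}) =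
    k * (\<Sum>h\<in>U \<rightarrow>\<^sub>E {0..N}. if rooted U (\<rho> \<circ> h) then F ({#} + image_mset h (mset_set U)) else 0)" .
  have cU: "card U = N - card D" and cD: "card D \<le> N"
    using card_Diff_subset[OF finD assms(2)] card_mono[OF _ assms(2)] by (simp_all add: U_def)
  show ?thesis
  proof (cases "U = {}")
    \<comment> \<open>Nothing is left to choose, and \<open>\<kappa> + card D\<close> is just one
      more factor \<open>\<kappa> + N\<close>.\<close>
    case True
    hence "card D = N" using cU cD by simp
    moreover have "rooted {} q" for q by (simp add: rooted_def)
    ultimately show ?thesis unfolding sum1 True by (simp add: F_def k_def)
  next
    case False
    have "(\<Sum>h\<in>U \<rightarrow>\<^sub>E {0..N}. if rooted U (\<rho> \<circ> h) then F ({#} + image_mset h (mset_set U)) else 0)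
      = (\<Sum>c\<in>{c \<in> {0..N}. \<rho> c = 0}. msum {0..N} (card U - 1) F {#c#})"
      by (rule sum_rooted_functions) (use False in \<open>auto simp: U_def \<rho>_def\<close>)
    also have "{c \<in> {0..N}. \<rho> c = 0} = insert 0 D" using assms(2) by (auto simp: \<rho>_def)
    also have "(\<Sum>c\<in>insert 0 D. msum {0..N} (card U - 1) F {#c#})
      = (\<Sum>c\<in>insert 0 D. F {#c#}) * (\<kappa> + N) ^ (card U - 1)"
      unfolding F_def by (subst msum_weight) (auto simp: sum_distrib_right)
    also have "(\<Sum>c\<in>insert 0 D. F {#c#}) = \<kappa> + (\<Sum>c\<in>D. 1)"
    proof -
      have "0 \<notin> D" by (rule rooted_zero[OF assms(1)])
      hence "(\<Sum>c\<in>D. F {#c#}) = (\<Sum>c\<in>D. 1)" by (intro sum.cong) (auto simp: F_def)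
      thus ?thesis using finD \<open>0 \<notin> D\<close> by (simp add: F_def)
    qed
    finally have "(\<Sum>f\<in>?A. \<kappa> ^ card {v \<in> {1..N}. f v = 0}) = k * ((\<kappa> + card D) * (\<kappa> + N) ^ (card U - 1))"
      unfolding sum1 by (simp add: comp_def)
    moreover have "card U \<noteq> 0" using False by (simp add: U_def)
    hence "N = card U - 1 + (card D + 1)" using cU cD by simp
    hence "(\<kappa> + N) ^ N = (\<kappa> + N) ^ (card U - 1) * (\<kappa> + N) ^ (card D + 1)"
      by (metis power_add)
    ultimately show ?thesis by (simp add: k_def)
  qed
qed

text \<open>With \<open>F\<close> the indicator of \<open>M\<close>, the first value is forced to be
  \<open>0\<close> and the others form an arbitrary arrangement of the rest of \<open>M\<close>,
  much as in a Pruefer code.\<close>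

lemma card_parent_funs_indegrees:
  assumes "N \<ge> 1" "0 \<in># M" "size M = N" "set_mset M \<subseteq> {0..N}"
  shows "card {f \<in> parent_funs N. image_mset f (mset_set {1..N}) = M}
    = card (permutations_of_multiset (M - {#0#}))"
proof -
  define F where "F K = (if K = M then 1 else 0 :: real)" for K
  let ?A = "{f \<in> parent_funs N. image_mset f (mset_set {1..N}) = M}"
  have "real (card ?A) = (\<Sum>f\<in>{1..N} \<rightarrow>\<^sub>E {0..N}. if f \<in> ?A then 1 else 0)"
  proof -
    have "?A = {f \<in> {1..N} \<rightarrow>\<^sub>E {0..N}. f \<in> ?A}" by (auto simp: parent_funs_def)
    hence "real (card ?A) = (\<Sum>f\<in>{f \<in> {1..N} \<rightarrow>\<^sub>E {0..N}. f \<in> ?A}. 1)" by simp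
    thus ?thesis by (subst (asm) sum.inter_filter) (auto intro: finite_PiE)
  qed
  also have "\<dots> = (\<Sum>f\<in>{1..N} \<rightarrow>\<^sub>E {0..N}. if rooted {1..N} (id \<circ> f) then F ({#} + image_mset f (mset_set {1..N})) else 0)"
    by (rule sum.cong) (auto simp: parent_funs_def F_def)
  also have "\<dots> = (\<Sum>c\<in>{c \<in> {0..N}. id c = 0}. msum {0..N} (card {1..N} - 1) F {#c#})"
    by (rule sum_rooted_functions) (use assms in auto)
  also have "{c \<in> {0..N}. id c = 0} = {0}" by auto
  also have "(\<Sum>c\<in>{0}. msum {0..N} (card {1..N} - 1) F {#c#})
    = (\<Sum>ws\<in>{ws. set ws \<subseteq> {0..N} \<and> length ws = N - 1}. F ({#0#} + mset ws))"
    by (simp add: msum_lists)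
  also have "\<dots> = (\<Sum>ws\<in>{ws \<in> {ws. set ws \<subseteq> {0..N} \<and> length ws = N - 1}. {#0#} + mset ws = M}. 1)"
    unfolding F_def by (rule sum.inter_filter[symmetric]) (rule finite_lists_length_eq, simp)
  also have "{ws \<in> {ws. set ws \<subseteq> {0..N} \<and> length ws = N - 1}. {#0#} + mset ws = M} = permutations_of_multiset (M - {#0#})"
  proof (intro set_eqI iffI)
    fix ws assume "ws \<in> {ws \<in> {ws. set ws \<subseteq> {0..N} \<and> length ws = N - 1}. {#0#} + mset ws = M}"
    thus "ws \<in> permutations_of_multiset (M - {#0#})" by (auto simp: permutations_of_multiset_def)
  next
    fix ws assume "ws \<in> permutations_of_multiset (M - {#0#})"
    hence ws: "mset ws = M - {#0#}" by (simp add: permutations_of_multiset_def)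
    hence M: "{#0#} + mset ws = M" using assms(2) by simp
    moreover have "length ws = N - 1" using assms(3) M by (metis add_diff_cancel_left' size_mset size_single size_union)
    moreover have "set ws \<subseteq> {0..N}" using assms(4) M by (metis set_mset_mset set_mset_union Un_subset_iff)
    ultimately show "ws \<in> {ws \<in> {ws. set ws \<subseteq> {0..N} \<and> length ws = N - 1}. {#0#} + mset ws = M}" by simp
  qed
  finally show ?thesis by simp
qed

section \<open>Relabelling and reduction\<close>

lemma relabel_pgraph:
  assumes "\<pi> 0 = 0" "\<And>v. v \<in> V \<Longrightarrow> q (\<pi> v) = \<pi> (p v)"
  shows "relabel \<pi> (pgraph V p) = pgraph (\<pi> ` V) q"
proof -
  have "(`) \<pi> ` pedges V p = pedges (\<pi> ` V) q"
    unfolding pedges_def image_image using assms(2) by (intro image_cong) auto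
  thus ?thesis using assms(1) by (simp add: relabel_def pgraph_def)
qed

lemma rooted_relabel:
  assumes "rooted V p" "inj_on \<pi> (insert 0 V)" "\<pi> 0 = 0" "\<And>v. v \<in> V \<Longrightarrow> q (\<pi> v) = \<pi> (p v)"
  shows "rooted (\<pi> ` V) q"
proof -
  have "reach (\<pi> ` V) q (\<pi> v)" if "v \<in> insert 0 V" for v
    using assms(1) that
  proof (induction rule: rooted_induct)
    case root
    show ?case using assms(3) reach.root by metis
  next
    case (step v)
    hence "reach (\<pi> ` V) q (q (\<pi> v))" using assms(4) by simp
    thus ?case using reach.step[of "\<pi> v" "\<pi> ` V" q] step by blast
  qed
  moreover have "0 \<notin> \<pi> ` V"
  proof
    assume "0 \<in> \<pi> ` V"
    then obtain v where "v \<in> V" "\<pi> v = \<pi> 0" using assms(3) by auto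
    thus False using inj_onD[OF assms(2), of v 0] rooted_zero[OF assms(1)] by auto
  qed
  ultimately show ?thesis using rooted_finite[OF assms(1)] by (auto simp: rooted_def)
qed

lemma path_to_root_relabel:
  assumes "rooted V p" "inj_on \<pi> (insert 0 V)" "\<pi> 0 = 0" "\<And>v. v \<in> V \<Longrightarrow> q (\<pi> v) = \<pi> (p v)"
    "v \<in> insert 0 V"
  shows "path_to_root (pedges (\<pi> ` V) q) (\<pi> v) = map \<pi> (ptr V p v)"
  using assms(1,5)
proof (induction rule: rooted_induct)
  case root
  show ?case using path_to_root_zero[OF rooted_relabel[OF assms(1-4)]] path_to_root_zero[OF assms(1)]
    by (simp add: assms(3))
next
  case (step v)
  show ?case
    using path_to_root_step[OF rooted_relabel[OF assms(1-4)], of "\<pi> v"] path_to_root_step[OF assms(1) step(1)]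
      step assms(4)[OF step(1)] by simp
qed

lemma relabel_relabel: "relabel \<sigma> (relabel \<pi> G) = relabel (\<sigma> \<circ> \<pi>) G"
  by (simp add: relabel_def image_image image_comp)

lemma tree_class_relabel:
  assumes "\<pi> permutes {l<..}"
  shows "tree_class l (relabel \<pi> G) = tree_class l G"
proof (intro equalityI subsetI)
  fix H assume "H \<in> tree_class l (relabel \<pi> G)"
  then obtain \<sigma> where s: "\<sigma> permutes {l<..}" "H = relabel (\<sigma> \<circ> \<pi>) G"
    by (auto simp: tree_class_def relabel_relabel)
  thus "H \<in> tree_class l G" using permutes_compose[OF assms s(1)] by (auto simp: tree_class_def)
next
  fix H assume "H \<in> tree_class l G"
  then obtain \<sigma> where s: "\<sigma> permutes {l<..}" "H = relabel \<sigma> G" by (auto simp: tree_class_def)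
  have "\<sigma> = (\<sigma> \<circ> inv \<pi>) \<circ> \<pi>" using permutes_inv_o[OF assms] by (simp add: comp_assoc)
  hence "H = relabel (\<sigma> \<circ> inv \<pi>) (relabel \<pi> G)" using s(2) relabel_relabel by metis
  thus "H \<in> tree_class l (relabel \<pi> G)"
    using permutes_compose[OF permutes_inv[OF assms] s(1)] by (auto simp: tree_class_def)
qed

lemma tree_class_self: "G \<in> tree_class l G"
proof -
  have "relabel id G = G" by (simp add: relabel_def)
  thus ?thesis unfolding tree_class_def using permutes_id by (metis (mono_tags, lifting) mem_Collect_eq)
qed

text \<open>\<open>A\<close> and its image have equal size, so the part of the image outside
  \<open>A\<close> can be sent onto the part of \<open>A\<close> outside the image. Elsewhere the
  identity is taken.\<close>

lemma extend_to_permutation: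
  fixes g :: "'a \<Rightarrow> 'a"
  assumes "finite A" "inj_on g A" "A \<subseteq> S" "g ` A \<subseteq> S"
  shows "\<exists>\<pi>. \<pi> permutes S \<and> (\<forall>x\<in>A. \<pi> x = g x)"
proof -
  define B where "B = g ` A"
  have cB: "card B = card A" "finite B" using assms by (auto simp: B_def card_image)
  have "card (B - A) = card (A - B)"
    using cB assms(1) card_Int_Diff[of B A] card_Int_Diff[of A B] by (simp add: Int_commute)
  then obtain h where h: "bij_betw h (B - A) (A - B)"
    using finite_same_card_bij[of "B - A" "A - B"] assms(1) cB by auto
  have "bij_betw (\<lambda>x. if x \<in> A then g x else h x) (A \<union> (B - A)) (B \<union> (A - B))"
    by (rule bij_betw_disjoint_Un) (use assms(2) h in \<open>auto simp: B_def bij_betw_def\<close>)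
  moreover have "A \<union> (B - A) = A \<union> B" "B \<union> (A - B) = A \<union> B" by auto
  ultimately have bij: "bij_betw (\<lambda>x. if x \<in> A then g x else h x) (A \<union> B) (A \<union> B)" by simp
  define \<pi> where "\<pi> x = (if x \<in> A \<union> B then if x \<in> A then g x else h x else x)" for x
  have "bij_betw \<pi> (A \<union> B) (A \<union> B)"
    using bij by (subst bij_betw_cong[where g = "\<lambda>x. if x \<in> A then g x else h x"]) (auto simp: \<pi>_def)
  hence "\<pi> permutes (A \<union> B)" by (rule bij_imp_permutes) (simp add: \<pi>_def)
  hence "\<pi> permutes S" by (rule permutes_subset) (use assms in \<open>auto simp: B_def\<close>)
  thus ?thesis by (auto simp: \<pi>_def)
qed

section \<open>Ancestors along the path to the root\<close>

lemma path_to_root_mem_self: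
  assumes "rooted V p" "v \<in> insert 0 V"
  shows "v \<in> set (ptr V p v)"
  using path_to_root_Cons[OF assms] by auto

lemma path_to_root_trans:
  assumes "rooted V p" "x \<in> insert 0 V" "v \<in> set (ptr V p x)"
    "w \<in> set (ptr V p v)"
  shows "w \<in> set (ptr V p x)"
  using assms(1,2,3)
proof (induction rule: rooted_induct)
  case root
  thus ?case using assms(4) path_to_root_zero[OF assms(1)] by simp
next
  case (step x)
  thus ?case using assms(4) path_to_root_step[OF assms(1) step(1)] by auto
qed

lemma path_to_root_comparable:
  assumes "rooted V p" "x \<in> insert 0 V" "v \<in> set (ptr V p x)"
    "w \<in> set (ptr V p x)"
  shows "w \<in> set (ptr V p v) \<or> v \<in> set (ptr V p w)"
  using assms
proof (induction rule: rooted_induct)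
  case root
  thus ?case using path_to_root_zero[OF assms(1)] by simp
next
  case (step x)
  thus ?case using path_to_root_step[OF assms(1) step(1)] by auto
qed

lemma path_to_root_depth:
  assumes "rooted V p" "x \<in> insert 0 V" "v \<in> set (ptr V p x)"
  shows "v = x \<or> depth V p v < depth V p x"
  using assms
proof (induction rule: rooted_induct)
  case root
  thus ?case using path_to_root_zero[OF assms(1)] by simp
next
  case (step x)
  thus ?case using path_to_root_step[OF assms(1) step(1)] depth_step[OF assms(1) step(1)] by auto
qed

lemma path_to_root_child:
  assumes "rooted V p" "x \<in> insert 0 V" "v \<in> set (ptr V p x)" "v \<noteq> x"
  shows "\<exists>c\<in>V. c \<in> set (ptr V p x) \<and> p c = v"
  using assms
proof (induction rule: rooted_induct)
  case root
  thus ?case using path_to_root_zero[OF assms(1)] by simp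
next
  case (step x)
  thus ?case using path_to_root_step[OF assms(1) step(1)] by (cases "v = p x") auto
qed

lemma nth_path_to_root:
  assumes "rooted V p" "v \<in> insert 0 V" "k < length (ptr V p v)"
  shows "ptr V p v ! k = (p ^^ k) v"
  using assms
proof (induction arbitrary: k rule: rooted_induct)
  case root
  thus ?case using path_to_root_zero[OF assms(1)] by simp
next
  case (step v)
  thus ?case using path_to_root_step[OF assms(1) step(1)]
    by (cases k) (auto simp: funpow_swap1)
qed

lemma zero_in_path_to_root:
  assumes "rooted V p" "v \<in> insert 0 V"
  shows "0 \<in> set (ptr V p v)"
  using is_path_path_to_root[OF assms] last_in_set unfolding is_path_def by metis

text \<open>The list searches in \<open>first_below\<close> and \<open>num_between\<close> become
  iterates of \<open>p\<close>. They always end, since \<open>0\<close> lies on the path and is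
  retained.\<close>

lemma first_below_spec:
  assumes "rooted V p" "v \<in> V"
  defines "G \<equiv> pgraph V p"
  shows "first_below L G v = (p ^^ Suc (num_between L G v)) v"
    and "(p ^^ Suc (num_between L G v)) v \<in> retained L G"
    and "\<And>j. 1 \<le> j \<Longrightarrow> j \<le> num_between L G v \<Longrightarrow> (p ^^ j) v \<notin> retained L G \<and> (p ^^ j) v \<in> V"
proof -
  define xs where "xs = ptr V p (p v)"
  let ?P = "\<lambda>w. w \<notin> retained L G"
  define n where "n = num_between L G v"
  have pv: "p v \<in> insert 0 V" by (rule rooted_closed[OF assms(1,2)])
  have tl: "tl (path_to_root (snd G) v) = xs"
    by (simp add: xs_def G_def path_to_root_step[OF assms(1,2)])
  have n: "n = length (takeWhile ?P xs)" by (simp add: n_def num_between_def tl)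
  have "0 \<in> set xs" unfolding xs_def by (rule zero_in_path_to_root[OF assms(1) pv])
  moreover have "0 \<in> retained L G" by (simp add: retained_def)
  ultimately have "takeWhile ?P xs \<noteq> xs" by (metis set_takeWhileD)
  moreover have "n \<le> length xs" by (simp add: n length_takeWhile_le)
  ultimately have nl: "n < length xs"
    unfolding n by (metis append_eq_conv_conj le_neq_implies_less takeWhile_dropWhile_id take_all_iff le_refl)
  have nth: "xs ! k = (p ^^ Suc k) v" if "k < length xs" for k
    using nth_path_to_root[OF assms(1) pv] that by (simp add: xs_def funpow_swap1)
  have "first_below L G v = hd (drop n xs)" by (simp add: first_below_def tl n dropWhile_eq_drop)
  also have "\<dots> = xs ! n" by (rule hd_drop_conv_nth[OF nl])
  also have "\<dots> = (p ^^ Suc n) v" by (rule nth[OF nl])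
  finally show "first_below L G v = (p ^^ Suc (num_between L G v)) v" unfolding n_def .
  have "\<not> ?P (xs ! n)" unfolding n by (rule nth_length_takeWhile) (use nl n in simp)
  thus "(p ^^ Suc (num_between L G v)) v \<in> retained L G"
    unfolding nth[OF nl] by (simp add: n_def)
  fix j assume j: "1 \<le> j" "j \<le> num_between L G v"
  then obtain i where i: "j = Suc i" "i < n" by (cases j) (auto simp: n_def)
  have "xs ! i = takeWhile ?P xs ! i" using i n by (simp add: takeWhile_nth)
  moreover have "takeWhile ?P xs ! i \<in> set (takeWhile ?P xs)" using i n by simp
  ultimately have "?P (xs ! i)" "xs ! i \<in> set xs" by (metis set_takeWhileD)+
  moreover have "xs ! i = (p ^^ j) v" using nth[of i] i nl by simp
  ultimately have "(p ^^ j) v \<notin> retained L G" "(p ^^ j) v \<in> insert 0 V"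
    using set_path_to_root[OF assms(1) pv] unfolding xs_def by auto
  moreover have "0 \<in> retained L G" by (simp add: retained_def)
  ultimately show "(p ^^ j) v \<notin> retained L G \<and> (p ^^ j) v \<in> V" by auto
qed

lemma first_below_eqI:
  assumes "rooted V p" "v \<in> V"
    "(p ^^ Suc n) v \<in> retained L (pgraph V p)"
    "\<And>j. 1 \<le> j \<Longrightarrow> j \<le> n \<Longrightarrow> (p ^^ j) v \<notin> retained L (pgraph V p)"
  shows "num_between L (pgraph V p) v = n" "first_below L (pgraph V p) v = (p ^^ Suc n) v"
proof -
  note spec = first_below_spec[OF assms(1,2), where L = L]
  have "\<not> num_between L (pgraph V p) v < n"
    using assms(4)[of "Suc (num_between L (pgraph V p) v)"] spec(2) by auto
  moreover have "\<not> n < num_between L (pgraph V p) v"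
    using spec(3)[of "Suc n"] assms(3) by auto
  ultimately show eq: "num_between L (pgraph V p) v = n" by simp
  show "first_below L (pgraph V p) v = (p ^^ Suc n) v" using spec(1) unfolding eq .
qed

lemma reduction_pgraph: "reduction L G = pgraph (retained L G - {0}) (first_below L G)"
  by (auto simp: reduction_def pgraph_def pedges_def retained_def)

lemma rooted_reduction:
  assumes "rooted V p" "L \<subseteq> V"
  defines "G \<equiv> pgraph V p"
  shows "rooted (retained L G - {0}) (first_below L G)" "retained L G - {0} \<subseteq> V"
proof -
  let ?R = "retained L G" and ?fb = "first_below L G"
  \<comment> \<open>\<open>?h v\<close> is the first retained vertex at or below \<open>v\<close>.
    The induction treats it along with \<open>v\<close>, because \<open>first_below\<close> of
    \<open>v\<close> is \<open>?h (p v)\<close>, where \<open>p v\<close> itself may fail to be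
    retained.\<close>
  let ?h = "\<lambda>v. hd (dropWhile (\<lambda>w. w \<notin> ?R) (ptr V p v))"
  have z: "0 \<in> ?R" by (simp add: retained_def)
  show sub: "?R - {0} \<subseteq> V" using assms(2) by (auto simp: retained_def nodes_def G_def)
  have "(v \<in> ?R \<longrightarrow> reach (?R - {0}) ?fb v) \<and> reach (?R - {0}) ?fb (?h v)"
    if "v \<in> insert 0 V" for v
    using assms(1) that
  proof (induction rule: rooted_induct)
    case root
    show ?case using path_to_root_zero[OF assms(1)] z reach.root by simp
  next
    case (step v)
    have fb: "?fb v = ?h (p v)"
      by (simp add: first_below_def G_def path_to_root_step[OF assms(1) step(1)])
    have 1: "reach (?R - {0}) ?fb v" if "v \<in> ?R"
    proof (rule reach.step)
      show "v \<in> ?R - {0}" using that step(1) rooted_zero[OF assms(1)] by (metis Diff_iff singletonD)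
      show "reach (?R - {0}) ?fb (?fb v)" unfolding fb using step by blast
    qed
    have "?h v = (if v \<in> ?R then v else ?h (p v))"
      by (simp add: path_to_root_step[OF assms(1) step(1)])
    thus ?case using 1 step by metis
  qed
  thus "rooted (?R - {0}) ?fb"
    using sub finite_subset[OF sub rooted_finite[OF assms(1)]] unfolding rooted_def by blast
qed

section \<open>Binary trees\<close>

lemma (in linorder) sorted_key_list_of_set_inj:
  assumes "inj_on f A" "finite A"
  shows "set (sorted_key_list_of_set f A) = A" "distinct (sorted_key_list_of_set f A)"
    "sorted (map f (sorted_key_list_of_set f A))" "length (sorted_key_list_of_set f A) = card A"
proof -
  interpret folding_insort_key "(\<le>)" "(<)" A f
    by unfold_locales (rule assms(1))
  show "set (sorted_key_list_of_set f A) = A" "sorted (map f (sorted_key_list_of_set f A))"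
    "length (sorted_key_list_of_set f A) = card A"
    by (simp_all add: assms(2))
  have "distinct (map f (sorted_key_list_of_set f A))" by simp
  thus "distinct (sorted_key_list_of_set f A)" by (simp add: distinct_map)
qed

locale binary_tree =
  fixes l :: nat and V :: "nat set" and p :: "nat \<Rightarrow> nat"
  assumes rooted: "rooted V p"
    and leaves: "{v \<in> V. {y \<in> V. p y = v} = {}} = {1..l}"
    and two_children: "\<And>v. v \<in> V \<Longrightarrow> v \<notin> {1..l} \<Longrightarrow> card {y \<in> V. p y = v} = 2"
    and root_child: "card {y \<in> V. p y = 0} = 1"

lemma is_binary_pgraph:
  assumes "rooted V p"
  shows "is_binary l (pgraph V p) \<longleftrightarrow> binary_tree l V p"
proof -
  have z: "0 \<notin> V" by (rule rooted_zero[OF assms])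
  have cl: "childless (pgraph V p) = {v \<in> V. {y \<in> V. p y = v} = {}}"
    using z by (auto simp: childless_def children_pgraph[OF assms])
  show ?thesis
    unfolding is_binary_def binary_tree_def cl children_pgraph[OF assms]
    using is_tree_pgraph[OF assms] assms z by auto
qed

lemma is_binary_iff: "is_binary l G \<longleftrightarrow> (\<exists>V p. G = pgraph V p \<and> binary_tree l V p)"
proof
  assume b: "is_binary l G"
  then obtain p where "rooted (fst G - {0}) p" "G = pgraph (fst G - {0}) p"
    using tree_eq_pgraph[of G] by (auto simp: is_binary_def)
  thus "\<exists>V p. G = pgraph V p \<and> binary_tree l V p" using is_binary_pgraph b by metis
next
  assume "\<exists>V p. G = pgraph V p \<and> binary_tree l V p"
  thus "is_binary l G" using is_binary_pgraph binary_tree.rooted by metis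
qed

context binary_tree
begin

lemma finite_V: "finite V" and zero_notin: "0 \<notin> V"
  using rooted by (auto simp: rooted_def)

lemma leaves_subset: "{1..l} \<subseteq> V"
  using leaves by auto

lemma leaf_iff: "v \<in> V \<Longrightarrow> v \<in> {1..l} \<longleftrightarrow> {y \<in> V. p y = v} = {}"
  unfolding leaves[symmetric] by blast

lemma non_leaf_gt:
  assumes "v \<in> V" "v \<notin> {1..l}"
  shows "v > l"
proof -
  have "v \<noteq> 0" using assms zero_notin by metis
  thus ?thesis using assms(2) by simp
qed

text \<open>Counting vertices by their parents gives \<open>card V = 1 + 2 * (card V - l)\<close>:
  one child of the root, two of each inner vertex, none of a leaf.\<close>

lemma card_V: "card V = 2 * l - 1" "l \<ge> 1"
proof -
  have "card V = (\<Sum>x\<in>insert 0 V. card {y \<in> V. p y = x})"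
  proof -
    have "V = (\<Union>x\<in>insert 0 V. {y \<in> V. p y = x})" using rooted_closed[OF rooted] by blast
    hence "card V = card (\<Union>x\<in>insert 0 V. {y \<in> V. p y = x})" by simp
    also have "\<dots> = (\<Sum>x\<in>insert 0 V. card {y \<in> V. p y = x})"
      by (rule card_UN_disjoint) (use finite_V in auto)
    finally show ?thesis .
  qed
  also have "\<dots> = 1 + (\<Sum>x\<in>V. card {y \<in> V. p y = x})"
    using finite_V zero_notin root_child by simp
  also have "(\<Sum>x\<in>V. card {y \<in> V. p y = x}) = (\<Sum>x\<in>V. if x \<in> {1..l} then 0 else 2)"
  proof (rule sum.cong[OF refl])
    fix x assume x: "x \<in> V"
    show "card {y \<in> V. p y = x} = (if x \<in> {1..l} then 0 else 2)"
    proof (cases "x \<in> {1..l}")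
      case True
      hence "{y \<in> V. p y = x} = {}" using leaf_iff[OF x] by blast
      thus ?thesis using True by (simp only: if_True card.empty)
    next
      case False
      thus ?thesis using two_children[OF x] by simp
    qed
  qed
  also have "\<dots> = (\<Sum>x\<in>V - {1..l}. 2)"
    by (rule sum.mono_neutral_cong_right) (use finite_V in auto)
  also have "\<dots> = 2 * (card V - l)" using leaves_subset by (simp add: card_Diff_subset)
  finally have e: "card V = 1 + 2 * (card V - l)" .
  have "l \<le> card V" using card_mono[OF finite_V leaves_subset] by simp
  thus "card V = 2 * l - 1" "l \<ge> 1" using e by presburger+
qed

abbreviation "way \<equiv> ptr V p"
abbreviation "tips \<equiv> leaves_above l (pgraph V p)"

lemma tips_def: "tips v = {x \<in> {1..l}. v \<in> set (way x)}"
  by (simp add: leaves_above_def)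

lemma tips_nonempty: "v \<in> V \<Longrightarrow> tips v \<noteq> {}"
  using rooted
proof (induction rule: rooted_up_induct)
  case (up v)
  show ?case
  proof (cases "v \<in> {1..l}")
    case True
    thus ?thesis using path_to_root_mem_self[OF rooted, of v] up(1) by (auto simp: tips_def)
  next
    case False
    then obtain w where w: "w \<in> V" "p w = v" using leaf_iff[OF up(1)] by blast
    then obtain x where x: "x \<in> {1..l}" "w \<in> set (way x)" using up(2) by (auto simp: tips_def)
    have "w \<noteq> 0" using w zero_notin by metis
    hence "v \<in> set (way x)"
      using path_to_root_closed[OF rooted _ x(2)] x(1) leaves_subset w by auto
    thus ?thesis using x(1) unfolding tips_def by blast
  qed
qed

text \<open>A proper ancestor \<open>w\<close> of \<open>v\<close> has a second child, not on the way to \<open>v\<close>, whose leaves are not above \<open>v\<close>.\<close>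

lemma tips_neq_ancestor:
  assumes v: "v \<in> V" and w: "w \<in> V" "w \<in> set (way v)" "w \<noteq> v"
  shows "tips v \<noteq> tips w"
proof -
  obtain c where c: "c \<in> V" "c \<in> set (way v)" "p c = w"
    using path_to_root_child[OF rooted _ w(2,3)] v by auto
  have "w \<notin> {1..l}" using leaf_iff[OF w(1)] c by blast
  hence "card {y \<in> V. p y = w} = 2" by (rule two_children[OF w(1)])
  hence "{y \<in> V. p y = w} \<noteq> {c}" by auto
  then obtain d where d: "d \<in> V" "p d = w" "d \<noteq> c" using c by blast
  obtain x where x: "x \<in> {1..l}" "d \<in> set (way x)" using tips_nonempty[OF d(1)] by (auto simp: tips_def)
  have xV: "x \<in> insert 0 V" using x leaves_subset by blast
  \<comment> \<open>Of two different children of \<open>w\<close>, neither is an ancestor of the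
    other: it would be \<open>w\<close> or an ancestor of \<open>w\<close>, where the depth is too
    small.\<close>
  have no: "\<not> b \<in> set (way a)" if "a \<in> V" "b \<in> V" "p a = w" "p b = w" "a \<noteq> b" for a b
  proof
    assume "b \<in> set (way a)"
    hence "b \<in> set (way w)" using that path_to_root_step[OF rooted that(1)] by auto
    hence "b = w \<or> depth V p b < depth V p w"
      using path_to_root_depth[OF rooted] w(1) by blast
    thus False using depth_step[OF rooted that(2)] that(4) by auto
  qed
  have "x \<notin> tips v"
  proof
    assume "x \<in> tips v"
    hence "v \<in> set (way x)" by (simp add: tips_def)
    hence "c \<in> set (way x)" using path_to_root_trans[OF rooted xV] c by blast
    thus False using path_to_root_comparable[OF rooted xV x(2)] no[of d c] no[of c d] c d by blast
  qed
  moreover have "d \<noteq> 0" using d zero_notin by metis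
  hence "w \<in> set (way x)" using path_to_root_closed[OF rooted xV x(2)] d by simp
  hence "x \<in> tips w" using x(1) by (simp add: tips_def)
  ultimately show ?thesis by blast
qed

text \<open>Vertices that share a leaf lie on one path, hence are comparable, and
  \<open>tips_neq_ancestor\<close> applies. Leaf sets may therefore serve as names of the
  edges.\<close>

lemma inj_on_tips: "inj_on tips V"
proof (rule inj_onI, rule ccontr)
  fix v w assume vw: "v \<in> V" "w \<in> V" "tips v = tips w" "v \<noteq> w"
  obtain x where x: "x \<in> tips v" using tips_nonempty vw by blast
  have "x \<in> insert 0 V" "v \<in> set (way x)" "w \<in> set (way x)"
    using x vw leaves_subset by (auto simp: tips_def)
  hence "w \<in> set (way v) \<or> v \<in> set (way w)" using path_to_root_comparable[OF rooted] by blast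
  thus False using tips_neq_ancestor vw by metis
qed

abbreviation "key \<equiv> \<lambda>v. set_encode (tips v)"

lemma inj_on_key: "inj_on key V"
proof (rule inj_onI)
  fix v w assume "v \<in> V" "w \<in> V" "key v = key w"
  moreover have "finite (tips v)" "finite (tips w)" by (simp_all add: leaves_above_def)
  ultimately show "v = w" using inj_onD[OF inj_on_tips, of v w] set_encode_eq by blast
qed

abbreviation "es \<equiv> edge_list l (pgraph V p)"

lemma es_props: "set es = V" "distinct es" "sorted (map key es)" "length es = 2 * l - 1"
proof -
  have "fst (pgraph V p) - {0} = V" using zero_notin by auto
  hence es: "es = sorted_key_list_of_set key V" unfolding edge_list_def by simp
  show "set es = V" "distinct es" "sorted (map key es)" "length es = 2 * l - 1"
    unfolding es using sorted_key_list_of_set_inj[OF inj_on_key finite_V] card_V by auto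
qed

text \<open>The labels of the leaves are fixed by \<pi>, so every vertex keeps its leaf set and
  hence its key. The sorted edge list is carried along by \<pi>, which makes the enumeration of the
  edges a matter of the class alone.\<close>

lemma relabelled:
  assumes "inj_on \<pi> (insert 0 V)" "\<pi> 0 = 0" "\<And>i. i \<in> {1..l} \<Longrightarrow> \<pi> i = i"
    "\<And>v. v \<in> V \<Longrightarrow> q (\<pi> v) = \<pi> (p v)"
  shows "binary_tree l (\<pi> ` V) q" "edge_list l (pgraph (\<pi> ` V) q) = map \<pi> es"
proof -
  have r: "rooted (\<pi> ` V) q" by (rule rooted_relabel[OF rooted assms(1,2,4)])
  have inj: "\<pi> v = \<pi> w \<longleftrightarrow> v = w" if "v \<in> insert 0 V" "w \<in> insert 0 V" for v w
    using inj_onD[OF assms(1) _ that] by blast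
  have ch: "{y \<in> \<pi> ` V. q y = \<pi> v} = \<pi> ` {y \<in> V. p y = v}" if "v \<in> insert 0 V" for v
    using assms(4) inj rooted_closed[OF rooted] that by auto
  have injV: "inj_on \<pi> A" if "A \<subseteq> V" for A using assms(1) that by (meson inj_on_subset subset_insertI2)
  show b: "binary_tree l (\<pi> ` V) q"
  proof
    show "rooted (\<pi> ` V) q" by (rule r)
    have "{v \<in> \<pi> ` V. {y \<in> \<pi> ` V. q y = v} = {}} = \<pi> ` {v \<in> V. {y \<in> V. p y = v} = {}}"
    proof (intro equalityI subsetI)
      fix x assume "x \<in> {v \<in> \<pi> ` V. {y \<in> \<pi> ` V. q y = v} = {}}"
      then obtain v where v: "v \<in> V" "x = \<pi> v" "{y \<in> \<pi> ` V. q y = \<pi> v} = {}" by blast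
      hence "{y \<in> V. p y = v} = {}" using ch[of v] by blast
      thus "x \<in> \<pi> ` {v \<in> V. {y \<in> V. p y = v} = {}}" using v by blast
    next
      fix x assume "x \<in> \<pi> ` {v \<in> V. {y \<in> V. p y = v} = {}}"
      then obtain v where v: "v \<in> V" "x = \<pi> v" "{y \<in> V. p y = v} = {}" by blast
      hence "{y \<in> \<pi> ` V. q y = \<pi> v} = {}" using ch[of v] by blast
      thus "x \<in> {v \<in> \<pi> ` V. {y \<in> \<pi> ` V. q y = v} = {}}" using v by blast
    qed
    thus "{v \<in> \<pi> ` V. {y \<in> \<pi> ` V. q y = v} = {}} = {1..l}" unfolding leaves using assms(3) by simp
    show "card {y \<in> \<pi> ` V. q y = v} = 2" if "v \<in> \<pi> ` V" "v \<notin> {1..l}" for v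
    proof -
      obtain w where w: "w \<in> V" "v = \<pi> w" using \<open>v \<in> \<pi> ` V\<close> by blast
      have "w \<notin> {1..l}" using w that(2) assms(3) by metis
      thus ?thesis using ch[of w] two_children[OF w(1)] w injV by (simp add: card_image)
    qed
    show "card {y \<in> \<pi> ` V. q y = 0} = 1"
      using ch[of 0] root_child injV by (simp add: assms(2) card_image)
  qed
  have ab: "leaves_above l (pgraph (\<pi> ` V) q) (\<pi> v) = tips v" if "v \<in> V" for v
  proof -
    have "\<pi> v \<in> set (path_to_root (pedges (\<pi> ` V) q) x) \<longleftrightarrow> v \<in> set (way x)" if x: "x \<in> {1..l}" for x
    proof -
      have xV: "x \<in> insert 0 V" using x leaves_subset by blast
      have "path_to_root (pedges (\<pi> ` V) q) x = map \<pi> (way x)"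
        using path_to_root_relabel[OF rooted assms(1,2,4) xV] assms(3)[OF x] by simp
      moreover have "set (way x) \<subseteq> insert 0 V" by (rule set_path_to_root[OF rooted xV])
      ultimately show ?thesis using inj \<open>v \<in> V\<close> by auto
    qed
    thus ?thesis unfolding leaves_above_def by auto
  qed
  interpret b: binary_tree l "\<pi> ` V" q by (rule b)
  show "edge_list l (pgraph (\<pi> ` V) q) = map \<pi> es"
  proof (rule map_sorted_distinct_set_unique[where f = "b.key"])
    show "set b.es = set (map \<pi> es)" using b.es_props es_props by simp
    thus "inj_on b.key (set b.es \<union> set (map \<pi> es))" using b.inj_on_key b.es_props(1) by auto
    show "sorted (map b.key b.es)" by (rule b.es_props)
    show "distinct (map b.key b.es)" using b.es_props b.inj_on_key by (simp add: distinct_map)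
    have eq: "map b.key (map \<pi> es) = map key es" using ab es_props(1) by simp
    show "sorted (map b.key (map \<pi> es))" unfolding eq by (rule es_props)
    show "distinct (map b.key (map \<pi> es))" unfolding eq
      using es_props inj_on_key by (simp add: distinct_map)
  qed
qed

end

section \<open>Subdivisions of a binary tree\<close>

context binary_tree
begin

text \<open>The slot \<open>(v, j)\<close> stands for the \<open>j\<close>-th vertex on the edge below \<open>v\<close> once \<open>u v\<close> intermediate vertices
  have been inserted there; \<open>(v, 0)\<close> is \<open>v\<close> itself. A map \<open>\<phi>\<close> on slots labels the subdivided tree.\<close>

definition slots :: "(nat \<Rightarrow> nat) \<Rightarrow> (nat \<times> nat) set" where
  "slots u = (SIGMA v:V. {..u v})"

text \<open>The slots whose label is open: the slot \<open>(i, 0)\<close> of a leaf must carry the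
  label \<open>i\<close>.\<close>

definition free_slots :: "(nat \<Rightarrow> nat) \<Rightarrow> (nat \<times> nat) set" where
  "free_slots u = slots u - (\<lambda>i. (i, 0)) ` {1..l}"

text \<open>The root has no slot, hence the separate value at \<open>0\<close>.\<close>

definition head :: "(nat \<times> nat \<Rightarrow> nat) \<Rightarrow> nat \<Rightarrow> nat" where
  "head \<phi> v = (if v = 0 then 0 else \<phi> (v, 0))"

text \<open>The parent function of the subdivided tree, read through the labels.\<close>

definition nxt :: "(nat \<Rightarrow> nat) \<Rightarrow> (nat \<times> nat \<Rightarrow> nat) \<Rightarrow> nat \<times> nat \<Rightarrow> nat" where
  "nxt u \<phi> s = (if snd s < u (fst s) then \<phi> (fst s, Suc (snd s)) else head \<phi> (p (fst s)))"

definition placed :: "nat \<Rightarrow> (nat \<Rightarrow> nat) \<Rightarrow> (nat \<times> nat \<Rightarrow> nat) \<Rightarrow> bool" where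
  "placed N u \<phi> \<longleftrightarrow> inj_on \<phi> (slots u) \<and> (\<forall>i\<in>{1..l}. \<phi> (i, 0) = i) \<and> \<phi> ` free_slots u \<subseteq> {l<..N}"

text \<open>Containment of the labelled subdivided tree in the tree with parent function
  \<open>f\<close>.\<close>

definition follows :: "(nat \<Rightarrow> nat) \<Rightarrow> (nat \<Rightarrow> nat) \<Rightarrow> (nat \<times> nat \<Rightarrow> nat) \<Rightarrow> bool" where
  "follows u f \<phi> \<longleftrightarrow> (\<forall>s\<in>slots u. f (\<phi> s) = nxt u \<phi> s)"

lemma slots_mem: "(v, j) \<in> slots u \<longleftrightarrow> v \<in> V \<and> j \<le> u v"
  by (auto simp: slots_def)

lemma finite_slots: "finite (slots u)"
  unfolding slots_def using finite_V by auto

lemma card_slots: "card (slots u) = 2 * l - 1 + (\<Sum>v\<in>V. u v)"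
  using finite_V card_V by (simp add: slots_def card_SigmaI sum_Suc)

lemma card_free_slots: "card (free_slots u) = l - 1 + (\<Sum>v\<in>V. u v)"
proof -
  have "(\<lambda>i. (i, 0)) ` {1..l} \<subseteq> slots u" using leaves_subset by (auto simp: slots_def)
  moreover have "card ((\<lambda>i::nat. (i, 0::nat)) ` {1..l}) = l" by (subst card_image) (auto simp: inj_on_def)
  ultimately show ?thesis
    using card_slots[of u] card_V by (simp add: free_slots_def card_Diff_subset)
qed

lemma placed_range:
  assumes "placed N u \<phi>" "l \<le> N" "s \<in> slots u"
  shows "\<phi> s \<in> {1..N}"
proof (cases "s \<in> free_slots u")
  case True
  thus ?thesis using assms(1) by (fastforce simp: placed_def)
next
  case False
  then obtain i where "i \<in> {1..l}" "s = (i, 0)" using assms(3) by (auto simp: free_slots_def)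
  thus ?thesis using assms(1,2) by (auto simp: placed_def)
qed

lemma placed_head_inj:
  assumes "placed N u \<phi>" "l \<le> N"
  shows "inj_on (head \<phi>) (insert 0 V)"
proof (rule inj_onI)
  fix v w assume vw: "v \<in> insert 0 V" "w \<in> insert 0 V" and eq: "head \<phi> v = head \<phi> w"
  have nz: "\<phi> (v, 0) \<noteq> 0" if "v \<in> V" for v
    using placed_range[OF assms, of "(v, 0)"] that by (simp add: slots_mem)
  have inj: "v = w" if "v \<in> V" "w \<in> V" "\<phi> (v, 0) = \<phi> (w, 0)"
  proof -
    have "inj_on \<phi> (slots u)" using assms(1) by (simp add: placed_def)
    from inj_onD[OF this that(3)] that(1,2) show ?thesis by (simp add: slots_mem)
  qed
  show "v = w"
  proof (cases "v = 0")
    case True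
    thus ?thesis using eq vw nz[of w] by (auto simp: head_def split: if_splits)
  next
    case False
    thus ?thesis using eq vw nz[of v] inj by (auto simp: head_def split: if_splits)
  qed
qed

text \<open>Within an edge the orbit runs down to the next head; from head to head it copies the
  orbit in the binary tree.\<close>

lemma placed_rooted:
  assumes "placed N u \<phi>" "l \<le> N" "\<And>s. s \<in> slots u \<Longrightarrow> g (\<phi> s) = nxt u \<phi> s"
  shows "rooted (\<phi> ` slots u) g"
proof -
  let ?D = "\<phi> ` slots u"
  have down: "reach ?D g (\<phi> (v, j))" if v: "v \<in> V" and h: "reach ?D g (head \<phi> (p v))" and j: "j \<le> u v" for v j
    using j
  proof (induction "u v - j" arbitrary: j)
    case 0
    hence "g (\<phi> (v, j)) = head \<phi> (p v)" using assms(3)[of "(v, j)"] v by (simp add: slots_mem nxt_def)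
    thus ?case using h reach.step[of "\<phi> (v, j)" ?D g] v 0 by (simp add: slots_mem)
  next
    case (Suc m)
    hence "j < u v" by linarith
    hence "g (\<phi> (v, j)) = \<phi> (v, Suc j)" using assms(3)[of "(v, j)"] v by (simp add: slots_mem nxt_def)
    moreover have "reach ?D g (\<phi> (v, Suc j))" using Suc by (intro Suc.hyps) auto
    ultimately show ?case using reach.step[of "\<phi> (v, j)" ?D g] v Suc by (simp add: slots_mem)
  qed
  have "reach ?D g (head \<phi> v)" if "v \<in> insert 0 V" for v
    using rooted that
  proof (induction rule: rooted_induct)
    case root
    show ?case by (simp add: head_def reach.root)
  next
    case (step v)
    have "v \<noteq> 0" using step(1) zero_notin by metis
    thus ?case using down[OF step(1) step(3), of 0] by (simp add: head_def)
  qed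
  hence "reach ?D g (\<phi> (v, j))" if "(v, j) \<in> slots u" for v j
    using down[of v j] that rooted_closed[OF rooted, of v] by (auto simp: slots_mem)
  moreover have "0 \<notin> ?D" using placed_range[OF assms(1,2)] by fastforce
  ultimately show ?thesis using finite_slots by (auto simp: rooted_def)
qed

text \<open>Together with \<open>placed_children_inner\<close> this shows that subdividing creates
  no nodes: heads keep their number of children, and an inserted vertex has a single child.\<close>

lemma placed_children_head:
  assumes "placed N u \<phi>" "l \<le> N" "\<And>s. s \<in> slots u \<Longrightarrow> g (\<phi> s) = nxt u \<phi> s" "v \<in> insert 0 V"
  shows "{x \<in> \<phi> ` slots u. g x = head \<phi> v} = (\<lambda>w. \<phi> (w, u w)) ` {w \<in> V. p w = v}"
    and "card {x \<in> \<phi> ` slots u. g x = head \<phi> v} = card {w \<in> V. p w = v}"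
proof -
  have inj: "inj_on \<phi> (slots u)" using assms(1) by (simp add: placed_def)
  show eq: "{x \<in> \<phi> ` slots u. g x = head \<phi> v} = (\<lambda>w. \<phi> (w, u w)) ` {w \<in> V. p w = v}"
  proof (intro equalityI subsetI)
    fix x assume "x \<in> {x \<in> \<phi> ` slots u. g x = head \<phi> v}"
    then obtain w j where wj: "(w, j) \<in> slots u" "x = \<phi> (w, j)" "nxt u \<phi> (w, j) = head \<phi> v"
      using assms(3) by auto
    have "\<not> j < u w"
    proof
      assume j: "j < u w"
      hence s: "(w, Suc j) \<in> slots u" using wj by (simp add: slots_mem)
      have "\<phi> (w, Suc j) = head \<phi> v" using wj j by (simp add: nxt_def)
      moreover have "\<phi> (w, Suc j) \<noteq> 0" using placed_range[OF assms(1,2) s] by simp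
      ultimately have "v \<in> V" "\<phi> (w, Suc j) = \<phi> (v, 0)" using assms(4) by (auto simp: head_def split: if_splits)
      thus False using inj_onD[OF inj, of "(w, Suc j)" "(v, 0)"] s by (simp add: slots_mem)
    qed
    hence j: "j = u w" "head \<phi> (p w) = head \<phi> v" using wj by (auto simp: slots_mem nxt_def)
    have "p w = v" using inj_onD[OF placed_head_inj[OF assms(1,2)] j(2)] assms(4)
      rooted_closed[OF rooted, of w] wj(1) by (auto simp: slots_mem)
    thus "x \<in> (\<lambda>w. \<phi> (w, u w)) ` {w \<in> V. p w = v}" using wj j by (auto simp: slots_mem)
  next
    fix x assume "x \<in> (\<lambda>w. \<phi> (w, u w)) ` {w \<in> V. p w = v}"
    then obtain w where w: "w \<in> V" "p w = v" "x = \<phi> (w, u w)" by blast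
    hence "(w, u w) \<in> slots u" by (simp add: slots_mem)
    moreover have "nxt u \<phi> (w, u w) = head \<phi> v" using w by (simp add: nxt_def)
    ultimately show "x \<in> {x \<in> \<phi> ` slots u. g x = head \<phi> v}" using assms(3) w(3) by auto
  qed
  have "inj_on (\<lambda>w. \<phi> (w, u w)) {w \<in> V. p w = v}"
  proof (rule inj_onI)
    fix a b assume "a \<in> {w \<in> V. p w = v}" "b \<in> {w \<in> V. p w = v}" "\<phi> (a, u a) = \<phi> (b, u b)"
    thus "a = b" using inj_onD[OF inj, of "(a, u a)" "(b, u b)"] by (simp add: slots_mem)
  qed
  thus "card {x \<in> \<phi> ` slots u. g x = head \<phi> v} = card {w \<in> V. p w = v}"
    unfolding eq by (rule card_image)
qed

lemma placed_children_inner: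
  assumes "placed N u \<phi>" "l \<le> N" "\<And>s. s \<in> slots u \<Longrightarrow> g (\<phi> s) = nxt u \<phi> s" "(v, Suc j) \<in> slots u"
  shows "{x \<in> \<phi> ` slots u. g x = \<phi> (v, Suc j)} = {\<phi> (v, j)}"
proof (intro equalityI subsetI)
  have inj: "inj_on \<phi> (slots u)" using assms(1) by (simp add: placed_def)
  fix x assume "x \<in> {x \<in> \<phi> ` slots u. g x = \<phi> (v, Suc j)}"
  then obtain w i where wi: "(w, i) \<in> slots u" "x = \<phi> (w, i)" "nxt u \<phi> (w, i) = \<phi> (v, Suc j)"
    using assms(3) by auto
  have "i < u w"
  proof (rule ccontr)
    assume "\<not> i < u w"
    hence h: "head \<phi> (p w) = \<phi> (v, Suc j)" using wi by (simp add: nxt_def)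
    hence "p w \<noteq> 0" using placed_range[OF assms(1,2,4)] by (auto simp: head_def split: if_splits)
    hence "(p w, 0) \<in> slots u" "\<phi> (p w, 0) = \<phi> (v, Suc j)"
      using h rooted_closed[OF rooted, of w] wi(1) by (auto simp: head_def slots_mem)
    thus False using inj_onD[OF inj, of "(p w, 0)" "(v, Suc j)"] assms(4) by simp
  qed
  hence "(w, Suc i) \<in> slots u" "\<phi> (w, Suc i) = \<phi> (v, Suc j)"
    using wi by (auto simp: slots_mem nxt_def)
  hence "(w, Suc i) = (v, Suc j)" using inj_onD[OF inj, of "(w, Suc i)" "(v, Suc j)"] assms(4) by blast
  thus "x \<in> {\<phi> (v, j)}" using wi by simp
next
  fix x assume "x \<in> {\<phi> (v, j)}"
  moreover have "(v, j) \<in> slots u" "j < u v" using assms(4) by (auto simp: slots_mem)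
  ultimately show "x \<in> {x \<in> \<phi> ` slots u. g x = \<phi> (v, Suc j)}"
    using assms(3)[of "(v, j)"] by (auto simp: nxt_def)
qed

text \<open>An instance of \<open>cylinder_weight\<close> for the labelled slots. The factor
  \<kappa> has exponent one because the root of a binary tree has a single child.\<close>

lemma follows_weight:
  fixes \<kappa> :: real
  assumes "placed N u \<phi>" "l \<le> N"
  shows "(\<Sum>f | f \<in> parent_funs N \<and> follows u f \<phi>. \<kappa> ^ card {v \<in> {1..N}. f v = 0}) * (\<kappa> + N) ^ (card (slots u) + 1)
    = \<kappa> * (\<kappa> + card (slots u)) * (\<kappa> + N) ^ N"
proof -
  have inj: "inj_on \<phi> (slots u)" using assms(1) by (simp add: placed_def)
  define g where "g x = nxt u \<phi> (inv_into (slots u) \<phi> x)" for x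
  have g: "g (\<phi> s) = nxt u \<phi> s" if "s \<in> slots u" for s
    using that inj by (simp add: g_def)
  have r: "rooted (\<phi> ` slots u) g" by (rule placed_rooted[OF assms g])
  have sub: "\<phi> ` slots u \<subseteq> {1..N}" using placed_range[OF assms] by blast
  have "card {x \<in> \<phi> ` slots u. g x = 0} = 1"
    using placed_children_head(2)[OF assms g, of 0] root_child by (simp add: head_def)
  moreover have "(\<forall>x\<in>\<phi> ` slots u. f x = g x) \<longleftrightarrow> follows u f \<phi>" for f
    using g by (auto simp: follows_def)
  ultimately show ?thesis using cylinder_weight[OF r sub, of \<kappa>] by (simp add: card_image[OF inj])
qed

text \<open>One inclusion is minimality, as the labelled slots are closed under \<open>f\<close> and
  contain the leaves. For the other, membership spreads from the leaves downwards, each further slot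
  being the parent of one already reached.\<close>

lemma follows_anc:
  assumes "placed N u \<phi>" "l \<le> N" "f \<in> parent_funs N" "follows u f \<phi>"
  shows "anc {1..N} f {1..l} = \<phi> ` slots u"
proof
  have r: "rooted {1..N} f" using assms(3) by (simp add: parent_funs_def)
  have fn: "f (\<phi> s) = nxt u \<phi> s" if "s \<in> slots u" for s using assms(4) that by (simp add: follows_def)
  have rD: "rooted (\<phi> ` slots u) f" by (rule placed_rooted[OF assms(1,2) fn])
  have L: "{1..l} \<subseteq> {1..N}" using assms(2) by auto
  have lD: "{1..l} \<subseteq> \<phi> ` slots u"
  proof
    fix i assume i: "i \<in> {1..l}"
    hence "(i, 0) \<in> slots u" "\<phi> (i, 0) = i" using leaves_subset assms(1) by (auto simp: slots_mem placed_def)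
    thus "i \<in> \<phi> ` slots u" by (metis image_eqI)
  qed
  show "anc {1..N} f {1..l} \<subseteq> \<phi> ` slots u"
  proof (rule anc_least[OF r lD])
    show "\<phi> ` slots u \<subseteq> {1..N}" using placed_range[OF assms(1,2)] by blast
    show "f v \<in> insert 0 (\<phi> ` slots u)" if "v \<in> \<phi> ` slots u" for v by (rule rooted_closed[OF rD that])
  qed
  have cl: "f x \<in> anc {1..N} f {1..l}" if "x \<in> anc {1..N} f {1..l}" "f x \<noteq> 0" for x
    using rooted_anc(4)[OF r L that(1)] that(2) by auto
  have up: "\<forall>j\<le>u v. \<phi> (v, j) \<in> anc {1..N} f {1..l}" if "v \<in> V" for v
    using rooted that
  proof (induction rule: rooted_up_induct)
    case (up v)
    show ?case
    proof (intro allI impI)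
      fix j assume "j \<le> u v"
      thus "\<phi> (v, j) \<in> anc {1..N} f {1..l}"
      proof (induction j)
        case 0
        show ?case
        proof (cases "v \<in> {1..l}")
          case True
          hence "\<phi> (v, 0) = v" using assms(1) by (simp add: placed_def)
          thus ?thesis using True rooted_anc(2)[OF r L] by auto
        next
          case False
          then obtain w where w: "w \<in> V" "p w = v" using leaf_iff[OF up(1)] by blast
          have "v \<noteq> 0" using up(1) zero_notin by metis
          hence "f (\<phi> (w, u w)) = \<phi> (v, 0)"
            using fn[of "(w, u w)"] w by (simp add: slots_mem nxt_def head_def)
          moreover have "\<phi> (v, 0) \<noteq> 0"
            using placed_range[OF assms(1,2), of "(v, 0)"] up(1) by (simp add: slots_mem)
          moreover have "\<phi> (w, u w) \<in> anc {1..N} f {1..l}" using up(2)[OF w] by simp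
          ultimately show ?thesis using cl by metis
        qed
      next
        case (Suc j)
        hence "f (\<phi> (v, j)) = \<phi> (v, Suc j)" using fn[of "(v, j)"] up(1) by (simp add: slots_mem nxt_def)
        moreover have "\<phi> (v, Suc j) \<noteq> 0"
          using placed_range[OF assms(1,2), of "(v, Suc j)"] up(1) Suc by (simp add: slots_mem)
        ultimately show ?case using cl[of "\<phi> (v, j)"] Suc by simp
      qed
    qed
  qed
  show "\<phi> ` slots u \<subseteq> anc {1..N} f {1..l}"
  proof
    fix x assume "x \<in> \<phi> ` slots u"
    then obtain v j where "v \<in> V" "j \<le> u v" "x = \<phi> (v, j)" by (auto simp: slots_def)
    thus "x \<in> anc {1..N} f {1..l}" using up by blast
  qed
qed

lemma follows_iterate:
  assumes "\<And>s. s \<in> slots u \<Longrightarrow> f (\<phi> s) = nxt u \<phi> s" "v \<in> V"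
  shows "j \<le> u v \<Longrightarrow> (f ^^ j) (\<phi> (v, 0)) = \<phi> (v, j)"
    and "(f ^^ Suc (u v)) (\<phi> (v, 0)) = head \<phi> (p v)"
proof -
  show 1: "(f ^^ j) (\<phi> (v, 0)) = \<phi> (v, j)" if "j \<le> u v" for j
    using that
  proof (induction j)
    case (Suc j)
    thus ?case using assms(1)[of "(v, j)"] assms(2) by (simp add: slots_mem nxt_def)
  qed simp
  show "(f ^^ Suc (u v)) (\<phi> (v, 0)) = head \<phi> (p v)"
    using 1[of "u v"] assms(1)[of "(v, u v)"] assms(2) by (simp add: slots_mem nxt_def)
qed

lemma placed_head_gt:
  assumes "placed N u \<phi>" "v \<in> V" "v \<notin> {1..l}"
  shows "head \<phi> v \<in> {l<..}"
proof -
  have "v \<noteq> 0" using assms(2) zero_notin by metis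
  moreover have "(v, 0) \<in> free_slots u" using assms by (auto simp: free_slots_def slots_mem)
  ultimately show ?thesis using assms(1) by (auto simp: placed_def head_def)
qed

lemma placed_head_leaf:
  assumes "placed N u \<phi>" "v \<in> {1..l}"
  shows "head \<phi> v = v"
  using assms by (auto simp: placed_def head_def)

text \<open>Classes admit only permutations of the labels above \<open>l\<close>. Leaves are their
  own heads and all inner vertices have heads above \<open>l\<close>, so the injective map
  \<open>head \<phi>\<close> extends to such a permutation.\<close>

lemma placed_head_permutation:
  assumes "placed N u \<phi>" "l \<le> N"
  shows "\<exists>\<pi>. \<pi> permutes {l<..} \<and> (\<forall>v\<in>insert 0 V. \<pi> v = head \<phi> v)"
proof -
  have inj: "inj_on (head \<phi>) (V - {1..l})"
    by (rule inj_on_subset[OF placed_head_inj[OF assms]]) auto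
  obtain \<pi> where \<pi>: "\<pi> permutes {l<..}" "\<forall>v\<in>V - {1..l}. \<pi> v = head \<phi> v"
    using extend_to_permutation[OF _ inj, of "{l<..}"] finite_V non_leaf_gt placed_head_gt[OF assms(1)]
    by blast
  have "\<pi> v = head \<phi> v" if v: "v \<in> insert 0 V" for v
  proof -
    consider "v = 0" | "v \<in> {1..l}" | "v \<in> V - {1..l}" using v by blast
    thus ?thesis
    proof cases
      case 1
      thus ?thesis using permutes_not_in[OF \<pi>(1), of 0] by (simp add: head_def)
    next
      case 2
      thus ?thesis using permutes_not_in[OF \<pi>(1), of v] placed_head_leaf[OF assms(1) 2] by simp
    next
      case 3
      thus ?thesis using \<pi>(2) by blast
    qed
  qed
  thus ?thesis using \<pi>(1) by blast
qed

section \<open>Shape and edge lengths of a labelled subdivision, and the converse\<close>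

lemma retained_placed:
  assumes "placed N u \<phi>" "l \<le> N" "\<And>s. s \<in> slots u \<Longrightarrow> f (\<phi> s) = nxt u \<phi> s"
  shows "retained {1..l} (pgraph (\<phi> ` slots u) f) = head \<phi> ` insert 0 V"
proof -
  let ?D = "\<phi> ` slots u"
  have rD: "rooted ?D f" by (rule placed_rooted[OF assms])
  have ch: "children (pgraph ?D f) x = {y \<in> ?D. f y = x}" for x by (rule children_pgraph[OF rD])
  show ?thesis
  proof (intro equalityI subsetI)
    fix x assume "x \<in> retained {1..l} (pgraph ?D f)"
    then consider "x = 0" | "x \<in> {1..l}" | v j where "(v, j) \<in> slots u" "x = \<phi> (v, j)" "card {y \<in> ?D. f y = x} \<ge> 2"
      by (fastforce simp: retained_def nodes_def ch)
    thus "x \<in> head \<phi> ` insert 0 V"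
    proof cases
      case 1
      have "head \<phi> 0 = 0" by (simp add: head_def)
      thus ?thesis using 1 by (metis image_eqI insertI1)
    next
      case 2
      hence "head \<phi> x = x" by (rule placed_head_leaf[OF assms(1)])
      thus ?thesis using leaves_subset 2 by (metis image_eqI insertI2 subsetD)
    next
      case 3
      show ?thesis
      proof (cases j)
        case 0
        have v: "v \<in> V" using 3 by (simp add: slots_mem)
        hence "v \<noteq> 0" using zero_notin by metis
        hence "x = head \<phi> v" using 3 0 by (simp add: head_def)
        thus ?thesis using v by blast
      next
        case (Suc i)
        thus ?thesis using placed_children_inner[OF assms, of v i] 3 by simp
      qed
    qed
  next
    fix x assume "x \<in> head \<phi> ` insert 0 V"
    then obtain v where v: "v \<in> insert 0 V" "x = head \<phi> v" by blast
    consider "v = 0" | "v \<in> {1..l}" | "v \<in> V" "v \<notin> {1..l}" using v by blast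
    thus "x \<in> retained {1..l} (pgraph ?D f)"
    proof cases
      case 1
      thus ?thesis using v by (simp add: retained_def head_def)
    next
      case 2
      hence "x = v" using placed_head_leaf[OF assms(1) 2] v by simp
      thus ?thesis using 2 by (simp add: retained_def)
    next
      case 3
      have "v \<noteq> 0" using 3 zero_notin by metis
      hence "x \<in> ?D" using v(2) 3 by (auto simp: head_def slots_mem)
      moreover have "card {y \<in> ?D. f y = x} = 2"
        using placed_children_head(2)[OF assms v(1)] two_children[OF 3] v(2) by simp
      ultimately show ?thesis by (simp add: retained_def nodes_def ch)
    qed
  qed
qed

text \<open>The retained vertices of the spanned subtree are the heads, so its reduction is the
  binary tree relabelled by \<open>head \<phi>\<close>. Edge lists respect relabelling, and the
  number of vertices between consecutive heads is given by \<open>u\<close>.\<close>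

lemma follows_imp:
  assumes "placed N u \<phi>" "l \<le> N" "f \<in> parent_funs N" "follows u f \<phi>"
  defines "T \<equiv> pedges {1..N} f"
  shows "L_star l T = {1..l}" "Q_class l T = tree_class l (pgraph V p)" "u_vec l T = map u es"
proof -
  let ?D = "\<phi> ` slots u"
  define S where "S = pgraph ?D f"
  have r: "rooted {1..N} f" using assms(3) by (simp add: parent_funs_def)
  have fn: "f (\<phi> s) = nxt u \<phi> s" if "s \<in> slots u" for s using assms(4) that by (simp add: follows_def)
  have L: "{1..l} \<subseteq> {1..N}" using assms(2) by auto
  have rD: "rooted ?D f" by (rule placed_rooted[OF assms(1,2) fn])
  have S: "spanned_subtree {1..l} T = S"
    unfolding T_def S_def spanned_subtree_pedges[OF r L] follows_anc[OF assms(1-4)] ..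
  have ch: "children S x = {y \<in> ?D. f y = x}" for x unfolding S_def by (rule children_pgraph[OF rD])
  have fS: "fst S = insert 0 ?D" by (simp add: S_def)
  have ret: "retained {1..l} S = head \<phi> ` insert 0 V"
    unfolding S_def by (rule retained_placed[OF assms(1,2) fn])
  have inj: "inj_on \<phi> (slots u)" using assms(1) by (simp add: placed_def)
  have hd: "head \<phi> v = \<phi> (v, 0)" "\<phi> (v, 0) \<in> ?D" "v \<noteq> 0" if "v \<in> V" for v
  proof -
    show "v \<noteq> 0" using that zero_notin by metis
    thus "head \<phi> v = \<phi> (v, 0)" "\<phi> (v, 0) \<in> ?D" using that by (auto simp: head_def slots_mem)
  qed
  have D0: "0 \<notin> ?D" by (rule rooted_zero[OF rD])
  show "L_star l T = {1..l}"
    unfolding L_star_def S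
  proof (intro equalityI subsetI)
    fix x assume "x \<in> childless S"
    hence x: "x \<in> ?D" "{y \<in> ?D. f y = x} = {}" unfolding childless_def ch fS by blast+
    then obtain v j where vj: "(v, j) \<in> slots u" "x = \<phi> (v, j)" by auto
    have v: "v \<in> V" using vj by (simp add: slots_mem)
    show "x \<in> {1..l}"
    proof (cases j)
      case 0
      hence xv: "x = head \<phi> v" using vj hd[OF v] by simp
      have "{w \<in> V. p w = v} = {}"
        using placed_children_head(1)[OF assms(1,2) fn, of v] x(2) v unfolding xv by auto
      hence "v \<in> {1..l}" using leaf_iff[OF v] by blast
      thus ?thesis using placed_head_leaf[OF assms(1)] xv by metis
    next
      case (Suc i)
      thus ?thesis using placed_children_inner[OF assms(1,2) fn, of v i] vj x(2) by simp
    qed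
  next
    fix x assume x: "x \<in> {1..l}"
    hence xV: "x \<in> V" using leaves_subset by blast
    have hx: "head \<phi> x = x" by (rule placed_head_leaf[OF assms(1) x])
    have "{y \<in> ?D. f y = x} = {}"
      using placed_children_head(1)[OF assms(1,2) fn, of x] leaf_iff[OF xV] x xV hx by auto
    moreover have "x \<in> ?D" using hd[OF xV] hx by simp
    moreover have "x \<noteq> 0" using hd[OF xV] by simp
    ultimately show "x \<in> childless S" unfolding childless_def ch fS by blast
  qed
  obtain \<pi> where \<pi>: "\<pi> permutes {l<..}" "\<And>v. v \<in> insert 0 V \<Longrightarrow> \<pi> v = head \<phi> v"
    using placed_head_permutation[OF assms(1,2)] by blast
  have fb: "num_between {1..l} S (\<pi> v) = u v" "first_below {1..l} S (\<pi> v) = \<pi> (p v)" if v: "v \<in> V" for v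
  proof -
    have iter: "(f ^^ Suc (u v)) (\<phi> (v, 0)) = head \<phi> (p v)" "\<And>j. j \<le> u v \<Longrightarrow> (f ^^ j) (\<phi> (v, 0)) = \<phi> (v, j)"
      by (rule follows_iterate[OF fn v], assumption)+
    have pv: "p v \<in> insert 0 V" by (rule rooted_closed[OF rooted v])
    \<comment> \<open>Distinct slots have distinct labels, so an inserted vertex is never a
      head.\<close>
    have not: "(f ^^ j) (\<phi> (v, 0)) \<notin> retained {1..l} (pgraph ?D f)" if j: "1 \<le> j" "j \<le> u v" for j
    proof
      assume "(f ^^ j) (\<phi> (v, 0)) \<in> retained {1..l} (pgraph ?D f)"
      hence "\<phi> (v, j) \<in> head \<phi> ` insert 0 V" using ret iter(2)[OF j(2)] by (simp add: S_def)
      then obtain w where w: "w \<in> insert 0 V" "\<phi> (v, j) = head \<phi> w" by blast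
      have s: "(v, j) \<in> slots u" using v j by (simp add: slots_mem)
      hence "\<phi> (v, j) \<noteq> 0" using placed_range[OF assms(1,2)] by fastforce
      hence wV: "w \<in> V" using w by (auto simp: head_def split: if_splits)
      hence "\<phi> (v, j) = \<phi> (w, 0)" using w hd by simp
      hence "(v, j) = (w, 0)" by (rule inj_onD[OF inj _ s]) (use wV in \<open>simp add: slots_mem\<close>)
      thus False using j by simp
    qed
    have "(f ^^ Suc (u v)) (\<phi> (v, 0)) \<in> retained {1..l} (pgraph ?D f)"
      unfolding iter(1) ret[unfolded S_def] using pv by (rule imageI)
    from first_below_eqI[OF rD hd(2)[OF v] this not]
    show "num_between {1..l} S (\<pi> v) = u v" "first_below {1..l} S (\<pi> v) = \<pi> (p v)"
      using \<pi>(2)[of v] \<pi>(2)[OF pv] hd[OF v] v iter(1) by (simp_all add: S_def)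
  qed
  have \<pi>0: "\<pi> 0 = 0" using \<pi>(2)[of 0] by (simp add: head_def)
  have \<pi>i: "\<pi> i = i" if "i \<in> {1..l}" for i
    using \<pi>(2)[of i] placed_head_leaf[OF assms(1) that] leaves_subset that by auto
  have \<pi>inj: "inj_on \<pi> (insert 0 V)" using permutes_inj[OF \<pi>(1)] by (meson inj_on_subset subset_UNIV)
  have "head \<phi> ` insert 0 V - {0} = \<pi> ` V"
  proof -
    have "head \<phi> ` insert 0 V = \<pi> ` insert 0 V" using \<pi>(2) by (intro image_cong) auto
    moreover have "0 \<notin> \<pi> ` V"
    proof
      assume "0 \<in> \<pi> ` V"
      then obtain v where "v \<in> V" "\<pi> v = \<pi> 0" using \<pi>0 by auto
      thus False using permutes_inj[OF \<pi>(1)] hd by (metis injD)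
    qed
    ultimately show ?thesis using \<pi>0 by auto
  qed
  hence red: "reduction {1..l} S = pgraph (\<pi> ` V) (first_below {1..l} S)"
    unfolding reduction_pgraph ret by simp
  also have "\<dots> = relabel \<pi> (pgraph V p)"
    by (rule relabel_pgraph[symmetric]) (use \<pi>0 fb in auto)
  finally have "Q_class l T = tree_class l (relabel \<pi> (pgraph V p))" unfolding Q_class_def S by simp
  thus "Q_class l T = tree_class l (pgraph V p)" using tree_class_relabel[OF \<pi>(1)] by simp
  have "edge_list l (reduction {1..l} S) = map \<pi> es"
    unfolding red by (rule relabelled(2)) (use \<pi>inj \<pi>0 \<pi>i fb in auto)
  hence "u_vec l T = map (num_between {1..l} S) (map \<pi> es)"
    unfolding u_vec_def S Let_def by simp
  also have "\<dots> = map u es" using fb(1) es_props(1) by simp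
  finally show "u_vec l T = map u es" .
qed

text \<open>Equality of classes supplies a permutation \<pi> that turns the binary tree into the
  reduction. The number of intermediate vertices below \<open>\<pi> v\<close> serves as
  \<open>u v\<close>, and the slots of that edge are labelled by iterating \<open>f\<close> from
  \<open>\<pi> v\<close>.\<close>

lemma class_imp_follows:
  assumes "l \<le> N" "f \<in> parent_funs N"
  defines "T \<equiv> pedges {1..N} f"
  assumes Q: "Q_class l T = tree_class l (pgraph V p)"
  shows "\<exists>u \<phi>. placed N u \<phi> \<and> follows u f \<phi> \<and> u_vec l T = map u es"
proof -
  have r: "rooted {1..N} f" using assms(2) by (simp add: parent_funs_def)
  have L: "{1..l} \<subseteq> {1..N}" using assms(1) by auto
  note A = rooted_anc[OF r L]
  define D where "D = anc {1..N} f {1..l}"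
  define S where "S = pgraph D f"
  have rD: "rooted D f" "{1..l} \<subseteq> D" "D \<subseteq> {1..N}" using A by (auto simp: D_def)
  have S: "spanned_subtree {1..l} T = S" unfolding T_def S_def D_def by (rule spanned_subtree_pedges[OF r L])
  define R where "R = retained {1..l} S - {0}"
  define fb where "fb = first_below {1..l} S"
  have rR: "rooted R fb" "R \<subseteq> D"
    using rooted_reduction[OF rD(1,2)] unfolding R_def fb_def S_def by auto
  have red: "reduction {1..l} S = pgraph R fb" unfolding R_def fb_def by (rule reduction_pgraph)
  have "pgraph R fb \<in> tree_class l (pgraph V p)"
    using Q tree_class_self[of "pgraph R fb" l] unfolding Q_class_def S red by simp
  then obtain \<pi> where \<pi>: "\<pi> permutes {l<..}" "pgraph R fb = relabel \<pi> (pgraph V p)"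
    by (auto simp: tree_class_def)
  have \<pi>inj: "inj \<pi>" by (rule permutes_inj[OF \<pi>(1)])
  have \<pi>i: "\<pi> i = i" if "i \<le> l" for i using permutes_not_in[OF \<pi>(1), of i] that by simp
  have \<pi>gt: "\<pi> v > l" if "v > l" for v using permutes_in_image[OF \<pi>(1), of v] that by simp
  define q where "q = \<pi> \<circ> p \<circ> inv \<pi>"
  have q: "q (\<pi> v) = \<pi> (p v)" for v by (simp add: q_def inv_f_f[OF \<pi>inj])
  have inj0: "inj_on \<pi> (insert 0 V)" using \<pi>inj by (meson inj_on_subset subset_UNIV)
  have rq: "rooted (\<pi> ` V) q" by (rule rooted_relabel[OF rooted inj0]) (use \<pi>i q in auto)
  have eq: "pgraph R fb = pgraph (\<pi> ` V) q"
    unfolding \<pi>(2) by (rule relabel_pgraph) (use \<pi>i q in auto)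
  have RV: "R = \<pi> ` V"
  proof -
    have "insert 0 R = insert 0 (\<pi> ` V)" using eq by (simp add: pgraph_def)
    thus ?thesis using rooted_zero[OF rR(1)] rooted_zero[OF rq] by (metis insert_ident)
  qed
  have fbq: "fb (\<pi> v) = \<pi> (p v)" if "v \<in> V" for v
  proof -
    have "pedges R fb = pedges (\<pi> ` V) q" using eq by (simp add: pgraph_def)
    thus ?thesis using parent_pedges[OF rR(1), of "\<pi> v"] parent_pedges[OF rq, of "\<pi> v"] that q RV by simp
  qed
  define u where "u v = num_between {1..l} S (\<pi> v)" for v
  define \<phi> where "\<phi> s = (f ^^ snd s) (\<pi> (fst s))" for s
  have piD: "\<pi> v \<in> D" "\<pi> v \<in> R" if "v \<in> V" for v using that RV rR(2) by auto
  note spec = first_below_spec[OF rD(1), where L = "{1..l}", folded S_def fb_def]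
  have inner: "\<phi> (v, j) \<notin> retained {1..l} S" "\<phi> (v, j) \<in> D" if "v \<in> V" "1 \<le> j" "j \<le> u v" for v j
    using spec(3)[OF piD(1)[OF that(1)] that(2)] that(3) by (auto simp: \<phi>_def u_def)
  have phiD: "\<phi> (v, j) \<in> D" if "v \<in> V" "j \<le> u v" for v j
    using inner(2)[of v j] that piD[of v] by (cases "j = 0") (auto simp: \<phi>_def)
  have ch: "children S x = {y \<in> D. f y = x}" for x unfolding S_def by (rule children_pgraph[OF rD(1)])
  \<comment> \<open>An intermediate vertex is not a node, so it has a single child in the spanned
    subtree.\<close>
  have single: "a = b" if "a \<in> D" "b \<in> D" "f a = f b" "f a \<in> D" "f a \<notin> retained {1..l} S" for a b
  proof (rule ccontr)
    assume "a \<noteq> b"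
    moreover have "finite {y \<in> D. f y = f a}" using rooted_finite[OF rD(1)] by simp
    moreover have "{a, b} \<subseteq> {y \<in> D. f y = f a}" using that by auto
    ultimately have "2 \<le> card {y \<in> D. f y = f a}" using card_mono[of "{y \<in> D. f y = f a}" "{a, b}"] by simp
    hence "f a \<in> nodes S" using that(4) using ch[of "f a"] by (simp add: nodes_def S_def)
    thus False using that(5) by (simp add: retained_def)
  qed
  \<comment> \<open>Coinciding labels can thus be traced back step by step to the upper ends of the
    two edges, and these coincide only for \<open>v = w\<close>.\<close>
  have inj: "v = w \<and> j = k"
    if "v \<in> V" "w \<in> V" "j \<le> u v" "k \<le> u w" "\<phi> (v, j) = \<phi> (w, k)" for v w j k
    using that
  proof (induction j arbitrary: k)
    case 0
    have "\<phi> (v, 0) \<in> retained {1..l} S" using piD(2)[OF 0(1)] by (simp add: \<phi>_def R_def)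
    hence "k = 0" using inner(1)[of w k] 0 by (cases k) auto
    thus ?case using 0 injD[OF \<pi>inj] by (auto simp: \<phi>_def)
  next
    case (Suc j)
    have nr: "\<phi> (v, Suc j) \<notin> retained {1..l} S" "\<phi> (v, Suc j) \<in> D" using inner[of v "Suc j"] Suc by auto
    have "k \<noteq> 0"
    proof
      assume "k = 0"
      hence "\<phi> (v, Suc j) \<in> retained {1..l} S" using piD(2)[of w] Suc.prems by (simp add: \<phi>_def R_def)
      thus False using nr by blast
    qed
    then obtain i where k: "k = Suc i" by (cases k) auto
    have "\<phi> (v, j) = \<phi> (w, i)"
    proof (rule single)
      show "\<phi> (v, j) \<in> D" "\<phi> (w, i) \<in> D" using phiD Suc.prems k by auto
      have f1: "f (\<phi> (v, j)) = \<phi> (v, Suc j)" "f (\<phi> (w, i)) = \<phi> (w, Suc i)" by (simp_all add: \<phi>_def)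
      show "f (\<phi> (v, j)) = f (\<phi> (w, i))" using f1 Suc.prems k by simp
      show "f (\<phi> (v, j)) \<in> D" "f (\<phi> (v, j)) \<notin> retained {1..l} S" using f1 nr by simp_all
    qed
    thus ?case using Suc.IH[of i] Suc.prems k by simp
  qed
  have "placed N u \<phi>"
    unfolding placed_def
  proof (intro conjI ballI subsetI)
    show "inj_on \<phi> (slots u)" by (rule inj_onI) (use inj in \<open>auto simp: slots_def\<close>)
    show "\<phi> (i, 0) = i" if "i \<in> {1..l}" for i using that \<pi>i by (simp add: \<phi>_def)
    fix x assume "x \<in> \<phi> ` free_slots u"
    then obtain v j where "(v, j) \<in> free_slots u" "x = \<phi> (v, j)" by auto
    hence vj: "v \<in> V" "j \<le> u v" "x = \<phi> (v, j)" "j = 0 \<longrightarrow> v \<notin> {1..l}"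
      unfolding free_slots_def by (auto simp: slots_mem image_iff)
    have "x \<in> {1..N}" using phiD[OF vj(1,2)] vj(3) rD(3) by blast
    moreover have "x > l"
    proof (cases "j = 0")
      case True
      thus ?thesis using vj \<pi>gt[OF non_leaf_gt[OF vj(1)]] by (simp add: \<phi>_def)
    next
      case False
      hence "x \<notin> {1..l}" using inner(1)[of v j] vj by (auto simp: retained_def)
      thus ?thesis using \<open>x \<in> {1..N}\<close> by auto
    qed
    ultimately show "x \<in> {l<..N}" by simp
  qed
  moreover have "follows u f \<phi>"
    unfolding follows_def
  proof
    fix s assume "s \<in> slots u"
    then obtain v j where s: "s = (v, j)" "v \<in> V" "j \<le> u v" by (auto simp: slots_def)
    show "f (\<phi> s) = nxt u \<phi> s"
    proof (cases "j < u v")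
      case True
      thus ?thesis using s by (simp add: nxt_def \<phi>_def)
    next
      case False
      hence j: "j = u v" using s by simp
      have "f (\<phi> s) = (f ^^ Suc (u v)) (\<pi> v)" by (simp add: s j \<phi>_def)
      also have "\<dots> = fb (\<pi> v)" 
        unfolding u_def fb_def using spec(1)[OF piD(1)[OF s(2)]] unfolding fb_def by (rule sym)
      also have "\<dots> = \<pi> (p v)" by (rule fbq[OF s(2)])
      also have "\<dots> = head \<phi> (p v)" using \<pi>i[of 0] by (simp add: head_def \<phi>_def)
      finally show ?thesis by (simp add: nxt_def s j)
    qed
  qed
  moreover have "u_vec l T = map u es"
  proof -
    have "edge_list l (pgraph R fb) = map \<pi> es"
      unfolding RV by (rule relabelled(2)) (use inj0 \<pi>i fbq in auto)
    thus ?thesis unfolding u_vec_def S Let_def red by (simp add: u_def)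
  qed
  ultimately show ?thesis by blast
qed

text \<open>The labels of the leaves are prescribed, and the label of any other vertex is an iterate
  of \<open>f\<close> at the label of one of its children. This is where the absence of
  automorphisms enters.\<close>

lemma follows_unique:
  assumes "placed N u \<phi>" "placed N u \<psi>" "follows u f \<phi>" "follows u f \<psi>" "s \<in> slots u"
  shows "\<phi> s = \<psi> s"
proof -
  have f1: "f (\<phi> s) = nxt u \<phi> s" "f (\<psi> s) = nxt u \<psi> s" if "s \<in> slots u" for s
    using assms(3,4) that by (auto simp: follows_def)
  have "\<phi> (v, 0) = \<psi> (v, 0)" if "v \<in> V" for v
    using rooted that
  proof (induction rule: rooted_up_induct)
    case (up v)
    show ?case
    proof (cases "v \<in> {1..l}")
      case True
      thus ?thesis using assms(1,2) by (simp add: placed_def)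
    next
      case False
      then obtain w where w: "w \<in> V" "p w = v" using leaf_iff[OF up(1)] by blast
      have "v \<noteq> 0" using up(1) zero_notin by metis
      thus ?thesis using follows_iterate(2)[OF f1(1) w(1)] follows_iterate(2)[OF f1(2) w(1)] up(2)[OF w] w(2)
        by (simp add: head_def)
    qed
  qed
  moreover obtain v j where s: "s = (v, j)" "v \<in> V" "j \<le> u v" using assms(5) by (auto simp: slots_def)
  ultimately show ?thesis
    using follows_iterate(1)[OF f1(1) s(2,3)] follows_iterate(1)[OF f1(2) s(2,3)] by simp
qed

end

section \<open>Weights of classes\<close>

lemma exists_map_eq:
  assumes "distinct xs" "length xs = length ys"
  shows "\<exists>u. map u xs = ys"
  using assms(2,1)
proof (induction rule: list_induct2)
  case (Cons x xs y ys)
  then obtain u where "map u xs = ys" by auto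
  hence "map (u(x := y)) (x # xs) = y # ys" using Cons.prems by (auto intro: map_cong)
  thus ?case by (intro exI[of _ "u(x := y)"])
qed simp

context binary_tree
begin

text \<open>Labellings are total functions with arbitrary values off the slots. For counting they
  are replaced by extensional injections on the free slots; \<open>fill\<close> goes back.\<close>

definition placements :: "nat \<Rightarrow> (nat \<Rightarrow> nat) \<Rightarrow> (nat \<times> nat \<Rightarrow> nat) set" where
  "placements N u = {\<psi> \<in> free_slots u \<rightarrow>\<^sub>E {l<..N}. inj_on \<psi> (free_slots u)}"

definition fill :: "(nat \<times> nat \<Rightarrow> nat) \<Rightarrow> nat \<times> nat \<Rightarrow> nat" where
  "fill \<psi> s = (if s \<in> (\<lambda>i. (i, 0)) ` {1..l} then fst s else \<psi> s)"

lemma finite_free_slots: "finite (free_slots u)"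
  using finite_slots by (simp add: free_slots_def)

lemma finite_placements: "finite (placements N u)"
  unfolding placements_def using finite_free_slots by (auto intro!: finite_PiE finite_Collect_conjI)

lemma card_placements: "card (placements N u) = (\<Prod>i<l - 1 + (\<Sum>v\<in>V. u v). N - l - i)"
  using card_inj_on_subset_funcset[OF finite_free_slots[of u], of "{l<..N}" "free_slots u"]
  by (simp add: placements_def card_free_slots lessThan_atLeast0)

lemma fill_free: "s \<in> free_slots u \<Longrightarrow> fill \<psi> s = \<psi> s"
  by (simp add: fill_def free_slots_def)

lemma placed_fill:
  assumes "\<psi> \<in> placements N u"
  shows "placed N u (fill \<psi>)"
proof -
  have P: "\<psi> s \<in> {l<..N}" if "s \<in> free_slots u" for s
    using assms that by (auto simp: placements_def)
  have inj: "inj_on \<psi> (free_slots u)" using assms by (simp add: placements_def)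
  have leaf: "fst s \<le> l" "fill \<psi> s = fst s" "snd s = 0" if "s \<in> slots u" "s \<notin> free_slots u" for s
    using that by (auto simp: free_slots_def fill_def)
  have "inj_on (fill \<psi>) (slots u)"
  proof (rule inj_onI)
    fix s t assume st: "s \<in> slots u" "t \<in> slots u" "fill \<psi> s = fill \<psi> t"
    show "s = t"
    proof (cases "s \<in> free_slots u"; cases "t \<in> free_slots u")
      assume "s \<in> free_slots u" "t \<in> free_slots u"
      thus ?thesis using st inj_onD[OF inj, of s t] by (simp add: fill_free)
    next
      assume a: "s \<in> free_slots u" "t \<notin> free_slots u"
      thus ?thesis using st(3) leaf[OF st(2) a(2)] P[OF a(1)] by (simp add: fill_free)
    next
      assume a: "s \<notin> free_slots u" "t \<in> free_slots u"
      thus ?thesis using st(3) leaf[OF st(1) a(1)] P[OF a(2)] by (simp add: fill_free)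
    next
      assume a: "s \<notin> free_slots u" "t \<notin> free_slots u"
      thus ?thesis using st(3) leaf[OF st(1) a(1)] leaf[OF st(2) a(2)] by (simp add: prod_eq_iff)
    qed
  qed
  moreover have "fill \<psi> (i, 0) = i" if "i \<in> {1..l}" for i
    using that by (auto simp: fill_def)
  ultimately show ?thesis using P by (auto simp: placed_def fill_free)
qed

lemma placed_restrict:
  assumes "placed N u \<phi>"
  shows "restrict \<phi> (free_slots u) \<in> placements N u"
    "\<And>s. s \<in> slots u \<Longrightarrow> fill (restrict \<phi> (free_slots u)) s = \<phi> s"
proof -
  have "inj_on \<phi> (free_slots u)"
    using assms by (auto simp: placed_def free_slots_def intro: inj_on_subset)
  hence "inj_on (restrict \<phi> (free_slots u)) (free_slots u)" by (simp add: inj_on_restrict_eq)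
  moreover have "restrict \<phi> (free_slots u) \<in> free_slots u \<rightarrow>\<^sub>E {l<..N}"
    unfolding restrict_PiE_iff using assms by (auto simp: placed_def)
  ultimately show "restrict \<phi> (free_slots u) \<in> placements N u" by (simp add: placements_def)
  show "fill (restrict \<phi> (free_slots u)) s = \<phi> s" if "s \<in> slots u" for s
    using that assms by (auto simp: fill_def free_slots_def placed_def)
qed

lemma follows_cong:
  assumes "\<And>s. s \<in> slots u \<Longrightarrow> \<phi> s = \<phi>' s"
  shows "follows u f \<phi> \<longleftrightarrow> follows u f \<phi>'"
proof -
  have hd: "head \<phi> v = head \<phi>' v" if "v \<in> insert 0 V" for v
    using that assms by (auto simp: head_def slots_mem)
  have "nxt u \<phi> s = nxt u \<phi>' s" if "s \<in> slots u" for s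
  proof (cases s)
    case (Pair v j)
    hence v: "v \<in> V" "j \<le> u v" using that by (auto simp: slots_mem)
    show ?thesis using hd[OF rooted_closed[OF rooted v(1)]] assms[of "(v, Suc j)"] v Pair
      by (simp add: nxt_def slots_mem)
  qed
  thus ?thesis using assms by (simp add: follows_def)
qed

lemma class_funs_eq:
  assumes "l \<le> N"
  shows "{f. f \<in> parent_funs N \<and> Q_class l (pedges {1..N} f) = tree_class l (pgraph V p)
      \<and> u_vec l (pedges {1..N} f) = map u es}
    = (\<Union>\<psi>\<in>placements N u. {f. f \<in> parent_funs N \<and> follows u f (fill \<psi>)})" (is "?A = ?B")
proof (intro equalityI subsetI)
  fix f assume f: "f \<in> ?A"
  then obtain u' \<phi> where *: "placed N u' \<phi>" "follows u' f \<phi>" "map u es = map u' es"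
    using class_imp_follows[OF assms, of f] by auto
  \<comment> \<open>The lists fix \<open>u\<close> only on \<open>V\<close>, so the labelling found
    for \<open>u'\<close> has to be transferred to \<open>u\<close>.\<close>
  hence uu: "u' v = u v" if "v \<in> V" for v using that es_props(1) by simp
  hence sl: "slots u' = slots u" by (auto simp: slots_def)
  hence pl: "placed N u \<phi>" using *(1) by (simp add: placed_def free_slots_def)
  have "follows u f \<phi>" using *(2) uu unfolding follows_def sl by (auto simp: nxt_def slots_def)
  moreover have "follows u f (fill (restrict \<phi> (free_slots u))) \<longleftrightarrow> follows u f \<phi>"
    by (rule follows_cong) (rule placed_restrict(2)[OF pl])
  ultimately show "f \<in> ?B" using placed_restrict(1)[OF pl] f by blast
next
  fix f assume "f \<in> ?B"
  then obtain \<psi> where "\<psi> \<in> placements N u" "f \<in> parent_funs N" "follows u f (fill \<psi>)" by blast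
  thus "f \<in> ?A" using follows_imp[OF placed_fill assms] by blast
qed

end

text \<open>The unnormalised weight of the tree \<open>pedges {1..N} f\<close>: the neighbours of
  the root are the vertices whose parent is \<open>0\<close>.\<close>

definition wt :: "real \<Rightarrow> nat \<Rightarrow> (nat \<Rightarrow> nat) \<Rightarrow> real" where
  "wt \<kappa> N f = \<kappa> ^ card {v \<in> {1..N}. f v = 0}"

lemma finite_parent_funs: "finite (parent_funs N)"
  unfolding parent_funs_def by (intro finite_Collect_conjI disjI1) (simp add: finite_PiE)

text \<open>By \<open>class_funs_eq\<close> the functions counted here split according to the
  placement that they follow. The parts are disjoint by \<open>follows_unique\<close> and have equal
  weight by \<open>follows_weight\<close>; the number of placements is a falling factorial.\<close>

lemma (in binary_tree) class_weight:
  assumes "l \<le> N" "length us = 2 * l - 1"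
  shows "(\<Sum>f | f \<in> parent_funs N \<and> Q_class l (pedges {1..N} f) = tree_class l (pgraph V p)
      \<and> u_vec l (pedges {1..N} f) = us. wt \<kappa> N f) * (\<kappa> + N) ^ (2 * l + sum_list us)
    = real (\<Prod>i<l - 1 + sum_list us. N - l - i) * (\<kappa> * (\<kappa> + (2 * l - 1 + sum_list us)) * (\<kappa> + N) ^ N)"
proof -
  obtain u where u: "map u es = us" using exists_map_eq[of es us] es_props assms(2) by auto
  have su: "(\<Sum>v\<in>V. u v) = sum_list us"
    using sum_list_distinct_conv_sum_set[OF es_props(2), of u] u es_props(1) by simp
  let ?C = "\<lambda>\<psi>. {f. f \<in> parent_funs N \<and> follows u f (fill \<psi>)}"
  have cs: "card (slots u) + 1 = 2 * l + sum_list us" "card (slots u) = 2 * l - 1 + sum_list us"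
    using card_slots[of u] card_V su by auto
  have dis: "?C \<psi> \<inter> ?C \<psi>' = {}" if \<psi>: "\<psi> \<in> placements N u" "\<psi>' \<in> placements N u" "\<psi> \<noteq> \<psi>'" for \<psi> \<psi>'
  proof (rule ccontr)
    assume "?C \<psi> \<inter> ?C \<psi>' \<noteq> {}"
    then obtain f where f: "follows u f (fill \<psi>)" "follows u f (fill \<psi>')" by blast
    have "\<psi> s = \<psi>' s" if s: "s \<in> free_slots u" for s
    proof -
      have "s \<in> slots u" using s by (simp add: free_slots_def)
      hence "fill \<psi> s = fill \<psi>' s"
        by (rule follows_unique[OF placed_fill[OF \<psi>(1)] placed_fill[OF \<psi>(2)] f])
      thus ?thesis using fill_free[OF s] by simp
    qed
    hence "\<psi> = \<psi>'"
      using that(1,2) by (intro PiE_ext[of \<psi> "free_slots u" "\<lambda>_. {l<..N}" \<psi>']) (auto simp: placements_def)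
    thus False using that(3) by blast
  qed
  have "(\<Sum>f | f \<in> parent_funs N \<and> Q_class l (pedges {1..N} f) = tree_class l (pgraph V p)
      \<and> u_vec l (pedges {1..N} f) = us. wt \<kappa> N f) = (\<Sum>\<psi>\<in>placements N u. \<Sum>f\<in>?C \<psi>. wt \<kappa> N f)"
    unfolding u[symmetric] class_funs_eq[OF assms(1)]
    by (rule sum.UNION_disjoint) (use finite_placements finite_parent_funs dis in auto)
  hence "(\<Sum>f | f \<in> parent_funs N \<and> Q_class l (pedges {1..N} f) = tree_class l (pgraph V p)
      \<and> u_vec l (pedges {1..N} f) = us. wt \<kappa> N f) * (\<kappa> + N) ^ (2 * l + sum_list us)
    = (\<Sum>\<psi>\<in>placements N u. (\<Sum>f\<in>?C \<psi>. wt \<kappa> N f) * (\<kappa> + N) ^ (card (slots u) + 1))"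
    by (simp only: sum_distrib_right cs(1))
  also have "\<dots> = (\<Sum>\<psi>\<in>placements N u. \<kappa> * (\<kappa> + card (slots u)) * (\<kappa> + N) ^ N)"
    by (rule sum.cong[OF refl]) (use follows_weight[OF placed_fill assms(1)] in \<open>simp only: wt_def\<close>)
  also have "\<dots> = real (\<Prod>i<l - 1 + sum_list us. N - l - i) * (\<kappa> * (\<kappa> + (2 * l - 1 + sum_list us)) * (\<kappa> + N) ^ N)"
    by (simp only: sum_constant card_placements su cs(2))
  finally show ?thesis .
qed

text \<open>A labelling embeds the slots in \<open>{1..N}\<close>, which bounds the total edge
  length and leaves finitely many \<open>u\<close>. The statement on \<open>L_star\<close> is what
  (a) rests on.\<close>

lemma (in binary_tree) class_imp_u_vec:
  assumes "l \<le> N" "f \<in> parent_funs N"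
    "Q_class l (pedges {1..N} f) = tree_class l (pgraph V p)"
  shows "length (u_vec l (pedges {1..N} f)) = 2 * l - 1" "2 * l - 1 + sum_list (u_vec l (pedges {1..N} f)) \<le> N"
    "L_star l (pedges {1..N} f) = {1..l}"
proof -
  obtain u \<phi> where *: "placed N u \<phi>" "follows u f \<phi>" "u_vec l (pedges {1..N} f) = map u es"
    using class_imp_follows[OF assms] by blast
  show "length (u_vec l (pedges {1..N} f)) = 2 * l - 1" using * es_props by simp
  have "card (slots u) \<le> card {1..N}"
    by (rule card_inj_on_le[of \<phi>]) (use * placed_range[OF *(1) assms(1)] in \<open>auto simp: placed_def\<close>)
  moreover have "(\<Sum>v\<in>V. u v) = sum_list (map u es)"
    using sum_list_distinct_conv_sum_set[OF es_props(2), of u] es_props(1) by simp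
  ultimately show "2 * l - 1 + sum_list (u_vec l (pedges {1..N} f)) \<le> N"
    using * card_slots[of u] by simp
  show "L_star l (pedges {1..N} f) = {1..l}" using follows_imp[OF *(1) assms(1,2) *(2)] by blast
qed

lemma (in binary_tree) class_weight_total:
  assumes "l \<le> N"
  shows "(\<Sum>f | f \<in> parent_funs N \<and> Q_class l (pedges {1..N} f) = tree_class l (pgraph V p). wt \<kappa> N f)
    = (\<Sum>us | length us = 2 * l - 1 \<and> sum_list us \<le> N. \<Sum>f | f \<in> parent_funs N \<and>
        Q_class l (pedges {1..N} f) = tree_class l (pgraph V p) \<and> u_vec l (pedges {1..N} f) = us. wt \<kappa> N f)"
proof -
  let ?U = "{us. length us = 2 * l - 1 \<and> sum_list us \<le> N}"
  let ?C = "\<lambda>us. {f. f \<in> parent_funs N \<and> Q_class l (pedges {1..N} f) = tree_class l (pgraph V p) \<and> u_vec l (pedges {1..N} f) = us}"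
  have "?U \<subseteq> {us. set us \<subseteq> {0..N} \<and> length us = 2 * l - 1}"
    using member_le_sum_list by fastforce
  hence fU: "finite ?U" by (rule finite_subset) (simp add: finite_lists_length_eq)
  have "{f. f \<in> parent_funs N \<and> Q_class l (pedges {1..N} f) = tree_class l (pgraph V p)} = (\<Union>us\<in>?U. ?C us)"
    using class_imp_u_vec[OF assms] by fastforce
  thus ?thesis
    by (simp only:) (rule sum.UNION_disjoint, use fU finite_parent_funs in auto)
qed

text \<open>The empty prescription in \<open>cylinder_weight\<close>.\<close>

lemma total_weight: "(\<Sum>f\<in>parent_funs N. wt \<kappa> N f) * (\<kappa> + N) = \<kappa> * (\<kappa> + N) ^ N"
proof -
  have "rooted {} id" by (simp add: rooted_def)
  from cylinder_weight[OF this, of N \<kappa>] show ?thesis by (simp add: wt_def)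
qed

text \<open>The bijection between trees and parent functions turns every probability into a quotient
  of weight sums; the degree of the root becomes the exponent in \<open>wt\<close>.\<close>

lemma prob_tree_law:
  assumes "\<kappa> > 0"
  shows "measure_pmf.prob (tree_law N \<kappa>) {T. P T}
    = (\<Sum>f | f \<in> parent_funs N \<and> P (pedges {1..N} f). wt \<kappa> N f) / (\<Sum>f\<in>parent_funs N. wt \<kappa> N f)"
proof -
  note bij = bij_betw_spanning_trees[of N]
  let ?S = "spanning_trees N" and ?h = "pedges {1..N}"
  have deg: "\<kappa> ^ degree_in (?h f) 0 = wt \<kappa> N f" if "f \<in> parent_funs N" for f
    using that degree_in_pedges[of "{1..N}" f] by (simp add: parent_funs_def wt_def)
  have Z: "(\<Sum>T\<in>?S. \<kappa> ^ degree_in T 0) = (\<Sum>f\<in>parent_funs N. wt \<kappa> N f)"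
    using sum.reindex_bij_betw[OF bij, of "\<lambda>T. \<kappa> ^ degree_in T 0"] deg by simp
  have sub: "set_pmf (tree_law N \<kappa>) \<subseteq> ?S" using pmf_tree_law[OF assms] by (auto simp: set_pmf_iff split: if_splits)
  have "measure_pmf.prob (tree_law N \<kappa>) {T. P T} = measure_pmf.prob (tree_law N \<kappa>) {T \<in> ?S. P T}"
  proof -
    have "{T. P T} \<inter> set_pmf (tree_law N \<kappa>) = {T \<in> ?S. P T} \<inter> set_pmf (tree_law N \<kappa>)" using sub by auto
    thus ?thesis using measure_Int_set_pmf by metis
  qed
  also have "\<dots> = (\<Sum>T\<in>{T \<in> ?S. P T}. pmf (tree_law N \<kappa>) T)"
    by (rule measure_measure_pmf_finite) (simp add: finite_spanning_trees)
  also have "\<dots> = (\<Sum>T\<in>{T \<in> ?S. P T}. \<kappa> ^ degree_in T 0 / (\<Sum>f\<in>parent_funs N. wt \<kappa> N f))"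
    by (rule sum.cong) (auto simp: pmf_tree_law[OF assms] Z)
  also have "{T \<in> ?S. P T} = ?h ` {f. f \<in> parent_funs N \<and> P (?h f)}"
    unfolding bij_betw_imp_surj_on[OF bij, symmetric] by auto
  also have "(\<Sum>T\<in>?h ` {f. f \<in> parent_funs N \<and> P (?h f)}. \<kappa> ^ degree_in T 0 / (\<Sum>f\<in>parent_funs N. wt \<kappa> N f))
    = (\<Sum>f | f \<in> parent_funs N \<and> P (?h f). wt \<kappa> N f / (\<Sum>f\<in>parent_funs N. wt \<kappa> N f))"
  proof (subst sum.reindex)
    show "inj_on ?h {f. f \<in> parent_funs N \<and> P (?h f)}"
      using bij by (auto simp: bij_betw_def intro: inj_on_subset)
  qed (rule sum.cong[OF refl], simp only: comp_apply mem_Collect_eq deg)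
  finally show ?thesis by (simp add: sum_divide_distrib)
qed

section \<open>The number of binary classes\<close>

lemma binary_classes_iff:
  "\<alpha> \<in> binary_classes l \<longleftrightarrow> (\<exists>V p. binary_tree l V p \<and> \<alpha> = tree_class l (pgraph V p))"
  unfolding binary_classes_def is_binary_iff by blast

text \<open>The parents in a binary tree on \<open>{1..2 * l - 1}\<close> with leaves
  \<open>{1..l}\<close>: the root occurs once and every inner vertex twice.\<close>

definition binary_mset :: "nat \<Rightarrow> nat multiset" where
  "binary_mset l = add_mset 0 (mset_set {l<..2 * l - 1} + mset_set {l<..2 * l - 1})"

lemma count_binary_mset:
  "count (binary_mset l) y = (if y = 0 then 1 else if y \<in> {l<..2 * l - 1} then 2 else 0)"
  by (simp add: binary_mset_def count_mset_set')

text \<open>With only \<open>2 * l - 1\<close> labels there is no room for inserted vertices: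
  \<open>u\<close> vanishes, the labelled slots exhaust \<open>{1..N}\<close>, and the indegrees are
  those of the binary tree.\<close>

lemma (in binary_tree) class_imp_indegrees:
  assumes "N = 2 * l - 1" "f \<in> parent_funs N"
    "Q_class l (pedges {1..N} f) = tree_class l (pgraph V p)"
  shows "image_mset f (mset_set {1..N}) = binary_mset l"
proof -
  have lN: "l \<le> N" using card_V(2) assms(1) by linarith
  obtain u \<phi> where *: "placed N u \<phi>" "follows u f \<phi>"
    using class_imp_follows[OF lN assms(2,3)] by blast
  have fn: "f (\<phi> s) = nxt u \<phi> s" if "s \<in> slots u" for s using * that by (simp add: follows_def)
  have inj: "inj_on \<phi> (slots u)" using * by (simp add: placed_def)
  have sub: "\<phi> ` slots u \<subseteq> {1..N}" using placed_range[OF *(1) lN] by blast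
  have "card (\<phi> ` slots u) = 2 * l - 1 + (\<Sum>v\<in>V. u v)" by (simp add: card_image[OF inj] card_slots)
  moreover have "card (\<phi> ` slots u) \<le> N" using card_mono[OF _ sub] by simp
  ultimately have c: "card (\<phi> ` slots u) = card {1..N}" and u0: "(\<Sum>v\<in>V. u v) = 0" using assms(1) by auto
  have im: "\<phi> ` slots u = {1..N}" by (rule card_subset_eq[OF _ sub c]) simp
  have u0: "u v = 0" if "v \<in> V" for v using u0 that finite_V by simp
  have card_head: "card {x \<in> {1..N}. f x = head \<phi> v} = card {w \<in> V. p w = v}" if "v \<in> insert 0 V" for v
    using placed_children_head(2)[OF *(1) lN fn that] unfolding im .
  show ?thesis
  proof (rule multiset_eqI)
    fix y
    have cnt: "count (image_mset f (mset_set {1..N})) y = card {x \<in> {1..N}. f x = y}"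
      by (rule count_image_mset_set) simp
    consider "y = 0" | "y \<in> {1..N}" | "y > N" by fastforce
    thus "count (image_mset f (mset_set {1..N})) y = count (binary_mset l) y"
    proof cases
      case 1
      have "head \<phi> 0 = 0" by (simp add: head_def)
      hence "card {x \<in> {1..N}. f x = 0} = 1" using card_head[of 0] root_child by simp
      thus ?thesis unfolding cnt count_binary_mset using 1 by simp
    next
      case 2
      then obtain v j where vj: "(v, j) \<in> slots u" "y = \<phi> (v, j)" unfolding im[symmetric] by auto
      have v: "v \<in> V" "j = 0" using vj u0 by (auto simp: slots_mem)
      have v0: "v \<noteq> 0" using v zero_notin by metis
      hence y: "y = head \<phi> v" using vj v by (simp add: head_def)
      show ?thesis
      proof (cases "v \<in> {1..l}")
        case True
        hence "y = v" using placed_head_leaf[OF *(1) True] y by simp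
        moreover have "{w \<in> V. p w = v} = {}" using leaf_iff[OF v(1)] True by blast
        hence "card {x \<in> {1..N}. f x = y} = 0" using card_head[of v] v y by (metis card.empty insertI2)
        moreover have "count (binary_mset l) v = 0" using True by (auto simp: count_binary_mset)
        ultimately show ?thesis using cnt by metis
      next
        case False
        have "y > l" using placed_head_gt[OF *(1) v(1) False] y by simp
        moreover have "card {x \<in> {1..N}. f x = y} = 2" using card_head[of v] v y two_children[OF v(1) False] by simp
        moreover have "count (binary_mset l) y = 2" if "y > l"
          using that 2 assms(1) by (auto simp: count_binary_mset)
        ultimately show ?thesis using cnt by metis
      qed
    next
      case 3
      have "f x \<noteq> y" if "x \<in> {1..N}" for x
        using PiE_mem[of f "{1..N}" "\<lambda>_. {0..N}" x] 3 assms(2) that by (auto simp: parent_funs_def)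
      hence "{x \<in> {1..N}. f x = y} = {}" by blast
      hence "card {x \<in> {1..N}. f x = y} = 0" by (simp only: card.empty)
      moreover have "count (binary_mset l) y = 0" using 3 assms(1) by (auto simp: count_binary_mset)
      ultimately show ?thesis using cnt by metis
    qed
  qed
qed

text \<open>The indegrees already make \<open>f\<close> a binary tree on all of
  \<open>{1..N}\<close>. That it is its own reduction follows from \<open>follows_imp\<close>, with
  no inserted vertices and every vertex as its own label, whence the labelling
  \<open>fst\<close>.\<close>

lemma indegrees_imp_binary:
  assumes "l \<ge> 1" "N = 2 * l - 1" "f \<in> parent_funs N" "image_mset f (mset_set {1..N}) = binary_mset l"
  shows "Q_class l (pedges {1..N} f) \<in> binary_classes l"
proof -
  have r: "rooted {1..N} f" using assms(3) by (simp add: parent_funs_def)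
  have c: "card {x \<in> {1..N}. f x = y} = count (binary_mset l) y" for y
    using count_image_mset_set[of "{1..N}" f y] assms(4) by simp
  have b: "binary_tree l {1..N} f"
  proof
    show "rooted {1..N} f" by (rule r)
    have e: "{y \<in> {1..N}. f y = v} = {} \<longleftrightarrow> v \<in> {1..l}" if "v \<in> {1..N}" for v
    proof -
      have "{y \<in> {1..N}. f y = v} = {} \<longleftrightarrow> card {y \<in> {1..N}. f y = v} = 0" by (subst card_0_eq) auto
      also have "\<dots> \<longleftrightarrow> v \<in> {1..l}" unfolding c count_binary_mset using that assms(2) by auto
      finally show ?thesis .
    qed
    have "l \<le> N" using assms(1,2) by linarith
    thus "{v \<in> {1..N}. {y \<in> {1..N}. f y = v} = {}} = {1..l}" using e by fastforce
    show "card {y \<in> {1..N}. f y = v} = 2" if "v \<in> {1..N}" "v \<notin> {1..l}" for v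
      unfolding c count_binary_mset using that assms(2) by auto
    show "card {y \<in> {1..N}. f y = 0} = 1" unfolding c count_binary_mset by simp
  qed
  interpret binary_tree l "{1..N}" f by (rule b)
  have "placed N (\<lambda>_. 0) fst"
    unfolding placed_def
  proof (intro conjI ballI subsetI)
    show "inj_on fst (slots (\<lambda>_. 0))" unfolding slots_def by (auto simp: inj_on_def)
    fix x assume "x \<in> fst ` free_slots (\<lambda>_. 0)"
    hence "(x, 0) \<in> free_slots (\<lambda>_. 0)" unfolding free_slots_def slots_def by auto
    thus "x \<in> {l<..N}" unfolding free_slots_def slots_def by (auto simp: image_iff)
  qed simp
  moreover have "follows (\<lambda>_. 0) f fst" unfolding follows_def nxt_def head_def by simp
  moreover have "l \<le> N" using assms(1,2) by linarith
  ultimately have "Q_class l (pedges {1..N} f) = tree_class l (pgraph {1..N} f)"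
    using follows_imp(2) assms(3) by blast
  thus ?thesis unfolding binary_classes_iff using b by blast
qed

text \<open>At \<kappa> = 1 the class weight is a cardinality. For this \<open>N\<close> the falling
  product contains a zero factor as soon as some vertex is inserted, so only \<open>u = 0\<close>
  survives, with \<open>(l - 1)!\<close> labellings of the inner vertices.\<close>

lemma (in binary_tree) card_class_funs:
  assumes "N = 2 * l - 1"
  shows "card {f \<in> parent_funs N. Q_class l (pedges {1..N} f) = tree_class l (pgraph V p)} = fact (l - 1)"
proof -
  let ?W = "\<lambda>us. \<Sum>f | f \<in> parent_funs N \<and> Q_class l (pedges {1..N} f) = tree_class l (pgraph V p)
    \<and> u_vec l (pedges {1..N} f) = us. wt 1 N f"
  let ?U = "{us. length us = 2 * l - 1 \<and> sum_list us \<le> N}"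
  let ?z = "replicate (2 * l - 1) (0::nat)"
  have lN: "l \<le> N" and Nl: "N - l = l - 1" using card_V(2) assms by linarith+
  have N1: "1 + real N = 2 * real l" using assms card_V(2) by (simp add: of_nat_diff)
  have w: "?W us * (2 * real l) ^ (2 * l + sum_list us)
      = real (\<Prod>i<l - 1 + sum_list us. l - 1 - i) * ((1 + real (2 * l - 1 + sum_list us)) * (2 * real l) ^ N)"
    if "us \<in> ?U" for us
    using class_weight[OF lN, of us 1] that by (simp only: N1 Nl mult_1 mem_Collect_eq)
  have w0: "?W us = 0" if us: "us \<in> ?U - {?z}" for us
  proof -
    have "sum_list us \<noteq> 0"
    proof
      assume "sum_list us = 0"
      hence "us = ?z" using us by (intro replicate_eqI) (auto simp: sum_list_eq_0_iff)
      thus False using us by blast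
    qed
    hence "l - 1 < l - 1 + sum_list us" by linarith
    hence "l - 1 \<in> {..<l - 1 + sum_list us}" by (rule lessThan_iff[THEN iffD2])
    hence "(\<Prod>i<l - 1 + sum_list us. l - 1 - i) = 0" by (intro prod_zero bexI[of _ "l - 1"]) simp_all
    hence "?W us * (2 * real l) ^ (2 * l + sum_list us) = 0" using w[of us] us by simp
    thus ?thesis using card_V(2) by simp
  qed
  have z: "?z \<in> ?U" by (simp add: sum_list_replicate)
  have "?W ?z * (2 * real l) ^ (2 * l) = real (\<Prod>i<l - 1. l - 1 - i) * ((2 * real l) * (2 * real l) ^ N)"
  proof -
    have s0: "sum_list (replicate n (0::nat)) = 0" for n by simp
    show ?thesis using w[OF z] unfolding s0 add_0_right assms[symmetric] N1 .
  qed
  also have "(\<Prod>i<l - 1. l - 1 - i) = fact (l - 1)"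
    by (simp only: fact_prod_rev lessThan_atLeast0 of_nat_id)
  \<comment> \<open>\<open>N + 1 = 2 * l\<close>, so both sides carry the same power.\<close>
  also have "(2 * real l) * (2 * real l) ^ N = (2 * real l) ^ (2 * l)"
    using assms card_V(2) by (metis One_nat_def Suc_diff_le diff_Suc_Suc diff_zero le_add2 mult_2 le_trans power_Suc)
  finally have z1: "?W ?z = fact (l - 1)" using card_V(2) by simp
  have "?U \<subseteq> {us. set us \<subseteq> {0..N} \<and> length us = 2 * l - 1}"
    using member_le_sum_list by fastforce
  hence fU: "finite ?U" by (rule finite_subset) (simp add: finite_lists_length_eq)
  have "real (card {f \<in> parent_funs N. Q_class l (pedges {1..N} f) = tree_class l (pgraph V p)})
    = (\<Sum>f | f \<in> parent_funs N \<and> Q_class l (pedges {1..N} f) = tree_class l (pgraph V p). wt 1 N f)"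
    by (simp add: wt_def)
  also have "\<dots> = (\<Sum>us\<in>?U. ?W us)" by (rule class_weight_total[OF lN])
  also have "\<dots> = (\<Sum>us\<in>{?z}. ?W us)"
    by (rule sum.mono_neutral_right[OF fU]) (use z w0 in auto)
  also have "\<dots> = real (fact (l - 1))" using z1 by simp
  finally show ?thesis by (simp only: of_nat_eq_iff)
qed

lemma fact_double: "fact (2 * n) = 2 ^ n * fact n * (\<Prod>i=1..n. 2 * i - 1 :: nat)"
proof (induction n)
  case (Suc n)
  have "fact (2 * Suc n) = (2 * n + 2) * ((2 * n + 1) * fact (2 * n))" by simp
  also have "\<dots> = 2 ^ Suc n * fact (Suc n) * ((\<Prod>i=1..n. 2 * i - 1) * (2 * Suc n - 1))"
    unfolding Suc.IH by (simp add: algebra_simps)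
  finally show ?case by simp
qed simp

text \<open>Every class is hit by \<open>(l - 1)!\<close> functions, and all classes together by the
  functions with indegrees \<open>binary_mset l\<close>, of which there are
  \<open>(2 l - 2)! / 2^(l - 1)\<close> by the multinomial formula. The quotient is the product of
  odd numbers.\<close>

lemma num_binary_eq:
  assumes "l \<ge> 1"
  shows "finite (binary_classes l)" "num_binary l = (\<Prod>i=1..l-1. 2 * i - 1)"
proof -
  define N where "N = 2 * l - 1"
  let ?A = "\<lambda>\<alpha>. {f \<in> parent_funs N. Q_class l (pedges {1..N} f) = \<alpha>}"
  have cA: "card (?A \<alpha>) = fact (l - 1)" if \<alpha>: "\<alpha> \<in> binary_classes l" for \<alpha>
  proof -
    obtain V p where "binary_tree l V p" "\<alpha> = tree_class l (pgraph V p)"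
      using \<alpha> unfolding binary_classes_iff by blast
    thus ?thesis using binary_tree.card_class_funs N_def by blast
  qed
  have "binary_classes l \<subseteq> (\<lambda>f. Q_class l (pedges {1..N} f)) ` parent_funs N"
  proof
    fix \<alpha> assume "\<alpha> \<in> binary_classes l"
    hence "card (?A \<alpha>) \<noteq> 0" using cA by simp
    hence "?A \<alpha> \<noteq> {}" by (metis card.empty)
    thus "\<alpha> \<in> (\<lambda>f. Q_class l (pedges {1..N} f)) ` parent_funs N" by blast
  qed
  thus fin: "finite (binary_classes l)" by (rule finite_subset) (simp add: finite_parent_funs)
  have "(\<Union>\<alpha>\<in>binary_classes l. ?A \<alpha>) = {f \<in> parent_funs N. image_mset f (mset_set {1..N}) = binary_mset l}"
  proof (intro equalityI subsetI)
    fix f assume "f \<in> (\<Union>\<alpha>\<in>binary_classes l. ?A \<alpha>)"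
    hence f: "f \<in> parent_funs N" "Q_class l (pedges {1..N} f) \<in> binary_classes l" by auto
    then obtain V p where "binary_tree l V p" "Q_class l (pedges {1..N} f) = tree_class l (pgraph V p)"
      unfolding binary_classes_iff by blast
    thus "f \<in> {f \<in> parent_funs N. image_mset f (mset_set {1..N}) = binary_mset l}"
      using binary_tree.class_imp_indegrees[OF _ N_def f(1)] f(1) by blast
  next
    fix f assume "f \<in> {f \<in> parent_funs N. image_mset f (mset_set {1..N}) = binary_mset l}"
    thus "f \<in> (\<Union>\<alpha>\<in>binary_classes l. ?A \<alpha>)" using indegrees_imp_binary[OF assms N_def] by blast
  qed
  moreover have "card (\<Union>\<alpha>\<in>binary_classes l. ?A \<alpha>) = (\<Sum>\<alpha>\<in>binary_classes l. card (?A \<alpha>))"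
    by (rule card_UN_disjoint) (use fin finite_parent_funs in auto)
  moreover have "(\<Sum>\<alpha>\<in>binary_classes l. card (?A \<alpha>)) = num_binary l * fact (l - 1)"
    using cA by (simp add: num_binary_def)
  ultimately have 1: "num_binary l * fact (l - 1) = card {f \<in> parent_funs N. image_mset f (mset_set {1..N}) = binary_mset l}"
    by simp
  define M where "M = mset_set {l<..2 * l - 1} + mset_set {l<..2 * l - 1}"
  have sM: "size M = 2 * (l - 1)" using assms by (simp add: M_def)
  have "card {f \<in> parent_funs N. image_mset f (mset_set {1..N}) = binary_mset l}
    = card (permutations_of_multiset (binary_mset l - {#0#}))"
  proof (rule card_parent_funs_indegrees)
    show "1 \<le> N" using assms by (simp add: N_def)
    show "size (binary_mset l) = N" using sM assms by (simp add: binary_mset_def M_def N_def)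
    show "set_mset (binary_mset l) \<subseteq> {0..N}" by (auto simp: binary_mset_def N_def)
  qed (simp add: binary_mset_def)
  also have "binary_mset l - {#0#} = M" by (simp add: binary_mset_def M_def)
  finally have "num_binary l * fact (l - 1) * (\<Prod>x\<in>set_mset M. fact (count M x)) = fact (size M)"
    using card_permutations_of_multiset_aux[of M] 1 by simp
  \<comment> \<open>Each inner label occurs twice in \<open>M\<close> and contributes
    \<open>2!\<close>.\<close>
  moreover have "(\<Prod>x\<in>set_mset M. fact (count M x)) = (2::nat) ^ (l - 1)"
  proof -
    have "(\<Prod>x\<in>set_mset M. fact (count M x)) = (\<Prod>x\<in>{l<..2 * l - 1}. 2::nat)"
      by (rule prod.cong) (auto simp: M_def numeral_2_eq_2)
    thus ?thesis using assms by simp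
  qed
  ultimately have "num_binary l * fact (l - 1) * 2 ^ (l - 1) = 2 ^ (l - 1) * fact (l - 1) * (\<Prod>i=1..l-1. 2 * i - 1)"
    using sM fact_double[of "l - 1"] by simp
  hence "(2 ^ (l - 1) * fact (l - 1)) * num_binary l = (2 ^ (l - 1) * fact (l - 1)) * (\<Prod>i=1..l-1. 2 * i - 1)"
    by (simp only: mult_ac)
  thus "num_binary l = (\<Prod>i=1..l-1. 2 * i - 1)" by simp
qed

section \<open>Asymptotics\<close>

text \<open>The subtraction in \<open>acoef\<close> is truncated, so that it vanishes for \<open>m > N\<close> and all sums over \<open>m\<close> are finite.
  The shift of the index in \<open>ysum\<close> makes the recursion of its values start at \<open>j = 0\<close>.\<close>

definition acoef :: "real \<Rightarrow> nat \<Rightarrow> nat \<Rightarrow> nat \<Rightarrow> real" where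
  "acoef \<kappa> l N m = real (\<Prod>i<l - 1 + m. N - l - i) / (\<kappa> + N) ^ (2 * l - 1 + m)"

definition ysum :: "real \<Rightarrow> nat \<Rightarrow> nat \<Rightarrow> nat \<Rightarrow> real" where
  "ysum \<kappa> l N j = (if j = 0 then acoef \<kappa> l N 0
     else \<Sum>m\<le>N. ((m + (j - 1)) choose (j - 1)) * acoef \<kappa> l N m)"

text \<open>Abel summation: by Pascal's rule the differences of the weights are binomials of order
  \<open>j\<close>.\<close>

lemma abel_binomial:
  fixes b :: "nat \<Rightarrow> real"
  shows "(\<Sum>m\<le>n. real ((m + Suc j) choose Suc j) * (b m - b (Suc m)))
    = (\<Sum>m\<le>n. real ((m + j) choose j) * b m) - real ((n + Suc j) choose Suc j) * b (Suc n)"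
proof (induction n)
  case (Suc n)
  have c: "(Suc n + Suc j) choose Suc j = ((Suc n + j) choose j) + ((n + Suc j) choose Suc j)" by simp
  have "(\<Sum>m\<le>Suc n. real ((m + Suc j) choose Suc j) * (b m - b (Suc m)))
    = (\<Sum>m\<le>n. real ((m + j) choose j) * b m) - real ((n + Suc j) choose Suc j) * b (Suc n)
      + real ((Suc n + Suc j) choose Suc j) * (b (Suc n) - b (Suc (Suc n)))"
    unfolding sum.atMost_Suc Suc.IH ..
  also have "\<dots> = (\<Sum>m\<le>n. real ((m + j) choose j) * b m) + real ((Suc n + j) choose j) * b (Suc n)
      - real ((Suc n + Suc j) choose Suc j) * b (Suc (Suc n))"
    unfolding c of_nat_add by (simp add: algebra_simps)
  finally show ?case unfolding sum.atMost_Suc .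
qed simp

context
  fixes \<kappa> :: real and l N :: nat
  assumes \<kappa>: "\<kappa> > 0" and l: "l \<ge> 1" and lN: "l \<le> N"
begin

private abbreviation "a \<equiv> acoef \<kappa> l N"
private abbreviation "X \<equiv> \<kappa> + real N"

lemma X_pos: "X > 0" using \<kappa> by simp

lemma acoef_nonneg: "a m \<ge> 0"
  unfolding acoef_def using X_pos by (intro divide_nonneg_nonneg of_nat_0_le_iff) simp

lemma acoef_zero:
  assumes "m > N"
  shows "a m = 0"
proof -
  have "N - l < l - 1 + m" using assms by linarith
  hence "(\<Prod>i<l - 1 + m. N - l - i) = 0" by (intro prod_zero bexI[of _ "N - l"]) auto
  thus ?thesis by (simp add: acoef_def)
qed

text \<open>Passing from \<open>a m\<close> to \<open>a (Suc m)\<close> multiplies by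
  \<open>(N - s) / X\<close> with \<open>s = 2 * l - 1 + m\<close>, and
  \<open>X - (N - s) = \<kappa> + s\<close>.\<close>

lemma acoef_step: "(\<kappa> + real (2 * l - 1 + m)) * a m = X * (a m - a (Suc m))"
proof -
  let ?P = "\<Prod>i<l - 1 + m. N - l - i"
  have s: "a (Suc m) = real ?P * real (N - l - (l - 1 + m)) / X ^ (2 * l - 1 + m) / X"
    by (simp add: acoef_def)
  have "X * a (Suc m) = a m * real (N - l - (l - 1 + m))"
    unfolding s using X_pos by (simp add: acoef_def)
  moreover have "a m * real (N - l - (l - 1 + m)) = a m * (real N - real (2 * l - 1 + m))"
  proof (cases "2 * l - 1 + m \<le> N")
    case True
    thus ?thesis using l by (simp add: of_nat_diff)
  next
    \<comment> \<open>Here the truncated factor differs from \<open>N - s\<close>, but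
      \<open>a m\<close> already vanishes.\<close>
    case False
    hence "N - l < l - 1 + m" using lN by linarith
    hence "?P = 0" by (intro prod_zero bexI[of _ "N - l"]) auto
    hence "a m = 0" unfolding acoef_def by (simp only: of_nat_0 div_0)
    thus ?thesis by simp
  qed
  ultimately show ?thesis by (simp add: algebra_simps)
qed

lemma acoef_antimono: "a (Suc m) \<le> a m"
proof -
  have "X * (a m - a (Suc m)) \<ge> 0"
    unfolding acoef_step[symmetric] using \<kappa> acoef_nonneg by simp
  thus ?thesis using X_pos by (simp add: zero_le_mult_iff)
qed

lemma acoef_le: "a m \<le> a 0"
  by (induction m) (use acoef_antimono order_trans in blast)+

text \<open>By \<open>acoef_step\<close> the summand is \<open>X\<close> times a weighted
  difference, and summation by parts lowers the order of the binomial; the boundary term contains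
  \<open>a (Suc N) = 0\<close>. For \<open>j = 0\<close> the sum telescopes to \<open>a 0\<close>,
  whence the first case of \<open>ysum\<close>.\<close>

lemma ysum_weighted: "(\<Sum>m\<le>N. real ((m + j) choose j) * ((\<kappa> + real (2 * l - 1 + m)) * a m)) = X * ysum \<kappa> l N j"
proof -
  have "(\<Sum>m\<le>N. real ((m + j) choose j) * (a m - a (Suc m))) = ysum \<kappa> l N j"
  proof (cases j)
    case 0
    have "(\<Sum>m\<le>N. a m - a (Suc m)) = a 0 - a (Suc N)" by (rule sum_telescope)
    thus ?thesis using 0 acoef_zero[of "Suc N"] by (simp add: ysum_def)
  next
    case (Suc i)
    thus ?thesis using abel_binomial[of i a N] acoef_zero[of "Suc N"] by (simp add: ysum_def)
  qed
  thus ?thesis unfolding acoef_step by (simp add: sum_distrib_left[symmetric] mult.left_commute)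
qed

text \<open>The factor \<open>\<kappa> + 2 l - 1 + m\<close> is split into a constant and
  \<open>m + j + 1\<close>; the latter raises the binomial, as
  \<open>(m + j + 1) * C(m + j, j) = (j + 1) * C(m + j + 1, j + 1)\<close>.\<close>

lemma ysum_rec:
  "real (Suc j) * ysum \<kappa> l N (Suc (Suc j)) = X * ysum \<kappa> l N j - (2 * real l - 2 + \<kappa> - real j) * ysum \<kappa> l N (Suc j)"
proof -
  have term_eq: "real ((m + j) choose j) * ((\<kappa> + real (2 * l - 1 + m)) * a m)
    = real (Suc j) * (real ((m + Suc j) choose Suc j) * a m)
      + (2 * real l - 2 + \<kappa> - real j) * (real ((m + j) choose j) * a m)" for m
  proof -
    have "Suc j * ((m + Suc j) choose Suc j) = (m + Suc j) * ((m + j) choose j)"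
      using Suc_times_binomial_eq[of "m + j" j] by (simp add: mult.commute)
    hence e: "real (Suc j) * real ((m + Suc j) choose Suc j) = (real m + real j + 1) * real ((m + j) choose j)"
      by (metis (no_types, lifting) of_nat_mult of_nat_add of_nat_Suc add.assoc add.commute)
    have "real (2 * l - 1 + m) = 2 * real l - 1 + real m" using l by (simp add: of_nat_diff)
    hence "real ((m + j) choose j) * ((\<kappa> + real (2 * l - 1 + m)) * a m)
      = ((real m + real j + 1) * real ((m + j) choose j)) * a m + (2 * real l - 2 + \<kappa> - real j) * (real ((m + j) choose j) * a m)"
      by (simp add: algebra_simps)
    thus ?thesis unfolding e[symmetric] by (simp only: mult.assoc)
  qed
  have "X * ysum \<kappa> l N j = real (Suc j) * (\<Sum>m\<le>N. real ((m + Suc j) choose Suc j) * a m)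
      + (2 * real l - 2 + \<kappa> - real j) * (\<Sum>m\<le>N. real ((m + j) choose j) * a m)"
    unfolding ysum_weighted[symmetric] term_eq sum.distrib sum_distrib_left ..
  also have "(\<Sum>m\<le>N. real ((m + Suc j) choose Suc j) * a m) = ysum \<kappa> l N (Suc (Suc j))"
    by (simp only: ysum_def) simp
  also have "(\<Sum>m\<le>N. real ((m + j) choose j) * a m) = ysum \<kappa> l N (Suc j)" by (simp only: ysum_def) simp
  finally show ?thesis by linarith
qed

text \<open>Among sequences bounded by \<open>a 0\<close> with a given sum, the first moment is
  least when the mass is packed at the start. In the induction this is the estimate of
  \<open>?T\<close> by \<open>n + 1\<close> times \<open>a 0\<close>. The inequality turns a bound
  on \<open>ysum\<close> at index 2 into one at index 1.\<close>

lemma square_sum_le: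
  "(\<Sum>m\<le>n. a m)\<^sup>2 \<le> 2 * a 0 * (\<Sum>m\<le>n. real (m + 1) * a m)"
proof (induction n)
  case 0
  show ?case using acoef_nonneg[of 0] by (simp add: power2_eq_square)
next
  case (Suc n)
  let ?T = "\<Sum>m\<le>n. a m" and ?b = "a (Suc n)"
  have T: "?T \<le> real (Suc n) * a 0"
    using sum_bounded_above[of "{..n}" a "a 0"] acoef_le by simp
  have b: "0 \<le> ?b" "?b \<le> a 0" using acoef_nonneg acoef_le by auto
  have "(\<Sum>m\<le>Suc n. a m)\<^sup>2 = ?T\<^sup>2 + 2 * ?T * ?b + ?b * ?b"
    by (simp add: power2_eq_square algebra_simps)
  also have "\<dots> \<le> 2 * a 0 * (\<Sum>m\<le>n. real (m + 1) * a m) + 2 * (real (Suc n) * a 0) * ?b + a 0 * ?b"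
    using Suc.IH T b by (intro add_mono mult_right_mono mult_left_mono) auto
  also have "\<dots> \<le> 2 * a 0 * (\<Sum>m\<le>Suc n. real (m + 1) * a m)"
    using mult_nonneg_nonneg[OF acoef_nonneg[of 0] b(1)] by (simp add: algebra_simps)
  finally show ?case .
qed

text \<open>The recursion at \<open>j = 0\<close> gives
  \<open>ysum \<kappa> l N 2 \<le> X * a 0\<close>, which \<open>square_sum_le\<close> converts. The
  order in \<open>N\<close> is the right one; the constant is crude.\<close>

lemma ysum_1_le: "ysum \<kappa> l N 1 \<le> a 0 * sqrt (2 * X)" "ysum \<kappa> l N 1 \<ge> 0"
proof -
  have y1: "ysum \<kappa> l N 1 = (\<Sum>m\<le>N. a m)" by (simp add: ysum_def)
  have y2: "ysum \<kappa> l N 2 = (\<Sum>m\<le>N. real (m + 1) * a m)" by (simp add: ysum_def numeral_2_eq_2)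
  show nn: "ysum \<kappa> l N 1 \<ge> 0" unfolding y1 by (rule sum_nonneg) (rule acoef_nonneg)
  have "ysum \<kappa> l N 2 = X * a 0 - (2 * real l - 2 + \<kappa>) * ysum \<kappa> l N 1"
    using ysum_rec[of 0] by (simp add: numeral_2_eq_2 ysum_def)
  hence "ysum \<kappa> l N 2 \<le> X * a 0" using nn l \<kappa> by simp
  hence "(ysum \<kappa> l N 1)\<^sup>2 \<le> 2 * a 0 * (X * a 0)"
    using square_sum_le[of N] mult_left_mono[of "ysum \<kappa> l N 2" "X * a 0" "2 * a 0"] acoef_nonneg[of 0]
    unfolding y1 y2 by linarith
  also have "\<dots> = (a 0 * sqrt (2 * X))\<^sup>2" using X_pos by (simp add: power_mult_distrib power2_eq_square)
  finally show "ysum \<kappa> l N 1 \<le> a 0 * sqrt (2 * X)"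
    by (rule power2_le_imp_le) (use acoef_nonneg[of 0] X_pos in simp)
qed

lemma acoef_0_pos: "2 * l \<le> N \<Longrightarrow> a 0 > 0"
  unfolding acoef_def using X_pos by (intro divide_pos_pos) (auto intro!: prod_pos)

end

text \<open>After normalisation the recursion reads \<open>y (j + 2) = ((1 + \<kappa> / N) * y j - c
  j / sqrt N * y (j + 1)) / (j + 1)\<close>. Limits propagate along even indices as soon as the odd
  neighbours are bounded, so this bound is carried along in the induction.\<close>

lemma ysum_normalised_limits:
  fixes \<kappa> :: real
  assumes \<kappa>: "\<kappa> > 0" and l: "l \<ge> 1"
  defines "y \<equiv> \<lambda>j N. ysum \<kappa> l N j / (acoef \<kappa> l N 0 * sqrt (real N) ^ j)"
  shows "y (2 * i) \<longlonglongrightarrow> 1 / (\<Prod>t=1..i. 2 * real t - 1) \<and> (\<exists>B. \<forall>\<^sub>F N in sequentially. \<bar>y (2 * i + 1) N\<bar> \<le> B)"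
proof -
  define c where "c j = 2 * real l - 2 + \<kappa> - real j" for j
  have rec: "\<forall>\<^sub>F N in sequentially. y (Suc (Suc j)) N
      = ((\<kappa> + real N) / real N * y j N - c j / sqrt (real N) * y (Suc j) N) / real (Suc j)" for j
    using eventually_ge_at_top[of "2 * l"]
  proof eventually_elim
    case (elim N)
    have N: "l \<le> N" "N > 0" using elim l by linarith+
    have a: "acoef \<kappa> l N 0 > 0" by (rule acoef_0_pos[OF \<kappa> l N(1) elim])
    define A r where "A = acoef \<kappa> l N 0" and "r = sqrt (real N)"
    have r: "r > 0" "r * r = real N" using N by (auto simp: r_def)
    have R: "real (Suc j) * ysum \<kappa> l N (Suc (Suc j)) = (\<kappa> + real N) * ysum \<kappa> l N j - c j * ysum \<kappa> l N (Suc j)"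
      using ysum_rec[OF \<kappa> l N(1), of j] by (simp add: c_def)
    have "real (Suc j) * y (Suc (Suc j)) N = ((\<kappa> + real N) * ysum \<kappa> l N j - c j * ysum \<kappa> l N (Suc j)) / (A * (r ^ j * (r * r)))"
      unfolding R[symmetric] y_def A_def r_def by (simp add: mult_ac)
    also have "\<dots> = (\<kappa> + real N) / (r * r) * (ysum \<kappa> l N j / (A * r ^ j)) - c j / r * (ysum \<kappa> l N (Suc j) / (A * r ^ Suc j))"
      by (simp add: diff_divide_distrib mult_ac)
    also have "\<dots> = (\<kappa> + real N) / real N * y j N - c j / r * y (Suc j) N"
    proof -
      have "y i N = ysum \<kappa> l N i / (A * r ^ i)" for i by (simp add: y_def A_def r_def)
      thus ?thesis by (simp only: r(2))
    qed
    finally show ?case by (simp add: field_simps r_def)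
  qed
  have l1: "(\<lambda>N. (\<kappa> + real N) / real N) \<longlonglongrightarrow> 1" by real_asymp
  have l2: "(\<lambda>N. c j / sqrt (real N)) \<longlonglongrightarrow> 0" for j by real_asymp
  show ?thesis
  proof (induction i)
    case 0
    have "\<forall>\<^sub>F N in sequentially. y 0 N = 1"
      using eventually_ge_at_top[of "2 * l"]
    proof eventually_elim
      case (elim N)
      have "acoef \<kappa> l N 0 > 0" by (rule acoef_0_pos[OF \<kappa> l _ elim]) (use elim in linarith)
      thus ?case by (simp add: y_def ysum_def)
    qed
    hence "y 0 \<longlonglongrightarrow> 1" by (rule tendsto_eventually)
    \<comment> \<open>The constant comes from
      \<open>\<kappa> + N \<le> (\<kappa> + 1) * N\<close>.\<close>
    moreover have "\<forall>\<^sub>F N in sequentially. \<bar>y 1 N\<bar> \<le> sqrt (2 * (\<kappa> + 1))"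
      using eventually_ge_at_top[of "2 * l"]
    proof eventually_elim
      case (elim N)
      have N: "l \<le> N" "N > 0" using elim l by linarith+
      have a: "acoef \<kappa> l N 0 > 0" by (rule acoef_0_pos[OF \<kappa> l N(1) elim])
      note b = ysum_1_le[OF \<kappa> l N(1)]
      have "\<kappa> + real N \<le> (\<kappa> + 1) * real N" using N \<kappa> by (simp add: algebra_simps)
      hence "2 * (\<kappa> + real N) \<le> 2 * (\<kappa> + 1) * real N" by (simp add: algebra_simps)
      hence "sqrt (2 * (\<kappa> + real N)) \<le> sqrt (2 * (\<kappa> + 1) * real N)" by (rule real_sqrt_le_mono)
      also have "\<dots> = sqrt (2 * (\<kappa> + 1)) * sqrt (real N)" by (rule real_sqrt_mult)
      finally have "ysum \<kappa> l N 1 \<le> acoef \<kappa> l N 0 * (sqrt (2 * (\<kappa> + 1)) * sqrt (real N))"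
        using b(1) mult_left_mono a by (meson less_imp_le order_trans)
      hence "y 1 N \<le> sqrt (2 * (\<kappa> + 1))"
        unfolding y_def using a N by (simp add: pos_divide_le_eq mult_ac)
      moreover have "y 1 N \<ge> 0" unfolding y_def using a b(2) by (intro divide_nonneg_nonneg) auto
      ultimately show ?case by linarith
    qed
    ultimately show ?case by auto
  next
    case (Suc i)
    then obtain B where lim: "y (2 * i) \<longlonglongrightarrow> 1 / (\<Prod>t=1..i. 2 * real t - 1)"
      and B: "\<forall>\<^sub>F N in sequentially. \<bar>y (Suc (2 * i)) N\<bar> \<le> B" by auto
    have z: "(\<lambda>N. c (2 * i) / sqrt (real N) * y (Suc (2 * i)) N) \<longlonglongrightarrow> 0"
    proof (rule Lim_null_comparison)
      show "\<forall>\<^sub>F N in sequentially. norm (c (2 * i) / sqrt (real N) * y (Suc (2 * i)) N) \<le> \<bar>c (2 * i) / sqrt (real N)\<bar> * B"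
        using B by eventually_elim (unfold real_norm_def abs_mult, intro mult_left_mono, auto)
      show "(\<lambda>N. \<bar>c (2 * i) / sqrt (real N)\<bar> * B) \<longlonglongrightarrow> 0"
        using tendsto_mult[OF tendsto_rabs[OF l2[of "2 * i"]] tendsto_const[of B]] by simp
    qed
    have "(\<lambda>N. ((\<kappa> + real N) / real N * y (2 * i) N - c (2 * i) / sqrt (real N) * y (Suc (2 * i)) N) / real (Suc (2 * i)))
      \<longlonglongrightarrow> (1 * (1 / (\<Prod>t=1..i. 2 * real t - 1)) - 0) / real (Suc (2 * i))"
      by (intro tendsto_intros l1 lim z) simp
    hence "y (Suc (Suc (2 * i))) \<longlonglongrightarrow> (1 * (1 / (\<Prod>t=1..i. 2 * real t - 1)) - 0) / real (Suc (2 * i))"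
      by (subst tendsto_cong[OF rec])
    also have "(1 * (1 / (\<Prod>t=1..i. 2 * real t - 1)) - 0) / real (Suc (2 * i)) = 1 / (\<Prod>t=1..Suc i. 2 * real t - 1)"
      by simp
    finally have lim2: "y (Suc (Suc (2 * i))) \<longlonglongrightarrow> 1 / (\<Prod>t=1..Suc i. 2 * real t - 1)" .
    have "(\<lambda>N. c (Suc (2 * i)) / sqrt (real N) * y (Suc (Suc (2 * i))) N) \<longlonglongrightarrow> 0 * (1 / (\<Prod>t=1..Suc i. 2 * real t - 1))"
      by (intro tendsto_mult l2 lim2)
    hence "\<forall>\<^sub>F N in sequentially. dist (c (Suc (2 * i)) / sqrt (real N) * y (Suc (Suc (2 * i))) N) (0 * (1 / (\<Prod>t=1..Suc i. 2 * real t - 1))) < 1"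
      by (rule tendstoD) simp
    moreover have "\<forall>\<^sub>F N in sequentially. dist ((\<kappa> + real N) / real N) 1 < 1" by (rule tendstoD[OF l1]) simp
    \<comment> \<open>The factor \<open>(\<kappa> + N) / N\<close> is eventually at most
      \<open>2\<close>, the cross term at most \<open>1\<close> in absolute value, and the divisor
      in the recursion is at least \<open>1\<close>.\<close>
    ultimately have "\<forall>\<^sub>F N in sequentially. \<bar>y (Suc (Suc (Suc (2 * i)))) N\<bar> \<le> 2 * B + 1"
      using B rec[of "Suc (2 * i)"]
    proof eventually_elim
      case (elim N)
      let ?u = "(\<kappa> + real N) / real N" and ?w = "c (Suc (2 * i)) / sqrt (real N) * y (Suc (Suc (2 * i))) N"
      have u: "\<bar>?u\<bar> \<le> 2" and w: "\<bar>?w\<bar> \<le> 1" using elim(1,2) by (auto simp: dist_real_def)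
      have "\<bar>?u * y (Suc (2 * i)) N - ?w\<bar> \<le> \<bar>?u\<bar> * \<bar>y (Suc (2 * i)) N\<bar> + \<bar>?w\<bar>"
        unfolding abs_mult[symmetric] by (rule abs_triangle_ineq4)
      also have "\<dots> \<le> 2 * B + 1" using u w elim(3) by (intro add_mono mult_mono) auto
      finally have "\<bar>?u * y (Suc (2 * i)) N - ?w\<bar> \<le> 2 * B + 1" .
      moreover have "\<bar>y (Suc (Suc (Suc (2 * i)))) N\<bar> \<le> \<bar>?u * y (Suc (2 * i)) N - ?w\<bar>"
        unfolding elim(4) abs_divide by (simp add: divide_le_eq mult_le_cancel_left1)
      ultimately show ?case by linarith
    qed
    thus ?case using lim2 by auto
  qed
qed

text \<open>By \<open>ysum_weighted\<close> the sum is \<open>\<kappa> + N\<close> times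
  \<open>ysum\<close> at index \<open>2 * (l - 1)\<close>. Undoing the normalisation leaves
  \<open>l - 1\<close> factors \<open>(N - l - i) / (\<kappa> + N)\<close> and \<open>l - 1\<close>
  factors \<open>N / (\<kappa> + N)\<close>, all of which tend to \<open>1\<close>.\<close>

lemma total_limit:
  fixes \<kappa> :: real
  assumes \<kappa>: "\<kappa> > 0" and l: "l \<ge> 1"
  shows "(\<lambda>N. \<Sum>m\<le>N. real ((m + (2 * l - 2)) choose (2 * l - 2)) * ((\<kappa> + real (2 * l - 1 + m)) * acoef \<kappa> l N m))
    \<longlonglongrightarrow> 1 / (\<Prod>t=1..l-1. 2 * real t - 1)" (is "?f \<longlonglongrightarrow> _")
proof -
  define y where "y = (\<lambda>N. ysum \<kappa> l N (2 * (l - 1)) / (acoef \<kappa> l N 0 * sqrt (real N) ^ (2 * (l - 1))))"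
  have y: "y \<longlonglongrightarrow> 1 / (\<Prod>t=1..l-1. 2 * real t - 1)"
    unfolding y_def using ysum_normalised_limits[OF assms, of "l - 1"] by blast
  have "(\<lambda>N. (\<Prod>i<l - 1. (real N - real l - real i) / (\<kappa> + real N)) * (real N / (\<kappa> + real N)) ^ (l - 1)) \<longlonglongrightarrow> (\<Prod>i<l - 1. 1) * 1 ^ (l - 1)"
    by (intro tendsto_mult tendsto_power tendsto_prod) real_asymp+
  hence "(\<lambda>N. (\<Prod>i<l - 1. (real N - real l - real i) / (\<kappa> + real N)) * (real N / (\<kappa> + real N)) ^ (l - 1) * y N) \<longlonglongrightarrow> 1 * (1 / (\<Prod>t=1..l-1. 2 * real t - 1))"
    using y by (intro tendsto_mult) simp_all
  moreover have "\<forall>\<^sub>F N in sequentially. (\<Prod>i<l - 1. (real N - real l - real i) / (\<kappa> + real N)) * (real N / (\<kappa> + real N)) ^ (l - 1) * y N = ?f N"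
    using eventually_ge_at_top[of "2 * l"]
  proof eventually_elim
    case (elim N)
    have N: "l \<le> N" "N > 0" using elim l by linarith+
    have a: "acoef \<kappa> l N 0 > 0" by (rule acoef_0_pos[OF \<kappa> l N(1) elim])
    define X where "X = \<kappa> + real N"
    have X: "X > 0" using \<kappa> by (simp add: X_def)
    have "(\<Prod>i<l - 1. (real N - real l - real i) / X) = (\<Prod>i<l - 1. real (N - l - i)) / X ^ (l - 1)"
    proof -
      have "(\<Prod>i<l - 1. (real N - real l - real i) / X) = (\<Prod>i<l - 1. real (N - l - i) / X)"
        by (rule prod.cong) (use elim in \<open>auto simp: of_nat_diff\<close>)
      thus ?thesis by (simp add: prod_dividef)
    qed
    moreover have "(\<Prod>i<l - 1. real (N - l - i)) = acoef \<kappa> l N 0 * X ^ (2 * l - 1)"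
      using X by (simp add: acoef_def X_def)
    moreover have "sqrt (real N) ^ (2 * (l - 1)) = real N ^ (l - 1)" by (simp add: power_mult)
    moreover have "X ^ (2 * l - 1) = X * X ^ (l - 1) * X ^ (l - 1)"
    proof -
      have "2 * l - 1 = Suc ((l - 1) + (l - 1))" using l by linarith
      thus ?thesis by (simp only: power_Suc power_add mult.assoc)
    qed
    ultimately have "(\<Prod>i<l - 1. (real N - real l - real i) / X) * (real N / X) ^ (l - 1) * y N = X * ysum \<kappa> l N (2 * (l - 1))"
      unfolding y_def using X a N by (simp add: power_divide field_simps)
    also have "\<dots> = ?f N"
      using ysum_weighted[OF \<kappa> l N(1), of "2 * (l - 1)"] unfolding X_def by (simp add: diff_mult_distrib2)
    finally show ?case unfolding X_def .
  qed
  ultimately show ?thesis using tendsto_cong by fastforce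
qed

section \<open>The local limit\<close>

lemma sum_arithmetic_progression: "(\<Sum>i<k. real l + real i) = real l * real k + real k * (real k - 1) / 2"
  by (induction k) (auto simp: field_simps)

text \<open>The logarithm of a factor \<open>1 - w\<close> lies between \<open>- w - 2 * w^2\<close>
  and \<open>- w\<close>. The terms \<open>w\<close> sum to exactly \<open>s\<close>, which tends to
  \<open>x^2 / 2\<close>; their squares sum to at most \<open>e\<close>, which tends to
  \<open>0\<close> because \<open>k\<close> is of order \<open>sqrt N\<close> and each
  \<open>w\<close> of order at most \<open>k / N\<close>.\<close>

lemma falling_product_limit:
  fixes k :: "nat \<Rightarrow> nat"
  assumes k: "(\<lambda>N. real (k N) / sqrt (real N)) \<longlonglongrightarrow> x"
  shows "(\<lambda>N. \<Prod>i<k N. 1 - (real l + real i) / real N) \<longlonglongrightarrow> exp (- (x\<^sup>2 / 2))"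
proof -
  define r where "r N = 1 / sqrt (real N)" for N :: nat
  define b where "b N = real (k N) / sqrt (real N)" for N
  have r0: "r \<longlonglongrightarrow> 0" unfolding r_def by real_asymp
  have b: "b \<longlonglongrightarrow> x" using k unfolding b_def .
  define s where "s N = real l * b N * r N + b N * (b N - r N) / 2" for N
  define e where "e N = b N * (real l * r N + b N)\<^sup>2 * r N" for N
  have "s \<longlonglongrightarrow> real l * x * 0 + x * (x - 0) / 2" unfolding s_def by (intro tendsto_intros r0 b) simp
  hence s: "s \<longlonglongrightarrow> x\<^sup>2 / 2" by (simp add: power2_eq_square)
  have "e \<longlonglongrightarrow> x * (real l * 0 + x)\<^sup>2 * 0" unfolding e_def by (intro tendsto_intros r0 b)
  hence e: "e \<longlonglongrightarrow> 0" by simp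
  have "(\<lambda>N. (real l * r N + b N) * r N) \<longlonglongrightarrow> (real l * 0 + x) * 0" by (intro tendsto_intros r0 b)
  \<comment> \<open>Terms \<open>w\<close> below \<open>1 / 2\<close> are the range in which the
    quadratic lower bound for the logarithm is applied.\<close>
  hence "\<forall>\<^sub>F N in sequentially. dist ((real l * r N + b N) * r N) 0 < 1 / 2" by (intro tendstoD) auto
  hence ev: "\<forall>\<^sub>F N in sequentially. exp (- s N - 2 * e N) \<le> (\<Prod>i<k N. 1 - (real l + real i) / real N)
      \<and> (\<Prod>i<k N. 1 - (real l + real i) / real N) \<le> exp (- s N)"
    using eventually_gt_at_top[of 0]
  proof eventually_elim
    case (elim N)
    define q where "q = sqrt (real N)"
    have q: "q > 0" "q * q = real N" using elim(2) by (auto simp: q_def)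
    define w where "w i = (real l + real i) / real N" for i
    define W where "W = (real l + real (k N)) / real N"
    have kq: "real (k N) = b N * q" using q by (simp add: b_def q_def)
    have rq: "r N = 1 / q" by (simp add: r_def q_def)
    have W: "W = (real l * r N + b N) * r N"
      unfolding W_def kq rq q(2)[symmetric] using q(1) by (simp add: field_simps)
    hence W2: "W < 1 / 2" using elim(1) by (simp add: dist_real_def)
    have w: "0 \<le> w i" "w i \<le> W" "w i \<le> 1 / 2" if "i < k N" for i
    proof -
      show "0 \<le> w i" by (simp add: w_def)
      show "w i \<le> W" using that by (simp add: w_def W_def divide_right_mono)
      thus "w i \<le> 1 / 2" using W2 by simp
    qed
    have sw: "(\<Sum>i<k N. w i) = s N"
    proof -
      have "(\<Sum>i<k N. w i) = (real l * real (k N) + real (k N) * (real (k N) - 1) / 2) / real N"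
        unfolding w_def sum_divide_distrib[symmetric] sum_arithmetic_progression ..
      also have "\<dots> = s N" unfolding kq s_def rq q(2)[symmetric] using q(1) by (simp add: field_simps)
      finally show ?thesis .
    qed
    have se: "(\<Sum>i<k N. (w i)\<^sup>2) \<le> e N"
    proof -
      have "(\<Sum>i<k N. (w i)\<^sup>2) \<le> real (k N) * W\<^sup>2"
        using sum_bounded_above[of "{..<k N}" "\<lambda>i. (w i)\<^sup>2" "W\<^sup>2"] w by (simp add: power_mono)
      also have "\<dots> = e N" unfolding W e_def kq rq using q(1) by (simp add: power2_eq_square field_simps)
      finally show ?thesis .
    qed
    have pos: "1 - w i > 0" if "i < k N" for i using w(3)[OF that] by linarith
    have prod: "(\<Prod>i<k N. 1 - w i) = exp (\<Sum>i<k N. ln (1 - w i))"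
      using pos by (simp add: exp_sum)
    have "(\<Sum>i<k N. ln (1 - w i)) \<le> (\<Sum>i<k N. - w i)"
    proof (rule sum_mono)
      fix i assume "i \<in> {..<k N}"
      hence "ln (1 - w i) \<le> (1 - w i) - 1" by (intro ln_le_minus_one pos) simp
      thus "ln (1 - w i) \<le> - w i" by simp
    qed
    hence up: "(\<Sum>i<k N. ln (1 - w i)) \<le> - s N" by (simp add: sum_negf sw)
    have "(\<Sum>i<k N. - w i - 2 * (w i)\<^sup>2) \<le> (\<Sum>i<k N. ln (1 - w i))"
      by (rule sum_mono) (use w in \<open>auto intro!: ln_one_minus_pos_lower_bound\<close>)
    moreover have "(\<Sum>i<k N. - w i - 2 * (w i)\<^sup>2) = - s N - 2 * (\<Sum>i<k N. (w i)\<^sup>2)"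
      by (simp add: sum_subtractf sum_negf sum_distrib_left sw)
    ultimately have lo: "- s N - 2 * e N \<le> (\<Sum>i<k N. ln (1 - w i))" using se by linarith
    show ?case using up lo prod by (simp add: w_def)
  qed
  have lo: "(\<lambda>N. exp (- s N - 2 * e N)) \<longlonglongrightarrow> exp (- (x\<^sup>2 / 2) - 2 * 0)" by (intro tendsto_intros s e)
  have up: "(\<lambda>N. exp (- s N)) \<longlonglongrightarrow> exp (- (x\<^sup>2 / 2))" by (intro tendsto_intros s)
  show ?thesis
    by (rule tendsto_sandwich[OF _ _ lo[unfolded mult_zero_right diff_zero] up])
      (use ev in \<open>simp_all add: eventually_conj_iff\<close>)
qed

text \<open>For large \<open>N\<close> the expression is \<open>(\<kappa> + s) / sqrt N\<close>
  times the product of \<open>1 - (l + i) / N\<close> over \<open>i < k\<close>, divided by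
  \<open>(1 + \<kappa> / N)^s\<close>, where \<open>s = k + l\<close>. The three parts tend to
  \<open>x\<close>, \<open>exp (- x^2 / 2)\<close> and \<open>1\<close>.\<close>

lemma local_limit:
  fixes \<kappa> :: real and m :: "nat \<Rightarrow> nat"
  assumes \<kappa>: "\<kappa> > 0" and l: "l \<ge> 1" and m: "(\<lambda>N. real (m N) / sqrt (real N)) \<longlonglongrightarrow> x"
  shows "(\<lambda>N. real N powr ((2 * real l - 1) / 2) * ((\<kappa> + real (2 * l - 1 + m N)) * acoef \<kappa> l N (m N)))
    \<longlonglongrightarrow> x * exp (- (x\<^sup>2 / 2))"
proof -
  define k s where "k N = l - 1 + m N" and "s N = 2 * l - 1 + m N" for N
  have r0: "(\<lambda>N. 1 / sqrt (real N)) \<longlonglongrightarrow> 0" by real_asymp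
  have "(\<lambda>N. real (l - 1) * (1 / sqrt (real N)) + real (m N) / sqrt (real N)) \<longlonglongrightarrow> real (l - 1) * 0 + x"
    by (intro tendsto_intros r0 m)
  hence k: "(\<lambda>N. real (k N) / sqrt (real N)) \<longlonglongrightarrow> x" by (simp add: k_def add_divide_distrib)
  have "(\<lambda>N. (\<kappa> + real (2 * l - 1)) * (1 / sqrt (real N)) + real (m N) / sqrt (real N)) \<longlonglongrightarrow> (\<kappa> + real (2 * l - 1)) * 0 + x"
    by (intro tendsto_intros r0 m)
  hence s: "(\<lambda>N. (\<kappa> + real (s N)) / sqrt (real N)) \<longlonglongrightarrow> x"
    by (simp add: s_def add_divide_distrib add.assoc)
  have X: "(\<lambda>N. (1 + \<kappa> / real N) ^ s N) \<longlonglongrightarrow> 1"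
  proof -
    have "(\<lambda>N. \<kappa> * ((\<kappa> + real (s N)) / sqrt (real N)) * (1 / sqrt (real N))) \<longlonglongrightarrow> \<kappa> * x * 0"
      by (intro tendsto_intros r0 s)
    hence "(\<lambda>N. exp (\<kappa> * ((\<kappa> + real (s N)) / sqrt (real N)) * (1 / sqrt (real N)))) \<longlonglongrightarrow> exp 0"
      by (intro tendsto_exp) simp
    hence lim: "(\<lambda>N. exp (\<kappa> * ((\<kappa> + real (s N)) / sqrt (real N)) * (1 / sqrt (real N)))) \<longlonglongrightarrow> 1" by (simp only: exp_zero)
    have up: "\<forall>\<^sub>F N in sequentially. (1 + \<kappa> / real N) ^ s N \<le> exp (\<kappa> * ((\<kappa> + real (s N)) / sqrt (real N)) * (1 / sqrt (real N)))"
      using eventually_gt_at_top[of 0]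
    proof eventually_elim
      case (elim N)
      have "(1 + \<kappa> / real N) ^ s N \<le> exp (\<kappa> / real N) ^ s N"
        using \<kappa> by (intro power_mono exp_ge_add_one_self) auto
      also have "\<dots> = exp (real (s N) * (\<kappa> / real N))" by (rule exp_of_nat_mult[symmetric])
      also have "\<dots> \<le> exp ((\<kappa> + real (s N)) * (\<kappa> / real N))"
        using \<kappa> by (simp add: divide_right_mono mult_right_mono)
      also have "(\<kappa> + real (s N)) * (\<kappa> / real N) = \<kappa> * ((\<kappa> + real (s N)) / sqrt (real N)) * (1 / sqrt (real N))"
        using elim by simp
      finally show ?case .
    qed
    have lo: "\<forall>\<^sub>F N in sequentially. 1 \<le> (1 + \<kappa> / real N) ^ s N"
      using \<kappa> by (intro always_eventually allI one_le_power) simp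
    show ?thesis by (rule tendsto_sandwich[OF lo up tendsto_const lim])
  qed
  have lim: "(\<lambda>N. (\<kappa> + real (s N)) / sqrt (real N) * (\<Prod>i<k N. 1 - (real l + real i) / real N) / (1 + \<kappa> / real N) ^ s N)
    \<longlonglongrightarrow> x * exp (- (x\<^sup>2 / 2)) / 1"
    by (intro tendsto_intros s falling_product_limit[OF k] X) simp
  \<comment> \<open>This bound on \<open>k N\<close> makes \<open>l + k N < N\<close> eventually, so
    that no subtraction in \<open>acoef\<close> is truncated.\<close>
  have 1: "\<forall>\<^sub>F N in sequentially. real (k N) / sqrt (real N) < x + 1"
    using order_tendstoD(2)[OF k, of "x + 1"] by simp
  have "\<forall>\<^sub>F N in sequentially. (\<kappa> + real (s N)) / sqrt (real N) * (\<Prod>i<k N. 1 - (real l + real i) / real N) / (1 + \<kappa> / real N) ^ s N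
    = real N powr ((2 * real l - 1) / 2) * ((\<kappa> + real (2 * l - 1 + m N)) * acoef \<kappa> l N (m N))"
  proof -
    have 2: "\<forall>\<^sub>F N in sequentially. real l + (x + 1) * sqrt (real N) < real N" by real_asymp
    show ?thesis using 1 2 eventually_gt_at_top[of 0]
    proof eventually_elim
      case (elim N)
      have q: "sqrt (real N) > 0" "sqrt (real N) * sqrt (real N) = real N" using elim(3) by auto
      have "real (k N) < (x + 1) * sqrt (real N)" using elim(1) q by (simp add: pos_divide_less_eq)
      hence kN: "l + k N < N" using elim(2) by linarith
      have "real (\<Prod>i<k N. N - l - i) = (\<Prod>i<k N. real N * (1 - (real l + real i) / real N))"
        unfolding of_nat_prod by (rule prod.cong) (use kN elim(3) in \<open>auto simp: of_nat_diff field_simps\<close>)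
      also have "\<dots> = real N ^ k N * (\<Prod>i<k N. 1 - (real l + real i) / real N)"
        by (simp add: prod.distrib)
      finally have P: "real (\<Prod>i<k N. N - l - i) = real N ^ k N * (\<Prod>i<k N. 1 - (real l + real i) / real N)" .
      have sk: "s N = k N + l" using l by (simp add: s_def k_def)
      have "(\<kappa> + real N) ^ s N = real N ^ s N * (1 + \<kappa> / real N) ^ s N"
      proof -
        have "\<kappa> + real N = real N * (1 + \<kappa> / real N)" using elim(3) by (simp add: field_simps)
        thus ?thesis by (metis power_mult_distrib)
      qed
      also have "real N ^ s N = real N ^ k N * real N ^ l" unfolding sk by (rule power_add)
      finally have D: "(\<kappa> + real N) ^ s N = real N ^ k N * real N ^ l * (1 + \<kappa> / real N) ^ s N" .
      have pw: "real N powr ((2 * real l - 1) / 2) = real N ^ l / sqrt (real N)"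
      proof -
        have e: "(2 * real l - 1) / 2 = real l - 1 / 2" by (simp add: field_simps)
        show ?thesis unfolding e powr_diff using elim(3) by (simp add: powr_realpow powr_half_sqrt)
      qed
      have a: "acoef \<kappa> l N (m N) = (\<Prod>i<k N. 1 - (real l + real i) / real N) / (real N ^ l * (1 + \<kappa> / real N) ^ s N)"
        unfolding acoef_def k_def[symmetric] s_def[symmetric] P D using elim(3) by (simp add: mult.assoc)
      show ?case unfolding a pw s_def[symmetric] using elim(3) by simp
    qed
  qed
  thus ?thesis using Lim_transform_eventually[OF lim] by simp
qed

section \<open>Probabilities of classes and their limits\<close>

lemma (in binary_tree) class_prob:
  assumes "\<kappa> > 0" "l \<le> N" "length us = 2 * l - 1"
  shows "measure_pmf.prob (tree_law N \<kappa>) {T. Q_class l T = tree_class l (pgraph V p) \<and> u_vec l T = us}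
    = (\<kappa> + real (2 * l - 1 + sum_list us)) * acoef \<kappa> l N (sum_list us)"
proof -
  define X W Z A where "X = \<kappa> + real N"
    and "W = (\<Sum>f | f \<in> parent_funs N \<and> Q_class l (pedges {1..N} f) = tree_class l (pgraph V p)
      \<and> u_vec l (pedges {1..N} f) = us. wt \<kappa> N f)"
    and "Z = (\<Sum>f\<in>parent_funs N. wt \<kappa> N f)"
    and "A = real (\<Prod>i<l - 1 + sum_list us. N - l - i)"
  have X: "X > 0" using assms(1) by (simp add: X_def)
  have "2 * l + sum_list us = Suc (2 * l - 1 + sum_list us)" using card_V(2) by linarith
  hence W: "W * (X * X ^ (2 * l - 1 + sum_list us)) = A * (\<kappa> * (\<kappa> + real (2 * l - 1 + sum_list us)) * X ^ N)"
    using class_weight[OF assms(2,3), of \<kappa>] unfolding W_def X_def A_def by (simp only: power_Suc)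
  have Z: "Z * X = \<kappa> * X ^ N" using total_weight[of \<kappa> N] by (simp add: Z_def X_def)
  have Z0: "Z > 0" using Z X assms(1) by (metis mult_pos_pos zero_less_power zero_less_mult_pos2)
  \<comment> \<open>Both weights carry the factor \<open>\<kappa> * X ^ N\<close>, which cancels in
    the quotient.\<close>
  have "W * X ^ (2 * l - 1 + sum_list us) * X = A * (\<kappa> + real (2 * l - 1 + sum_list us)) * (Z * X)"
    unfolding Z using W by (simp only: mult_ac)
  hence "W * X ^ (2 * l - 1 + sum_list us) = A * (\<kappa> + real (2 * l - 1 + sum_list us)) * Z" using X by simp
  hence "W / Z = (\<kappa> + real (2 * l - 1 + sum_list us)) * (A / X ^ (2 * l - 1 + sum_list us))"
    using X Z0 by (simp add: field_simps)
  thus ?thesis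
    unfolding prob_tree_law[OF assms(1)] acoef_def W_def[symmetric] Z_def[symmetric] X_def[symmetric] A_def[symmetric] .
qed

text \<open>The probability in \<open>class_prob\<close> depends on \<open>us\<close> only through
  its sum \<open>m\<close>, so the vectors are grouped by \<open>m\<close>; stars and bars counts
  those with a given sum.\<close>

lemma (in binary_tree) class_prob_total:
  assumes "\<kappa> > 0" "l \<le> N"
  shows "measure_pmf.prob (tree_law N \<kappa>) {T. Q_class l T = tree_class l (pgraph V p)}
    = (\<Sum>m\<le>N. real ((m + (2 * l - 2)) choose (2 * l - 2)) * ((\<kappa> + real (2 * l - 1 + m)) * acoef \<kappa> l N m))"
proof -
  define P where "P m = (\<kappa> + real (2 * l - 1 + m)) * acoef \<kappa> l N m" for m
  define Z where "Z = (\<Sum>f\<in>parent_funs N. wt \<kappa> N f)"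
  let ?W = "\<lambda>us. \<Sum>f | f \<in> parent_funs N \<and> Q_class l (pedges {1..N} f) = tree_class l (pgraph V p)
      \<and> u_vec l (pedges {1..N} f) = us. wt \<kappa> N f"
  let ?U = "{us::nat list. length us = 2 * l - 1 \<and> sum_list us \<le> N}"
  let ?Um = "\<lambda>m. {us::nat list. length us = 2 * l - 1 \<and> sum_list us = m}"
  have fin: "finite (?Um m)" for m
  proof (rule finite_subset)
    show "?Um m \<subseteq> {us. set us \<subseteq> {0..m} \<and> length us = 2 * l - 1}" using member_le_sum_list by fastforce
  qed (simp add: finite_lists_length_eq)
  have "measure_pmf.prob (tree_law N \<kappa>) {T. Q_class l T = tree_class l (pgraph V p)} = (\<Sum>us\<in>?U. ?W us) / Z"
    unfolding prob_tree_law[OF assms(1)] class_weight_total[OF assms(2)] Z_def ..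
  also have "\<dots> = (\<Sum>us\<in>?U. ?W us / Z)" by (rule sum_divide_distrib)
  also have "\<dots> = (\<Sum>us\<in>?U. P (sum_list us))"
  proof (rule sum.cong[OF refl])
    fix us assume "us \<in> ?U"
    hence "length us = 2 * l - 1" by simp
    from class_prob[OF assms this] show "?W us / Z = P (sum_list us)"
      unfolding prob_tree_law[OF assms(1)] P_def Z_def .
  qed
  also have "?U = (\<Union>m\<in>{..N}. ?Um m)" by auto
  also have "(\<Sum>us\<in>(\<Union>m\<in>{..N}. ?Um m). P (sum_list us)) = (\<Sum>m\<le>N. \<Sum>us\<in>?Um m. P (sum_list us))"
    by (rule sum.UNION_disjoint) (use fin in auto)
  also have "\<dots> = (\<Sum>m\<le>N. real ((m + (2 * l - 2)) choose (2 * l - 2)) * P m)"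
  proof (rule sum.cong[OF refl])
    fix m
    have "(\<Sum>us\<in>?Um m. P (sum_list us)) = (\<Sum>us\<in>?Um m. P m)" by (rule sum.cong) auto
    also have "\<dots> = real (card (?Um m)) * P m" by simp
    also have "card (?Um m) = (m + (2 * l - 1) - 1) choose m" by (rule card_length_sum_list)
    also have "m + (2 * l - 1) - 1 = m + (2 * l - 2)" using card_V(2) by linarith
    also have "(m + (2 * l - 2)) choose m = (m + (2 * l - 2)) choose (2 * l - 2)"
      by (subst binomial_symmetric) auto
    finally show "(\<Sum>us\<in>?Um m. P (sum_list us)) = real ((m + (2 * l - 2)) choose (2 * l - 2)) * P m" .
  qed
  finally show ?thesis unfolding P_def .
qed

lemma sum_list_floor_limit:
  assumes "\<forall>x\<in>set t. x \<ge> (0::real)"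
  shows "(\<lambda>N. real (sum_list (map (\<lambda>x. nat \<lfloor>x * sqrt (real N)\<rfloor>) t)) / sqrt (real N)) \<longlonglongrightarrow> sum_list t"
  using assms
proof (induction t)
  case (Cons x t)
  have "(\<lambda>N. real_of_int \<lfloor>x * sqrt (real N)\<rfloor> / sqrt (real N)) \<longlonglongrightarrow> x"
  proof (rule tendsto_sandwich)
    show "(\<lambda>N. x - 1 / sqrt (real N)) \<longlonglongrightarrow> x" by real_asymp
    show "(\<lambda>_. x) \<longlonglongrightarrow> x" by simp
    show "\<forall>\<^sub>F N in sequentially. x - 1 / sqrt (real N) \<le> real_of_int \<lfloor>x * sqrt (real N)\<rfloor> / sqrt (real N)"
      using eventually_gt_at_top[of 0]
    proof eventually_elim
      case (elim N)
      have "x * sqrt (real N) - 1 \<le> real_of_int \<lfloor>x * sqrt (real N)\<rfloor>" by linarith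
      hence "(x * sqrt (real N) - 1) / sqrt (real N) \<le> real_of_int \<lfloor>x * sqrt (real N)\<rfloor> / sqrt (real N)"
        by (rule divide_right_mono) simp
      thus ?case using elim by (simp add: diff_divide_distrib)
    qed
    show "\<forall>\<^sub>F N in sequentially. real_of_int \<lfloor>x * sqrt (real N)\<rfloor> / sqrt (real N) \<le> x"
      using eventually_gt_at_top[of 0]
      by eventually_elim (simp add: divide_le_eq)
  qed
  moreover have "real (nat \<lfloor>x * sqrt (real N)\<rfloor>) = real_of_int \<lfloor>x * sqrt (real N)\<rfloor>" for N
    using Cons.prems by (simp add: of_nat_nat)
  ultimately have "(\<lambda>N. real (nat \<lfloor>x * sqrt (real N)\<rfloor>) / sqrt (real N)) \<longlonglongrightarrow> x" by simp
  from tendsto_add[OF this Cons.IH] Cons.prems show ?case by (simp add: add_divide_distrib)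
qed simp

lemma class_prob_limit:
  assumes "\<kappa> > 0" "l \<ge> 1" "\<alpha> \<in> binary_classes l"
  shows "(\<lambda>N. measure_pmf.prob (tree_law N \<kappa>) {T. Q_class l T = \<alpha>}) \<longlonglongrightarrow> 1 / real (num_binary l)"
proof -
  obtain V p where b: "binary_tree l V p" and \<alpha>: "\<alpha> = tree_class l (pgraph V p)"
    using assms(3) unfolding binary_classes_iff by blast
  have "real (num_binary l) = (\<Prod>t=1..l-1. 2 * real t - 1)"
    unfolding num_binary_eq(2)[OF assms(2)] of_nat_prod by (rule prod.cong) (auto simp: of_nat_diff)
  hence "(\<lambda>N. \<Sum>m\<le>N. real ((m + (2 * l - 2)) choose (2 * l - 2)) * ((\<kappa> + real (2 * l - 1 + m)) * acoef \<kappa> l N m))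
    \<longlonglongrightarrow> 1 / real (num_binary l)"
    using total_limit[OF assms(1,2)] by simp
  moreover have "\<forall>\<^sub>F N in sequentially. (\<Sum>m\<le>N. real ((m + (2 * l - 2)) choose (2 * l - 2)) * ((\<kappa> + real (2 * l - 1 + m)) * acoef \<kappa> l N m))
    = measure_pmf.prob (tree_law N \<kappa>) {T. Q_class l T = \<alpha>}"
    using eventually_ge_at_top[of l]
    by eventually_elim (simp only: binary_tree.class_prob_total[OF b assms(1)] \<alpha>)
  ultimately show ?thesis by (rule Lim_transform_eventually)
qed

lemma class_local_limit:
  assumes "\<kappa> > 0" "l \<ge> 1" "\<alpha> \<in> binary_classes l" "length t = 2 * l - 1" "\<forall>x\<in>set t. x \<ge> (0::real)"
  shows "(\<lambda>N. real N powr ((2 * real l - 1) / 2) *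
           measure_pmf.prob (tree_law N \<kappa>)
             {T. Q_class l T = \<alpha> \<and> u_vec l T = map (\<lambda>x. nat \<lfloor>x * sqrt (real N)\<rfloor>) t})
        \<longlonglongrightarrow> sum_list t * exp (- ((sum_list t)\<^sup>2 / 2))"
proof -
  obtain V p where b: "binary_tree l V p" and \<alpha>: "\<alpha> = tree_class l (pgraph V p)"
    using assms(3) unfolding binary_classes_iff by blast
  define us where "us N = map (\<lambda>x. nat \<lfloor>x * sqrt (real N)\<rfloor>) t" for N
  have len: "length (us N) = 2 * l - 1" for N using assms(4) by (simp add: us_def)
  have "(\<lambda>N. real N powr ((2 * real l - 1) / 2) * ((\<kappa> + real (2 * l - 1 + sum_list (us N))) * acoef \<kappa> l N (sum_list (us N))))
    \<longlonglongrightarrow> sum_list t * exp (- ((sum_list t)\<^sup>2 / 2))"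
    by (rule local_limit[OF assms(1,2)]) (use sum_list_floor_limit[OF assms(5)] in \<open>simp only: us_def\<close>)
  moreover have "\<forall>\<^sub>F N in sequentially.
      real N powr ((2 * real l - 1) / 2) * ((\<kappa> + real (2 * l - 1 + sum_list (us N))) * acoef \<kappa> l N (sum_list (us N)))
    = real N powr ((2 * real l - 1) / 2) * measure_pmf.prob (tree_law N \<kappa>) {T. Q_class l T = \<alpha> \<and> u_vec l T = us N}"
    using eventually_ge_at_top[of l]
    by eventually_elim (simp only: binary_tree.class_prob[OF b assms(1) _ len] \<alpha>)
  ultimately have "(\<lambda>N. real N powr ((2 * real l - 1) / 2) * measure_pmf.prob (tree_law N \<kappa>) {T. Q_class l T = \<alpha> \<and> u_vec l T = us N})
    \<longlonglongrightarrow> sum_list t * exp (- ((sum_list t)\<^sup>2 / 2))"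
    by (rule Lim_transform_eventually)
  thus ?thesis unfolding us_def .
qed

text \<open>Distinct classes are disjoint events, and each binary class forces every element of
  \<open>{1..l}\<close> to be a leaf. Since the probability of each class tends to the reciprocal of
  the number of classes, this lower bound tends to \<open>1\<close>.\<close>

lemma L_star_prob_ge:
  assumes "\<kappa> > 0" "l \<ge> 1" "l \<le> N"
  shows "(\<Sum>\<alpha>\<in>binary_classes l. measure_pmf.prob (tree_law N \<kappa>) {T. Q_class l T = \<alpha>})
    \<le> measure_pmf.prob (tree_law N \<kappa>) {T. L_star l T = {1..l}}"
proof -
  define Z where "Z = (\<Sum>f\<in>parent_funs N. wt \<kappa> N f)"
  have w: "wt \<kappa> N f \<ge> 0" for f using assms(1) by (simp add: wt_def)
  let ?A = "\<lambda>\<alpha>. {f. f \<in> parent_funs N \<and> Q_class l (pedges {1..N} f) = \<alpha>}"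
  have "(\<Sum>\<alpha>\<in>binary_classes l. measure_pmf.prob (tree_law N \<kappa>) {T. Q_class l T = \<alpha>})
    = (\<Sum>\<alpha>\<in>binary_classes l. \<Sum>f\<in>?A \<alpha>. wt \<kappa> N f) / Z"
    unfolding prob_tree_law[OF assms(1)] Z_def sum_divide_distrib ..
  also have "(\<Sum>\<alpha>\<in>binary_classes l. \<Sum>f\<in>?A \<alpha>. wt \<kappa> N f) = (\<Sum>f\<in>(\<Union>\<alpha>\<in>binary_classes l. ?A \<alpha>). wt \<kappa> N f)"
    by (rule sum.UNION_disjoint[symmetric]) (use num_binary_eq(1)[OF assms(2)] finite_parent_funs in auto)
  also have "\<dots> / Z \<le> (\<Sum>f | f \<in> parent_funs N \<and> L_star l (pedges {1..N} f) = {1..l}. wt \<kappa> N f) / Z"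
  proof (intro divide_right_mono sum_mono2)
    show "finite {f. f \<in> parent_funs N \<and> L_star l (pedges {1..N} f) = {1..l}}" using finite_parent_funs by simp
    show "(\<Union>\<alpha>\<in>binary_classes l. ?A \<alpha>) \<subseteq> {f. f \<in> parent_funs N \<and> L_star l (pedges {1..N} f) = {1..l}}"
    proof
      fix f assume "f \<in> (\<Union>\<alpha>\<in>binary_classes l. ?A \<alpha>)"
      hence f: "f \<in> parent_funs N" "Q_class l (pedges {1..N} f) \<in> binary_classes l" by auto
      then obtain V p where "binary_tree l V p" "Q_class l (pedges {1..N} f) = tree_class l (pgraph V p)"
        unfolding binary_classes_iff by blast
      thus "f \<in> {f. f \<in> parent_funs N \<and> L_star l (pedges {1..N} f) = {1..l}}"
        using binary_tree.class_imp_u_vec(3)[OF _ assms(3) f(1)] f(1) by blast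
    qed
  qed (use w in \<open>auto simp: Z_def intro: sum_nonneg\<close>)
  finally show ?thesis unfolding prob_tree_law[OF assms(1)] Z_def .
qed

theorem theorem1:
  fixes \<kappa> :: real and l :: nat
  assumes "\<kappa> > 0" and "l \<ge> 1"
  shows "((\<lambda>N. measure_pmf.prob (tree_law N \<kappa>) {T. L_star l T = {1..l}}) \<longlonglongrightarrow> 1) \<and>
    num_binary l = (\<Prod>i=1..l-1. 2 * i - 1) \<and>
    (\<forall>\<alpha> \<in> binary_classes l.
      (\<lambda>N. measure_pmf.prob (tree_law N \<kappa>) {T. Q_class l T = \<alpha>})
        \<longlonglongrightarrow> 1 / real (num_binary l)) \<and>
    (\<forall>\<alpha> \<in> binary_classes l. \<forall>t :: real list.
      length t = 2 * l - 1 \<longrightarrow> (\<forall>x \<in> set t. x \<ge> 0) \<longrightarrow>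
      (\<lambda>N. real N powr ((2 * real l - 1) / 2) *
           measure_pmf.prob (tree_law N \<kappa>)
             {T. Q_class l T = \<alpha> \<and> u_vec l T = map (\<lambda>x. nat \<lfloor>x * sqrt (real N)\<rfloor>) t})
        \<longlonglongrightarrow> sum_list t * exp (- ((sum_list t)\<^sup>2 / 2)))"
proof -
  have "num_binary l > 0" unfolding num_binary_eq(2)[OF assms(2)] by (intro prod_pos) auto
  hence "(\<lambda>N. \<Sum>\<alpha>\<in>binary_classes l. measure_pmf.prob (tree_law N \<kappa>) {T. Q_class l T = \<alpha>}) \<longlonglongrightarrow> 1"
    using tendsto_sum[OF class_prob_limit[OF assms], where I = "binary_classes l"]
    by (simp add: num_binary_def)
  hence "(\<lambda>N. measure_pmf.prob (tree_law N \<kappa>) {T. L_star l T = {1..l}}) \<longlonglongrightarrow> 1"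
  proof (rule tendsto_sandwich[rotated 2, OF _ tendsto_const])
    show "\<forall>\<^sub>F N in sequentially. (\<Sum>\<alpha>\<in>binary_classes l. measure_pmf.prob (tree_law N \<kappa>) {T. Q_class l T = \<alpha>})
      \<le> measure_pmf.prob (tree_law N \<kappa>) {T. L_star l T = {1..l}}"
      using eventually_ge_at_top[of l] by eventually_elim (rule L_star_prob_ge[OF assms])
  qed simp
  thus ?thesis
    using num_binary_eq(2)[OF assms(2)] class_prob_limit[OF assms] class_local_limit[OF assms] by blast
qed

end
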